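(* Let $T\in PO(1,n)$, $r=\dim V_t$, and $T_s=T|_{V_s}$. Then: (a) if $T$ is elliptic, $\Gamma_T(k)\cong\bigsqcup_{k_1+k_2=k}\mathrm{Gr}_{k_1}(\mathbb H^{r-1})\times S_{T_s}(k_2)$; (b) if $T$ is parabolic, $\Gamma_T(0)=\Gamma_T(1)=\emptyset$ and for $k\ge2$, $\Gamma_T(k)\cong\bigsqcup_{k_1+k_2=k-2}\mathrm{Gr}_{k_1}(\mathbb E^{r-3})\times S_{T_s}(k_2)$; (c) if $T$ is hyperbolic, $\Gamma_T(0)=\emptyset$ and $\Gamma_T(k)\cong S_{T_s}(k-1)$ for $k\ge1$.
   Context: $Q(x,y)=-x_0y_0+\sum_{i=1}^nx_iy_i$ on $\mathbb R^{n+1}$; $PO(1,n)$ its proper isometries. For $T\in PO(1,n)$: $V_s$ is the sum of real primary components of $T$ (spaces $\ker p(T)^N$ for irreducible factors $p$ of the characteristic polynomial) on which $Q$ is positive definite, $V_t$ the sum of the others. $T$ is elliptic if $T|_{V_t}=\mathrm{id}$, parabolic if $T|_{V_t}$ is unipotent $\ne\mathrm{id}$, hyperbolic otherwise. $\Gamma_T(k)$ is the set of $(k+1)$-dimensional linear subspaces $U$ with $T(U)=U$ containing a vector $v$ with $Q(v)<0$ (equivalently, $T$-invariant totally geodesic $\mathbb H^k\subseteq\mathbb H^n$). $\mathrm{Gr}_j(\mathbb H^m)$: space of $j$-dimensional totally geodesic subspaces of $\mathbb H^m$ ($=\mathbb H^m$ for $j=0$, empty if $j>m$); $\mathrm{Gr}_j(\mathbb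 E^m)$: space of $j$-dimensional affine subspaces of $\mathbb E^m$; $S_B(k)$: set of $k$-dimensional $B$-invariant linear subspaces of $V_s$. *)

theory Defs
  imports "HOL-Analysis.Analysis" "HOL-Computational_Algebra.Polynomial"
begin

text \<open>Ambient space R^{n+1} is modelled as real^'n for a finite type 'n with a
  distinguished (time) coordinate i0; thus n + 1 = CARD('n).\<close>

definition lform :: "'n::finite \<Rightarrow> real^'n \<Rightarrow> real^'n \<Rightarrow> real" where
  "lform i0 x y = - (x$i0 * y$i0) + (\<Sum>i\<in>UNIV - {i0}. x$i * y$i)"

text \<open>PO(1,n): linear maps preserving Q and the upper sheet (time orientation),
  i.e. the isometry group O^+(1,n) of hyperbolic space.\<close>
definition PO :: "'n::finite \<Rightarrow> (real^'n \<Rightarrow> real^'n) \<Rightarrow> bool" where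
  "PO i0 T \<longleftrightarrow> linear T \<and> (\<forall>x y. lform i0 (T x) (T y) = lform i0 x y)
     \<and> (\<forall>x. lform i0 x x < 0 \<and> x$i0 > 0 \<longrightarrow> (T x)$i0 > 0)"

definition charpoly :: "(real^'n::finite \<Rightarrow> real^'n) \<Rightarrow> real poly" where
  "charpoly T = det (\<chi> i j. (if i = j then [:0, 1:] else 0) - [:matrix T $ i $ j:])"

definition poly_op :: "real poly \<Rightarrow> (real^'n::finite \<Rightarrow> real^'n) \<Rightarrow> real^'n \<Rightarrow> real^'n" where
  "poly_op p T = (\<lambda>x. \<Sum>i\<le>degree p. coeff p i *\<^sub>R (T ^^ i) x)"

definition primary_comp :: "real poly \<Rightarrow> (real^'n::finite \<Rightarrow> real^'n) \<Rightarrow> (real^'n) set" where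
  "primary_comp p T = {x. \<exists>N. (poly_op p T ^^ N) x = 0}"

definition primary_factors :: "(real^'n::finite \<Rightarrow> real^'n) \<Rightarrow> real poly set" where
  "primary_factors T = {p. irreducible p \<and> lead_coeff p = 1 \<and> p dvd charpoly T}"

definition pos_def_on :: "'n::finite \<Rightarrow> (real^'n) set \<Rightarrow> bool" where
  "pos_def_on i0 W \<longleftrightarrow> (\<forall>x\<in>W. x \<noteq> 0 \<longrightarrow> lform i0 x x > 0)"

definition Vs :: "'n::finite \<Rightarrow> (real^'n \<Rightarrow> real^'n) \<Rightarrow> (real^'n) set" where
  "Vs i0 T = span (\<Union>{primary_comp p T | p. p \<in> primary_factors T \<and> pos_def_on i0 (primary_comp p T)})"

definition Vt :: "'n::finite \<Rightarrow> (real^'n \<Rightarrow> real^'n) \<Rightarrow> (real^'n) set" where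
  "Vt i0 T = span (\<Union>{primary_comp p T | p. p \<in> primary_factors T \<and> \<not> pos_def_on i0 (primary_comp p T)})"

definition elliptic :: "'n::finite \<Rightarrow> (real^'n \<Rightarrow> real^'n) \<Rightarrow> bool" where
  "elliptic i0 T \<longleftrightarrow> (\<forall>x\<in>Vt i0 T. T x = x)"

definition unipotent_on :: "(real^'n::finite) set \<Rightarrow> (real^'n \<Rightarrow> real^'n) \<Rightarrow> bool" where
  "unipotent_on V T \<longleftrightarrow> (\<exists>N. \<forall>x\<in>V. ((\<lambda>y. T y - y) ^^ N) x = 0)"

definition parabolic :: "'n::finite \<Rightarrow> (real^'n \<Rightarrow> real^'n) \<Rightarrow> bool" where
  "parabolic i0 T \<longleftrightarrow> unipotent_on (Vt i0 T) T \<and> \<not> elliptic i0 T"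

definition hyperbolic :: "'n::finite \<Rightarrow> (real^'n \<Rightarrow> real^'n) \<Rightarrow> bool" where
  "hyperbolic i0 T \<longleftrightarrow> \<not> elliptic i0 T \<and> \<not> parabolic i0 T"

definition GammaT :: "'n::finite \<Rightarrow> (real^'n \<Rightarrow> real^'n) \<Rightarrow> nat \<Rightarrow> (real^'n) set set" where
  "GammaT i0 T k = {U. subspace U \<and> dim U = k + 1 \<and> T ` U = U \<and> (\<exists>v\<in>U. lform i0 v v < 0)}"

definition S_inv :: "(real^'n::finite) set \<Rightarrow> (real^'n \<Rightarrow> real^'n) \<Rightarrow> nat \<Rightarrow> (real^'n) set set" where
  "S_inv V B k = {W. subspace W \<and> W \<subseteq> V \<and> dim W = k \<and> B ` W \<subseteq> W}"

text \<open>Gr_j(H^m): model R^{1,m} = real^'m with time coordinate m0, CARD('m) = m + 1;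
  j-dim totally geodesic subspaces = (j+1)-dim linear subspaces containing a timelike vector.\<close>
definition GrH :: "'m::finite \<Rightarrow> nat \<Rightarrow> (real^'m) set set" where
  "GrH m0 j = {U. subspace U \<and> dim U = j + 1 \<and> (\<exists>v\<in>U. lform m0 v v < 0)}"

text \<open>Gr_j(E^m): via homogenisation, R^{m+1} = real^'m with homogenising coordinate p0,
  CARD('m) = m + 1; j-dim affine subspaces of E^m = {x$p0 = 1} correspond to
  (j+1)-dim linear subspaces not contained in {x$p0 = 0}.\<close>
definition GrE :: "'m::finite \<Rightarrow> nat \<Rightarrow> (real^'m) set set" where
  "GrE p0 j = {U. subspace U \<and> dim U = j + 1 \<and> \<not> U \<subseteq> {x. x$p0 = 0}}"

text \<open>Topology on a set of linear subspaces: the Grassmannian topology, pulled back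
  via the matrix of the orthogonal projection.\<close>
definition subsp_top :: "(real^'n::finite) set set \<Rightarrow> (real^'n) set topology" where
  "subsp_top S = pullback_topology S (\<lambda>U. matrix (closest_point U)) euclidean"

end

theory Submission
  imports Defs "HOL-Computational_Algebra.Polynomial_Factorial" "HOL-Computational_Algebra.Field_as_Ring"
begin

text \<open>By Brouwer's theorem, applied to the disc of forward causal directions, \<open>T\<close> has a causal
  eigenvector \<open>w\<close> with eigenvalue \<open>l > 0\<close>. If \<open>l \<noteq> 1\<close>, then \<open>w\<close> is null and, together with a null
  eigenvector for \<open>1 / l\<close>, spans \<open>V\<^sub>t\<close>; if \<open>l = 1\<close>, then \<open>V\<^sub>t\<close> is the generalised eigenspace for 1.
  In both cases the orthogonal complement of that space is positive definite and, as every vector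
  lies in a sum of primary components, equals \<open>V\<^sub>s\<close>. An operator \<open>g(T)\<close> that kills \<open>V\<^sub>t\<close> and is
  injective on \<open>V\<^sub>s\<close> splits every invariant subspace along \<open>V\<^sub>t \<oplus> V\<^sub>s\<close>.

  Every invariant subspace with a timelike vector contains the following subspace \<open>C \<subseteq> V\<^sub>t\<close>:
  it is \<open>0\<close> in the elliptic case, the plane spanned by \<open>w\<close> and \<open>T v - v\<close> (for any \<open>v \<in> V\<^sub>t\<close> not
  orthogonal to \<open>w\<close>) in the parabolic case, and \<open>V\<^sub>t\<close> in the hyperbolic case. An element of
  \<open>\<Gamma>\<^sub>T(k)\<close> is then a subspace of \<open>V\<^sub>t / C\<close> that is timelike, respectively not contained in a hyperplane, plus an invariant
  subspace of \<open>V\<^sub>s\<close>. The bijections are built from linear images and sums, under which families of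
  subspaces remain lower semicontinuous; for constant dimension lower semicontinuity amounts to
  continuity for the Grassmannian topology. Dimensions of lower semicontinuous families can only
  jump upwards nearby, so that strata on which the dimensions have constant sum are open.\<close>

section \<open>Orthogonal projections\<close>

text \<open>The numbers in the three cases come from one dimension count. In the elliptic and
  parabolic cases \<open>T\<close> acts as the identity on \<open>V\<^sub>t / C\<close>, so every
  subspace between \<open>C\<close> and \<open>V\<^sub>t\<close> is invariant and only the part in
  \<open>V\<^sub>s\<close> carries an invariance condition. The dimension \<open>k + 1\<close> of an
  invariant subspace splits as \<open>dim C + (k1 + 1) + k2\<close>, with \<open>dim C\<close> equal
  to 0 or 2. In the hyperbolic case \<open>dim C = 2\<close>, the quotient is 0, the middle term
  disappears and \<open>k2 = k - 1\<close>.

  Euclidean space enters in the parabolic case because the form does not descend to the quotient: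
  \<open>C\<close> contains a null vector \<open>w\<close>, and adding a multiple of
  \<open>w\<close> makes any vector not orthogonal to \<open>w\<close> timelike. What survives is
  the hyperplane orthogonal to \<open>w\<close>. In \<open>V\<^sub>t / C\<close>, of dimension
  \<open>r - 2\<close>, the subspaces not inside a hyperplane are the affine subspaces of a space of
  dimension \<open>r - 3\<close>.

  The topological obstacle is that the dimensions of the two components of \<open>U\<close> vary
  over the whole space of invariant subspaces, so each stratum must be shown open.\<close>

lemma closest_point_subspace_eqI:
  fixes S :: "'a::euclidean_space set"
  assumes "subspace S" "y \<in> S" "\<And>w. w \<in> S \<Longrightarrow> (x - y) \<bullet> w = 0"
  shows "closest_point S x = y"
proof (rule closest_point_unique[symmetric])
  show "convex S" "closed S"
    using assms(1) by (auto simp: subspace_imp_convex closed_subspace)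
  show "\<forall>z\<in>S. dist x y \<le> dist x z"
  proof
    fix z assume "z \<in> S"
    then have "(x - y) \<bullet> (y - z) = 0"
      using assms by (simp add: subspace_diff)
    then have "(norm (x - z))\<^sup>2 = (norm (x - y))\<^sup>2 + (norm (y - z))\<^sup>2"
      using norm_add_Pythagorean[of "x - y" "y - z"] by (simp add: orthogonal_def)
    then show "dist x y \<le> dist x z"
      by (simp add: dist_norm norm_le_square power2_norm_eq_inner[symmetric])
  qed
qed fact

context
  fixes S :: "'a::euclidean_space set"
  assumes S: "subspace S"
begin

lemma closest_point_subspace_in [simp]: "closest_point S x \<in> S"
  using closest_point_in_set[OF closed_subspace[OF S], of x] subspace_0[OF S] by blast

lemma closest_point_subspace_inner:
  assumes "w \<in> S" shows "(x - closest_point S x) \<bullet> w = 0"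
proof -
  obtain y z where yz: "y \<in> span S" "\<And>w. w \<in> span S \<Longrightarrow> orthogonal z w" "x = y + z"
    using orthogonal_subspace_decomp_exists by blast
  have "closest_point S x = y"
    using S yz by (intro closest_point_subspace_eqI) (auto simp: orthogonal_def span_eq_iff[THEN iffD2, OF S])
  with yz show ?thesis
    using assms by (simp add: orthogonal_def span_base)
qed

lemma linear_closest_point_subspace: "linear (closest_point S)"
proof (rule linearI)
  fix x y :: 'a and c :: real
  show "closest_point S (x + y) = closest_point S x + closest_point S y"
    using S closest_point_subspace_inner[of _ x] closest_point_subspace_inner[of _ y]
    by (intro closest_point_subspace_eqI) (auto simp: subspace_add inner_diff_left inner_add_left)
  show "closest_point S (c *\<^sub>R x) = c *\<^sub>R closest_point S x"
    using S closest_point_subspace_inner[of _ x]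
    by (intro closest_point_subspace_eqI) (auto simp: subspace_scale inner_diff_left)
qed

lemma closest_point_subspace_self: "x \<in> S \<Longrightarrow> closest_point S x = x"
  by (simp add: closest_point_self)

lemma closest_point_subspace_le: "w \<in> S \<Longrightarrow> norm (x - closest_point S x) \<le> norm (x - w)"
  using S closest_point_le[of S w x] by (simp add: closed_subspace dist_norm)

lemma closest_point_subspace_Pythagoras:
  "(norm x)\<^sup>2 = (norm (closest_point S x))\<^sup>2 + (norm (x - closest_point S x))\<^sup>2"
  using norm_add_Pythagorean[of "closest_point S x" "x - closest_point S x"]
    closest_point_subspace_inner[of "closest_point S x" x]
  by (simp add: orthogonal_def inner_commute)

lemma norm_closest_point_subspace_le: "norm (closest_point S x) \<le> norm x"
  by (rule power2_le_imp_le) (use closest_point_subspace_Pythagoras[of x] in auto)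

lemma norm_diff_closest_point_subspace_le: "norm (x - closest_point S x) \<le> norm x"
  by (rule power2_le_imp_le) (use closest_point_subspace_Pythagoras[of x] in auto)

end

text \<open>A vector killed by the projection is moved by its full norm, which \<open>d < 1\<close>
  permits only for 0.\<close>

lemma inj_on_closest_point_subspace:
  fixes A B :: "'a::euclidean_space set"
  assumes "subspace A" "subspace B" "d < 1"
    and d: "\<And>u. u \<in> A \<Longrightarrow> norm (u - closest_point B u) \<le> d * norm u"
  shows "inj_on (closest_point B) A"
proof -
  have "x = 0" if "x \<in> A" "closest_point B x = 0" for x
  proof (rule ccontr)
    assume "x \<noteq> 0"
    then show False
      using d[OF that(1)] that(2) assms(3) by simp
  qed
  then show ?thesis
    using assms linear_inj_on_iff_eq_0[of "closest_point B" A] linear_closest_point_subspace by blast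
qed

text \<open>Equal dimension makes one-sided closeness two-sided: the projection to \<open>B\<close>
  is injective on \<open>A\<close>, hence maps \<open>A\<close> onto \<open>B\<close>. Splitting
  \<open>v\<close> along \<open>B\<close> and its orthogonal complement costs \<open>2 * d\<close>
  on the first part and \<open>d\<close> on the second.\<close>

lemma norm_diff_closest_point_subspaces_le:
  fixes A B :: "'a::euclidean_space set"
  assumes AB: "subspace A" "subspace B" and dim: "dim A = dim B" and d: "0 \<le> d" "d \<le> 1/2"
    and close: "\<And>u. u \<in> A \<Longrightarrow> norm (u - closest_point B u) \<le> d * norm u"
  shows "norm (closest_point B v - closest_point A v) \<le> 3 * d * norm v"
proof -
  have lin: "linear (closest_point A)" "linear (closest_point B)"
    using AB by (auto intro: linear_closest_point_subspace)
  have inj: "inj_on (closest_point B) A"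
    using AB d close by (intro inj_on_closest_point_subspace[where d = d]) auto
  have onto: "closest_point B ` A = B"
  proof (rule subspace_dim_equal)
    show "subspace (closest_point B ` A)"
      using AB lin linear_subspace_image by blast
    show "dim B \<le> dim (closest_point B ` A)"
      using dim_image_eq[OF lin(2), of A] inj dim AB by (simp add: span_eq_iff[THEN iffD2])
  qed (use AB in auto)
  have 1: "norm (z - closest_point A z) \<le> 2 * d * norm z" if "z \<in> B" for z
  proof -
    obtain u where u: "u \<in> A" "z = closest_point B u"
      using onto \<open>z \<in> B\<close> by blast
    have "norm u \<le> norm z + norm (u - z)"
      by (metis norm_triangle_sub add.commute)
    moreover have "norm (u - z) \<le> d * norm u"
      using close u by auto
    moreover have "d * norm u \<le> 1/2 * norm u"
      using d by (intro mult_right_mono) auto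
    ultimately have "norm u \<le> 2 * norm z" "norm (u - z) \<le> d * norm u"
      by auto
    then have "norm (u - z) \<le> d * (2 * norm z)"
      using d mult_left_mono order_trans by blast
    then show ?thesis
      using closest_point_subspace_le[OF AB(1) u(1), of z] by (simp add: norm_minus_commute mult_ac)
  qed
  \<comment> \<open>As \<open>z\<close> is orthogonal to \<open>B\<close>, its inner product with
    its projection \<open>p\<close> to \<open>A\<close> sees only the part of \<open>p\<close> off
    \<open>B\<close>, and that part has norm at most \<open>d * norm p\<close>.\<close>
  have 2: "norm (closest_point A z) \<le> d * norm z" if z: "\<And>w. w \<in> B \<Longrightarrow> z \<bullet> w = 0" for z
  proof -
    let ?p = "closest_point A z"
    have "?p \<bullet> ?p = z \<bullet> ?p"
      using closest_point_subspace_inner[OF AB(1), of ?p z] AB by (simp add: inner_diff_left)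
    also have "\<dots> = z \<bullet> (?p - closest_point B ?p)"
      using z AB by (simp add: inner_diff_right)
    also have "\<dots> \<le> norm z * norm (?p - closest_point B ?p)"
      by (rule norm_cauchy_schwarz)
    also have "\<dots> \<le> norm z * (d * norm ?p)"
      using close AB by (intro mult_left_mono) auto
    finally have "norm ?p * norm ?p \<le> (d * norm z) * norm ?p"
      by (simp add: power2_norm_eq_inner[symmetric] power2_eq_square mult_ac)
    then show ?thesis
      using d by (cases "norm ?p = 0") (auto simp: mult_le_cancel_right)
  qed
  have "closest_point B v - closest_point A v =
      (closest_point B v - closest_point A (closest_point B v)) - closest_point A (v - closest_point B v)"
    by (simp add: linear_diff[OF lin(1)])
  also have "norm \<dots> \<le> 2 * d * norm (closest_point B v) + d * norm (v - closest_point B v)"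
    using AB closest_point_subspace_inner
    by (intro norm_triangle_le_diff add_mono 1 2) auto
  also have "\<dots> \<le> 2 * d * norm v + d * norm v"
    using AB d by (intro add_mono mult_left_mono norm_closest_point_subspace_le
        norm_diff_closest_point_subspace_le) auto
  finally show ?thesis by simp
qed

section \<open>Lower semicontinuous families of subspaces\<close>

text \<open>Lower semicontinuity of a set-valued map: vectors of \<open>F x\<close> are approximated
  in all nearby fibres, while nearby fibres may be larger. Unlike continuity, this survives a linear
  image whose dimension drops at special points.\<close>

definition lsc_family :: "'x topology \<Rightarrow> ('x \<Rightarrow> 'a::real_normed_vector set) \<Rightarrow> bool" where
  "lsc_family X F \<longleftrightarrow> (\<forall>x\<in>topspace X. \<forall>v\<in>F x. \<forall>e>0.
     \<exists>G. openin X G \<and> x \<in> G \<and> (\<forall>y\<in>G. \<exists>w\<in>F y. norm (w - v) < e))"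

lemma lsc_familyD:
  assumes "lsc_family X F" "x \<in> topspace X" "v \<in> F x" "e > 0"
  obtains G where "openin X G" "x \<in> G" "\<And>y. y \<in> G \<Longrightarrow> \<exists>w\<in>F y. norm (w - v) < e"
  using assms unfolding lsc_family_def by metis

lemma lsc_family_const: "lsc_family X (\<lambda>_. C)"
  unfolding lsc_family_def by (metis diff_self norm_zero openin_topspace)

lemma lsc_family_compose:
  assumes "continuous_map X Y g" "lsc_family Y F"
  shows "lsc_family X (\<lambda>x. F (g x))"
  unfolding lsc_family_def
proof (intro ballI allI impI)
  fix x v and e :: real
  assume "x \<in> topspace X" "v \<in> F (g x)" "e > 0"
  moreover from this have "g x \<in> topspace Y"
    using assms(1) continuous_map_image_subset_topspace by blast
  ultimately obtain G where G: "openin Y G" "g x \<in> G" "\<And>y. y \<in> G \<Longrightarrow> \<exists>w\<in>F y. norm (w - v) < e"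
    using lsc_familyD[OF assms(2)] by metis
  have "openin X {x \<in> topspace X. g x \<in> G}"
    using assms(1) G(1) openin_continuous_map_preimage by blast
  then show "\<exists>G. openin X G \<and> x \<in> G \<and> (\<forall>y\<in>G. \<exists>w\<in>F (g y). norm (w - v) < e)"
    using G \<open>x \<in> topspace X\<close> by (intro exI[of _ "{x \<in> topspace X. g x \<in> G}"]) auto
qed

lemma lsc_family_linear_image:
  fixes A :: "'a::euclidean_space \<Rightarrow> 'b::real_normed_vector"
  assumes "lsc_family X F" "linear A"
  shows "lsc_family X (\<lambda>x. A ` F x)"
  unfolding lsc_family_def
proof (intro ballI allI impI)
  fix x v and e :: real
  assume x: "x \<in> topspace X" and v: "v \<in> A ` F x" and e: "e > 0"
  obtain B where B: "B > 0" "\<And>u. norm (A u) \<le> B * norm u"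
    using linear_bounded_pos[OF assms(2)] by metis
  obtain u where u: "u \<in> F x" "v = A u"
    using v by auto
  have "e / B > 0"
    using e B by simp
  then obtain G where G: "openin X G" "x \<in> G" "\<And>y. y \<in> G \<Longrightarrow> \<exists>w\<in>F y. norm (w - u) < e / B"
    using lsc_familyD[OF assms(1) x u(1)] by metis
  have "\<exists>w\<in>A ` F y. norm (w - v) < e" if y: "y \<in> G" for y
  proof -
    obtain w where w: "w \<in> F y" "norm (w - u) < e / B"
      using G(3)[OF y] by blast
    have "norm (A w - A u) \<le> B * norm (w - u)"
      using B(2)[of "w - u"] by (simp add: linear_diff[OF assms(2)])
    also have "\<dots> < e"
      using w B by (simp add: field_simps)
    finally show ?thesis
      using w u by auto
  qed
  then show "\<exists>G. openin X G \<and> x \<in> G \<and> (\<forall>y\<in>G. \<exists>w\<in>A ` F y. norm (w - v) < e)"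
    using G by blast
qed

lemma lsc_family_sum:
  assumes "lsc_family X F" "lsc_family X H"
  shows "lsc_family X (\<lambda>x. {a + b |a b. a \<in> F x \<and> b \<in> H x})"
  unfolding lsc_family_def
proof (intro ballI allI impI)
  fix x v and e :: real
  assume x: "x \<in> topspace X" and v: "v \<in> {a + b |a b. a \<in> F x \<and> b \<in> H x}" and e: "e > 0"
  obtain a b where ab: "v = a + b" "a \<in> F x" "b \<in> H x"
    using v by auto
  have e2: "e / 2 > 0"
    using e by simp
  obtain G1 where G1: "openin X G1" "x \<in> G1" "\<And>y. y \<in> G1 \<Longrightarrow> \<exists>w\<in>F y. norm (w - a) < e / 2"
    using lsc_familyD[OF assms(1) x ab(2) e2] by metis
  obtain G2 where G2: "openin X G2" "x \<in> G2" "\<And>y. y \<in> G2 \<Longrightarrow> \<exists>w\<in>H y. norm (w - b) < e / 2"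
    using lsc_familyD[OF assms(2) x ab(3) e2] by metis
  have "\<exists>w\<in>{a + b |a b. a \<in> F y \<and> b \<in> H y}. norm (w - v) < e" if y: "y \<in> G1 \<inter> G2" for y
  proof -
    obtain a' b' where w: "a' \<in> F y" "b' \<in> H y" "norm (a' - a) < e / 2" "norm (b' - b) < e / 2"
      using G1(3)[of y] G2(3)[of y] y by blast
    have "norm (a' + b' - v) \<le> norm (a' - a) + norm (b' - b)"
      unfolding ab by (rule norm_diff_triangle_ineq)
    then have "norm (a' + b' - v) < e"
      using w by linarith
    then show ?thesis
      using w by blast
  qed
  then show "\<exists>G. openin X G \<and> x \<in> G \<and> (\<forall>y\<in>G. \<exists>w\<in>{a + b |a b. a \<in> F y \<and> b \<in> H y}. norm (w - v) < e)"
    using G1 G2 by (intro exI[of _ "G1 \<inter> G2"]) auto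
qed

text \<open>Approximating the finitely many vectors of an orthonormal basis of \<open>F x\<close>
  suffices, because the coordinates of \<open>u\<close> are bounded by
  \<open>norm u\<close>.\<close>

lemma lsc_family_uniform:
  fixes F :: "'x \<Rightarrow> 'a::euclidean_space set"
  assumes F: "lsc_family X F" and sub: "\<And>x. x \<in> topspace X \<Longrightarrow> subspace (F x)"
    and x: "x \<in> topspace X" and e: "e > 0"
  obtains G where "openin X G" "x \<in> G"
    "\<And>y u. y \<in> G \<Longrightarrow> u \<in> F x \<Longrightarrow> norm (u - closest_point (F y) u) \<le> e * norm u"
proof -
  obtain B where B: "B \<subseteq> F x" "pairwise orthogonal B" "\<And>b. b \<in> B \<Longrightarrow> norm b = 1"
    "independent B" "card B = dim (F x)" "span B = F x"
    using orthonormal_basis_subspace[OF sub[OF x]] by metis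
  have finB: "finite B"
    using B(4) independent_imp_finite by blast
  \<comment> \<open>The errors of \<open>card B\<close> basis vectors add up; the summand 1 keeps
    the denominator positive when \<open>F x\<close> is 0.\<close>
  define d where "d = e / (1 + card B)"
  have d: "d > 0"
    using e by (simp add: d_def add_pos_nonneg)
  have "\<forall>b\<in>B. \<exists>G. openin X G \<and> x \<in> G \<and> (\<forall>y\<in>G. \<exists>w\<in>F y. norm (w - b) < d)"
    using F x B(1) d unfolding lsc_family_def by blast
  then obtain G where G: "\<And>b. b \<in> B \<Longrightarrow> openin X (G b) \<and> x \<in> G b \<and> (\<forall>y\<in>G b. \<exists>w\<in>F y. norm (w - b) < d)"
    by metis
  \<comment> \<open>Intersecting with the whole space covers an empty basis, where the intersection
    of the \<open>G b\<close> is not a subset of \<open>X\<close>.\<close>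
  define H where "H = topspace X \<inter> \<Inter>(G ` B)"
  have "openin X H"
  proof (cases "B = {}")
    case False
    then have "openin X (\<Inter>(G ` B))"
      using G finB by (intro openin_Inter) auto
    then show ?thesis
      unfolding H_def by blast
  qed (simp add: H_def)
  moreover have "x \<in> H"
    using G x by (auto simp: H_def)
  moreover have "norm (u - closest_point (F y) u) \<le> e * norm u" if y: "y \<in> H" and u: "u \<in> F x" for y u
  proof -
    have "\<forall>b\<in>B. \<exists>w. w \<in> F y \<and> norm (w - b) < d"
      using G y unfolding H_def by blast
    then obtain w where w: "\<And>b. b \<in> B \<Longrightarrow> w b \<in> F y \<and> norm (w b - b) < d"
      by metis
    have suby: "subspace (F y)"
      using y sub by (auto simp: H_def)
    have u_eq: "u = (\<Sum>b\<in>B. (u \<bullet> b) *\<^sub>R b)"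
    proof -
      have "u \<in> span B"
        using u B by simp
      then obtain c where c: "u = (\<Sum>b\<in>B. c b *\<^sub>R b)"
        using span_finite[OF finB] by auto
      have "u \<bullet> b = c b" if "b \<in> B" for b
      proof -
        have "u \<bullet> b = (\<Sum>a\<in>B. c a * (a \<bullet> b))"
          unfolding c by (simp add: inner_sum_left)
        also have "\<dots> = (\<Sum>a\<in>B. if a = b then c a else 0)"
        proof (rule sum.cong)
          fix a assume "a \<in> B"
          then show "c a * (a \<bullet> b) = (if a = b then c a else 0)"
            using that B(2) B(3)[of b] by (auto simp: pairwise_def orthogonal_def norm_eq_1)
        qed simp
        also have "\<dots> = c b"
          using that finB by simp
        finally show ?thesis .
      qed
      with c show ?thesis by simp
    qed
    let ?z = "\<Sum>b\<in>B. (u \<bullet> b) *\<^sub>R w b"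
    have "?z \<in> F y"
      using suby w by (intro subspace_sum subspace_scale) auto
    then have "norm (u - closest_point (F y) u) \<le> norm (u - ?z)"
      using closest_point_subspace_le suby by blast
    also have "u - ?z = (\<Sum>b\<in>B. (u \<bullet> b) *\<^sub>R (b - w b))"
      by (subst u_eq) (simp add: sum_subtractf scaleR_diff_right)
    also have "norm \<dots> \<le> (\<Sum>b\<in>B. norm u * d)"
    proof (rule sum_norm_le)
      fix b assume b: "b \<in> B"
      have "\<bar>u \<bullet> b\<bar> \<le> norm u"
        using Cauchy_Schwarz_ineq2[of u b] B(3)[OF b] by simp
      moreover have "norm (b - w b) \<le> d"
        using w[OF b] by (simp add: norm_minus_commute)
      ultimately show "norm ((u \<bullet> b) *\<^sub>R (b - w b)) \<le> norm u * d"
        by (simp add: mult_mono)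
    qed
    also have "\<dots> = (card B * d) * norm u"
      by simp
    also have "\<dots> \<le> e * norm u"
      using e by (intro mult_right_mono) (simp_all add: d_def field_simps)
    finally show ?thesis .
  qed
  ultimately show ?thesis
    using that by blast
qed

text \<open>A nearby fibre \<open>F y\<close> contains the image of \<open>F x\<close> under a
  projection that is injective on \<open>F x\<close>.\<close>

lemma lsc_family_dim_ge:
  fixes F :: "'x \<Rightarrow> 'a::euclidean_space set"
  assumes F: "lsc_family X F" and sub: "\<And>x. x \<in> topspace X \<Longrightarrow> subspace (F x)"
  shows "openin X {x \<in> topspace X. d \<le> dim (F x)}"
proof (subst openin_subopen, intro ballI)
  fix x assume x: "x \<in> {x \<in> topspace X. d \<le> dim (F x)}"
  then obtain G where G: "openin X G" "x \<in> G"
    "\<And>y u. y \<in> G \<Longrightarrow> u \<in> F x \<Longrightarrow> norm (u - closest_point (F y) u) \<le> 1/2 * norm u"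
    using lsc_family_uniform[OF F sub, of x "1/2"] by auto
  have "d \<le> dim (F y)" if "y \<in> G" for y
  proof -
    have y: "y \<in> topspace X"
      using G(1) that openin_subset by blast
    have inj: "inj_on (closest_point (F y)) (F x)"
      using inj_on_closest_point_subspace[of "F x" "F y" "1/2"] sub x y G(3) that by auto
    have "d \<le> dim (F x)"
      using x by simp
    also have "\<dots> = dim (closest_point (F y) ` F x)"
      using inj sub x y
      by (intro dim_image_eq[symmetric] linear_closest_point_subspace)
         (auto simp: span_eq_iff[THEN iffD2])
    also have "\<dots> \<le> dim (F y)"
      using sub[OF y] by (intro dim_subset) auto
    finally show ?thesis .
  qed
  then show "\<exists>T. openin X T \<and> x \<in> T \<and> T \<subseteq> {x \<in> topspace X. d \<le> dim (F x)}"
    using G(1,2) openin_subset by (intro exI[of _ G]) blast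
qed

section \<open>The Grassmannian topology in terms of lower semicontinuous families\<close>

lemma topspace_subsp_top [simp]: "topspace (subsp_top S) = S"
  by (simp add: subsp_top_def topspace_pullback_topology)

lemma subtopology_subsp_top: "R \<subseteq> S \<Longrightarrow> subtopology (subsp_top S) R = subsp_top R"
  unfolding topology_eq openin_subtopology subsp_top_def openin_pullback_topology
  by (auto simp: Int_assoc inf_absorb2)

text \<open>The vector of \<open>W\<close> near \<open>v\<close> is the projection of
  \<open>v\<close> to \<open>W\<close>, which depends continuously on the projection matrix.\<close>

lemma lsc_family_subsp_top:
  assumes "\<And>U. U \<in> S \<Longrightarrow> subspace U"
  shows "lsc_family (subsp_top S) (\<lambda>U. U)"
  unfolding lsc_family_def
proof (intro ballI allI impI)
  fix U v and e :: real
  assume U: "U \<in> topspace (subsp_top S)" and v: "v \<in> U" and e: "e > 0"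
  have mv: "matrix (closest_point W) *v v = closest_point W v" if "W \<in> S" for W
    using matrix_vector_mul(2)[OF linear_closest_point_subspace[OF assms[OF that]]] by metis
  define G where "G = {M. norm (M *v v - v) < e}"
  have "continuous_on UNIV (\<lambda>M :: real^'a^'a. M *v v)"
    unfolding matrix_vector_mult_def by (intro continuous_intros)
  then have "open G"
    unfolding G_def by (intro open_Collect_less continuous_intros)
  then have "openin (subsp_top S) ((\<lambda>U. matrix (closest_point U)) -` G \<inter> S)"
    unfolding subsp_top_def openin_pullback_topology by auto
  moreover have "U \<in> (\<lambda>U. matrix (closest_point U)) -` G \<inter> S"
    using U v e mv[of U] by (simp add: G_def closest_point_self)
  moreover have "\<exists>w\<in>W. norm (w - v) < e" if "W \<in> (\<lambda>U. matrix (closest_point U)) -` G \<inter> S" for W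
    using that mv[of W] assms[of W] by (intro bexI[of _ "closest_point W v"]) (auto simp: G_def)
  ultimately show "\<exists>G. openin (subsp_top S) G \<and> U \<in> G \<and> (\<forall>y\<in>G. \<exists>w\<in>y. norm (w - v) < e)"
    by blast
qed

text \<open>The common dimension \<open>k\<close> is what upgrades lower semicontinuity to
  continuity: the one-sided approximation of \<open>F x\<close> by \<open>F y\<close> then controls
  the difference of the projections, and so every matrix entry.\<close>

lemma continuous_map_subsp_top:
  assumes F: "lsc_family X F" and im: "\<And>x. x \<in> topspace X \<Longrightarrow> F x \<in> S"
    and S: "\<And>U. U \<in> S \<Longrightarrow> subspace U \<and> dim U = k"
  shows "continuous_map X (subsp_top S) F"
  unfolding subsp_top_def
proof (rule continuous_map_pullback')
  have sub: "subspace (F x)" and dim: "dim (F x) = k" if "x \<in> topspace X" for x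
    using S im that by auto
  have comp: "continuous_map X euclidean (\<lambda>x. closest_point (F x) v)" for v
  proof -
    have "\<exists>G. openin X G \<and> x \<in> G \<and> (\<forall>y\<in>G. dist (closest_point (F y) v) (closest_point (F x) v) < e)"
      if x: "x \<in> topspace X" and e: "e > 0" for x e
    proof -
      \<comment> \<open>The bound \<open>1/2\<close> is required by the comparison of projections;
        the other one makes \<open>3 * d * norm v\<close> smaller than \<open>e\<close>, also for
        \<open>v = 0\<close>.\<close>
      define d where "d = min (1/2) (e / (3 * (1 + norm v)))"
      have n: "1 + norm v > 0"
        using norm_ge_zero[of v] by linarith
      then have d: "0 < d" "d \<le> 1/2" "d \<le> e / (3 * (1 + norm v))"
        using e unfolding d_def by (simp, metis min.cobounded1, metis min.cobounded2)
      obtain G where G: "openin X G" "x \<in> G"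
        "\<And>y u. y \<in> G \<Longrightarrow> u \<in> F x \<Longrightarrow> norm (u - closest_point (F y) u) \<le> d * norm u"
        using lsc_family_uniform[OF F sub x d(1)] by metis
      have "dist (closest_point (F y) v) (closest_point (F x) v) < e" if "y \<in> G" for y
      proof -
        have y: "y \<in> topspace X"
          using G(1) that openin_subset by blast
        have "norm (closest_point (F y) v - closest_point (F x) v) \<le> 3 * d * norm v"
          using sub dim x y d G(3) that by (intro norm_diff_closest_point_subspaces_le) auto
        also have "\<dots> < 3 * d * (1 + norm v)"
          using d by simp
        also have "\<dots> \<le> e"
          using d(3) n by (simp add: field_simps)
        finally show ?thesis
          by (simp add: dist_norm)
      qed
      then show ?thesis
        using G by blast
    qed
    then show ?thesis
      using Met_TC.continuous_map_to_metric[of X "\<lambda>x. closest_point (F x) v"]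
      by (force simp: dist_commute)
  qed
  have "continuous_map X euclidean (\<lambda>x. \<chi> i j. closest_point (F x) (axis j 1) $ i)"
  proof -
    have *: "continuous_map X euclidean f" if "\<And>i. continuous_map X euclidean (\<lambda>x. f x $ i)"
      for f :: "'a \<Rightarrow> 'c::real_normed_vector ^ 'd"
      using that unfolding continuous_map_atin limitin_canonical_iff
      by (auto intro!: vec_tendstoI)
    have "continuous_map X euclidean (\<lambda>x. closest_point (F x) (axis j 1) $ i)" for i j
      using comp[of "axis j 1"] unfolding continuous_map_atin limitin_canonical_iff
      by (auto intro!: tendsto_vec_nth)
    then show ?thesis
      by (intro *) simp
  qed
  then show "continuous_map X euclidean ((\<lambda>U. matrix (closest_point U)) \<circ> F)"
    by (simp add: matrix_def o_def)
  show "topspace X \<subseteq> F -` S"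
    using im by auto
qed

section \<open>Homeomorphisms onto disjoint sums\<close>

lemma continuous_map_from_sum_topology:
  assumes "\<And>i. i \<in> I \<Longrightarrow> continuous_map (X i) Y (\<lambda>x. f (i, x))"
  shows "continuous_map (sum_topology X I) Y f"
proof -
  have "openin (X i) {x. (i, x) \<in> {z \<in> Sigma I (topspace \<circ> X). f z \<in> W}}" if "i \<in> I" "openin Y W" for i W
  proof -
    have "{x. (i, x) \<in> {z \<in> Sigma I (topspace \<circ> X). f z \<in> W}} = {x \<in> topspace (X i). f (i, x) \<in> W}"
      using that by auto
    then show ?thesis
      using openin_continuous_map_preimage[OF assms[OF that(1)] that(2)] by simp
  qed
  moreover have "f z \<in> topspace Y" if "z \<in> Sigma I (topspace \<circ> X)" for z
    using that assms continuous_map_image_subset_topspace by fastforce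
  ultimately show ?thesis
    unfolding continuous_map_def by (auto simp: openin_sum_topology)
qed

text \<open>Openness of the pieces is used to glue the maps \<open>f i\<close> continuously; the
  inverse, defined on a disjoint sum, is continuous as soon as each \<open>g i\<close> is.\<close>

lemma homeomorphic_sum_topology:
  assumes cov: "topspace X = (\<Union>i\<in>I. R i)"
    and op: "\<And>i. i \<in> I \<Longrightarrow> openin X (R i)"
    and disj: "\<And>i j x. i \<in> I \<Longrightarrow> j \<in> I \<Longrightarrow> x \<in> R i \<Longrightarrow> x \<in> R j \<Longrightarrow> i = j"
    and homeo: "\<And>i. i \<in> I \<Longrightarrow> subtopology X (R i) homeomorphic_space Y i"
  shows "X homeomorphic_space sum_topology Y I"
proof -
  obtain f g where fg: "\<And>i. i \<in> I \<Longrightarrow> homeomorphic_maps (subtopology X (R i)) (Y i) (f i) (g i)"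
    using homeo unfolding homeomorphic_space_def by metis
  have ts: "topspace (subtopology X (R i)) = R i" if "i \<in> I" for i
    using cov that by auto
  have "\<exists>i. \<forall>x. x \<in> topspace X \<longrightarrow> x \<in> R (i x) \<and> i x \<in> I"
    using cov by (intro choice allI) auto
  then obtain idx where idx: "\<And>x. x \<in> topspace X \<Longrightarrow> x \<in> R (idx x) \<and> idx x \<in> I"
    by blast
  have idx_eq: "idx x = i" if "i \<in> I" "x \<in> R i" for x i
    using idx disj that cov by blast
  have cf: "continuous_map X (sum_topology Y I) (\<lambda>x. (idx x, f (idx x) x))"
    unfolding continuous_map_def
  proof (intro conjI allI impI)
    show "(\<lambda>x. (idx x, f (idx x) x)) \<in> topspace X \<rightarrow> topspace (sum_topology Y I)"
      using idx fg ts unfolding homeomorphic_maps_def continuous_map_def by fastforce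
    fix W assume W: "openin (sum_topology Y I) W"
    have "openin X {x \<in> R i. f i x \<in> {y. (i, y) \<in> W}}" if "i \<in> I" for i
    proof -
      have "openin (Y i) {y. (i, y) \<in> W}"
        using W that by (auto simp: openin_sum_topology)
      then have "openin (subtopology X (R i)) {x \<in> R i. f i x \<in> {y. (i, y) \<in> W}}"
        using openin_continuous_map_preimage[of "subtopology X (R i)" "Y i" "f i" "{y. (i, y) \<in> W}"]
          fg[OF that] unfolding homeomorphic_maps_def ts[OF that] by blast
      then show ?thesis
        using op[OF that] openin_trans_full by blast
    qed
    then have "openin X (\<Union>i\<in>I. {x \<in> R i. f i x \<in> {y. (i, y) \<in> W}})"
      by blast
    also have "(\<Union>i\<in>I. {x \<in> R i. f i x \<in> {y. (i, y) \<in> W}}) =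
        {x \<in> topspace X. (idx x, f (idx x) x) \<in> W}"
      using idx idx_eq cov by auto
    finally show "openin X {x \<in> topspace X. (idx x, f (idx x) x) \<in> W}" .
  qed
  have cg: "continuous_map (sum_topology Y I) X (\<lambda>(i, y). g i y)"
    using fg unfolding homeomorphic_maps_def
    by (intro continuous_map_from_sum_topology) (auto simp: continuous_map_in_subtopology)
  have "homeomorphic_maps X (sum_topology Y I) (\<lambda>x. (idx x, f (idx x) x)) (\<lambda>(i, y). g i y)"
    unfolding homeomorphic_maps_def
  proof (intro conjI cf cg ballI)
    fix x assume "x \<in> topspace X"
    then show "(case (idx x, f (idx x) x) of (i, y) \<Rightarrow> g i y) = x"
      using idx[of x] fg[of "idx x"] ts[of "idx x"] by (auto simp: homeomorphic_maps_def)
  next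
    fix z assume "z \<in> topspace (sum_topology Y I)"
    then obtain i y where z: "z = (i, y)" "i \<in> I" "y \<in> topspace (Y i)"
      by auto
    have "g i y \<in> R i"
      using fg[OF z(2)] z(3) ts[OF z(2)] unfolding homeomorphic_maps_def
      using continuous_map_image_subset_topspace by blast
    then show "(idx (case z of (i, y) \<Rightarrow> g i y), f (idx (case z of (i, y) \<Rightarrow> g i y)) (case z of (i, y) \<Rightarrow> g i y)) = z"
      using z idx_eq[OF z(2), of "g i y"] fg[OF z(2)] by (simp add: homeomorphic_maps_def)
  qed
  then show ?thesis
    unfolding homeomorphic_space_def by blast
qed

section \<open>Polynomials in an operator\<close>

lemma poly_op_pCons:
  assumes "linear T"
  shows "poly_op (pCons a p) T x = a *\<^sub>R x + T (poly_op p T x)"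
proof (cases "p = 0")
  case True
  then show ?thesis
    using linear_0[OF assms] by (cases "a = 0") (auto simp: poly_op_def)
next
  case False
  then have "poly_op (pCons a p) T x = (\<Sum>i\<le>Suc (degree p). coeff (pCons a p) i *\<^sub>R (T ^^ i) x)"
    by (simp add: poly_op_def)
  also have "\<dots> = a *\<^sub>R x + (\<Sum>i\<le>degree p. coeff p i *\<^sub>R T ((T ^^ i) x))"
    by (subst sum.atMost_Suc_shift) simp
  also have "\<dots> = a *\<^sub>R x + T (poly_op p T x)"
    by (simp add: poly_op_def linear_sum[OF assms] linear_cmul[OF assms])
  finally show ?thesis .
qed

lemma poly_op_0 [simp]: "poly_op 0 T x = 0"
  by (simp add: poly_op_def)

lemma poly_op_1 [simp]: "poly_op 1 T x = x"
  by (simp add: poly_op_def)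

lemma linear_poly_op:
  assumes "linear T" shows "linear (poly_op p T)"
proof (induction p)
  case 0
  show ?case by (simp add: poly_op_def linear_zero)
next
  case (pCons a p)
  have "poly_op (pCons a p) T = (\<lambda>x. a *\<^sub>R x + T (poly_op p T x))"
    by (simp add: fun_eq_iff poly_op_pCons[OF assms])
  then show ?case
    using linear_compose[OF pCons(2) assms] by (simp add: o_def linear_compose_add linear_scale_self)
qed

lemma poly_op_add:
  assumes "linear T"
  shows "poly_op (p + q) T x = poly_op p T x + poly_op q T x"
proof (induction p arbitrary: q)
  case (pCons a p)
  show ?case
  proof (cases q)
    case (pCons b q)
    then show ?thesis
      using pCons.IH[of q] by (simp add: poly_op_pCons[OF assms] linear_add[OF assms] scaleR_add_left)
  qed
qed simp

lemma poly_op_smult: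
  assumes "linear T"
  shows "poly_op (smult c p) T x = c *\<^sub>R poly_op p T x"
  by (induction p)
    (simp_all add: poly_op_pCons[OF assms] linear_cmul[OF assms] scaleR_add_right)

lemma poly_op_mult:
  assumes "linear T"
  shows "poly_op (p * q) T x = poly_op p T (poly_op q T x)"
  by (induction p)
    (simp_all add: poly_op_pCons[OF assms] poly_op_add[OF assms] poly_op_smult[OF assms])

lemma poly_op_power:
  assumes "linear T"
  shows "poly_op (p ^ N) T x = (poly_op p T ^^ N) x"
  by (induction N arbitrary: x) (simp_all add: poly_op_mult[OF assms])

lemma poly_op_monom: "poly_op (monom 1 k) T x = (T ^^ k) x"
proof -
  have "poly_op (monom 1 k) T x = (\<Sum>i\<le>k. if i = k then (T ^^ i) x else 0)"
    unfolding poly_op_def by (rule sum.cong) (auto simp: degree_monom_eq)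
  then show ?thesis by simp
qed

lemma poly_op_linear_factor:
  assumes "linear T"
  shows "poly_op [:- a, 1:] T x = T x - a *\<^sub>R x"
  by (simp add: poly_op_pCons[OF assms] linear_0[OF assms])

lemma poly_op_invariant:
  assumes "linear T" "subspace U" "T ` U \<subseteq> U" "x \<in> U"
  shows "poly_op p T x \<in> U"
proof -
  have "(T ^^ i) x \<in> U" for i
    by (induction i) (use assms in auto)
  then show ?thesis
    unfolding poly_op_def using assms by (intro subspace_sum subspace_scale) auto
qed

lemma poly_op_commute:
  assumes "linear T"
  shows "T (poly_op p T x) = poly_op p T (T x)"
proof -
  have "poly_op [:0, 1:] T y = T y" for y
    using poly_op_linear_factor[OF assms, of 0] by simp
  then show ?thesis
    using poly_op_mult[OF assms, of "[:0, 1:]" p x] poly_op_mult[OF assms, of p "[:0, 1:]" x]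
    by (simp add: mult.commute)
qed

lemma subspace_primary_comp:
  assumes "linear T" shows "subspace (primary_comp p T)"
proof (rule subspaceI)
  \<comment> \<open>The exponent in \<open>primary_comp\<close> depends on the vector. Kernels grow
    with it, so two vectors share the larger one.\<close>
  have mono: "(poly_op p T ^^ M) x = 0" if "(poly_op p T ^^ N) x = 0" "N \<le> M" for N M x
  proof -
    have "poly_op (p ^ (M - N) * p ^ N) T x = 0"
      using that(1) linear_0[OF linear_poly_op[OF assms]]
      by (simp add: poly_op_mult[OF assms] poly_op_power[OF assms, of p N])
    then show ?thesis
      using that(2) by (simp add: power_add[symmetric] poly_op_power[OF assms])
  qed
  have lin: "linear (poly_op p T ^^ N)" for N
    using linear_poly_op[OF assms, of "p ^ N"] poly_op_power[OF assms, of p N] ext by metis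
  show "0 \<in> primary_comp p T"
    by (auto simp: primary_comp_def intro: exI[of _ 0])
  fix x y assume "x \<in> primary_comp p T" "y \<in> primary_comp p T"
  then obtain N M where "(poly_op p T ^^ N) x = 0" "(poly_op p T ^^ M) y = 0"
    by (auto simp: primary_comp_def)
  then have "(poly_op p T ^^ max N M) x = 0" "(poly_op p T ^^ max N M) y = 0"
    using mono by (metis max.cobounded1, metis max.cobounded2)
  then show "x + y \<in> primary_comp p T"
    unfolding primary_comp_def using linear_add[OF lin] by (metis (mono_tags, lifting) add_0 mem_Collect_eq)
next
  fix c x assume "x \<in> primary_comp p T"
  moreover have lin: "linear (poly_op p T ^^ N)" for N
    using linear_poly_op[OF assms, of "p ^ N"] poly_op_power[OF assms, of p N] ext by metis
  ultimately show "c *\<^sub>R x \<in> primary_comp p T"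
    unfolding primary_comp_def using linear_cmul[OF lin] by auto
qed

section \<open>Irreducible factors of the characteristic polynomial\<close>

text \<open>The library version of this form of Cramer's rule requires a field.\<close>
lemma cramer_comm_ring:
  fixes M :: "'a::comm_ring_1^'n^'n"
  shows "det (\<chi> i j. if j = k then (M *v y) $ i else M $ i $ j) = y $ k * det M"
proof -
  let ?R = "\<lambda>i. row i (transpose M)"
  have "det (\<chi> i j. if j = k then (M *v y) $ i else M $ i $ j) =
      det (transpose (\<chi> i j. if j = k then (M *v y) $ i else M $ i $ j))"
    by simp
  also have "transpose (\<chi> i j. if j = k then (M *v y) $ i else M $ i $ j) =
      (\<chi> i. if i = k then (\<Sum>j\<in>UNIV. y $ j *s ?R j) else ?R i)"
    by (auto simp: vec_eq_iff transpose_def row_def matrix_vector_mult_def mult.commute)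
  also have "det \<dots> = (\<Sum>j\<in>UNIV. det (\<chi> i. if i = k then y $ j *s ?R j else ?R i))"
    by (rule det_linear_row_sum) simp
  also have "\<dots> = (\<Sum>j\<in>UNIV. y $ j * det (\<chi> i. if i = k then ?R j else ?R i))"
    by (simp add: det_row_mul)
  also have "\<dots> = (\<Sum>j\<in>UNIV. if j = k then y $ k * det M else 0)"
  proof (rule sum.cong)
    fix j
    show "y $ j * det (\<chi> i. if i = k then ?R j else ?R i) = (if j = k then y $ k * det M else 0)"
    proof (cases "j = k")
      case True
      have "(\<chi> i. if i = k then ?R k else ?R i) = transpose M"
        by (auto simp: vec_eq_iff row_def)
      then show ?thesis
        unfolding True by (simp only: det_transpose) simp
    next
      case False
      have "det (\<chi> i. if i = k then ?R j else ?R i) = 0"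
        by (rule det_identical_rows[OF False]) (use False in \<open>auto simp: vec_eq_iff row_def\<close>)
      then show ?thesis
        using False by simp
    qed
  qed simp
  finally show ?thesis by simp
qed

text \<open>The vector \<open>y\<close> is \<open>q(X, T) x\<close> for \<open>q(X, Y) = (p(X) - p(Y)) / (X - Y)\<close>.\<close>
lemma charmatrix_quotient:
  fixes T :: "real^'n::finite \<Rightarrow> real^'n"
  assumes "linear T"
  shows "\<exists>y. (\<forall>i. ((\<chi> i j. (if i = j then [:0, 1:] else 0) - [:matrix T $ i $ j:]) *v y) $ i =
        p * [:x $ i:] - [:poly_op p T x $ i:]) \<and>
      (\<forall>i j. degree p \<le> j \<longrightarrow> coeff (y $ i) j = 0) \<and>
      (degree p > 0 \<longrightarrow> (\<forall>i. coeff (y $ i) (degree p - 1) = lead_coeff p * x $ i))"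
    (is "\<exists>y. (\<forall>i. (?M *v y) $ i = _ i) \<and> _ y")
proof (induction p)
  case 0
  show ?case
    by (rule exI[of _ 0]) (simp add: matrix_vector_mult_0_right)
next
  case (pCons a p)
  show ?case
  proof (cases "p = 0")
    case True
    then show ?thesis
      using assms
      by (intro exI[of _ 0]) (auto simp: matrix_vector_mult_0_right poly_op_pCons linear_0)
  next
    case False
    obtain y where "(\<forall>i. (?M *v y) $ i = p * [:x $ i:] - [:poly_op p T x $ i:]) \<and>
      (\<forall>i j. degree p \<le> j \<longrightarrow> coeff (y $ i) j = 0) \<and>
      (degree p > 0 \<longrightarrow> (\<forall>i. coeff (y $ i) (degree p - 1) = lead_coeff p * x $ i))"
      using pCons(2) by (elim exE)
    then have y: "\<And>i. (?M *v y) $ i = p * [:x $ i:] - [:poly_op p T x $ i:]"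
      "\<And>i j. degree p \<le> j \<Longrightarrow> coeff (y $ i) j = 0"
      "degree p > 0 \<Longrightarrow> (\<forall>i. coeff (y $ i) (degree p - 1) = lead_coeff p * x $ i)"
      by simp_all
    let ?z = "poly_op p T x"
    let ?y = "\<chi> i. pCons (?z $ i) (y $ i)"
    have const: "(?M *v (\<chi> i. [:z $ i:])) $ i = [:0, 1:] * [:z $ i:] - [:T z $ i:]" for z i
    proof -
      have "(?M *v (\<chi> i. [:z $ i:])) $ i =
          (\<Sum>j\<in>UNIV. (if i = j then [:0, 1:] * [:z $ j:] else 0) - [:matrix T $ i $ j * z $ j:])"
        unfolding matrix_vector_mult_def vec_lambda_beta by (rule sum.cong) (auto simp: left_diff_distrib)
      also have "\<dots> = [:0, 1:] * [:z $ i:] - (\<Sum>j\<in>UNIV. [:matrix T $ i $ j * z $ j:])"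
        by (simp add: sum_subtractf)
      also have "(\<Sum>j\<in>UNIV. [:matrix T $ i $ j * z $ j:]) = [:\<Sum>j\<in>UNIV. matrix T $ i $ j * z $ j:]"
        by (simp add: sum_to_poly)
      also have "(\<Sum>j\<in>UNIV. matrix T $ i $ j * z $ j) = (matrix T *v z) $ i"
        by (simp add: matrix_vector_mult_def)
      also have "matrix T *v z = T z"
        using matrix_vector_mul(2)[OF assms] by metis
      finally show ?thesis .
    qed
    have split: "?y = [:0, 1:] *s y + (\<chi> i. [:?z $ i:])"
      by (simp add: vec_eq_iff)
    have "(?M *v ?y) $ i = pCons a p * [:x $ i:] - [:poly_op (pCons a p) T x $ i:]" for i
    proof -
      have "(?M *v ?y) $ i = [:0, 1:] * (?M *v y) $ i + (?M *v (\<chi> i. [:?z $ i:])) $ i"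
        unfolding split by (simp add: matrix_vector_mult_def sum.distrib sum_distrib_left distrib_left mult_ac)
      also have "\<dots> = [:0, 1:] * p * [:x $ i:] - [:T ?z $ i:]"
        unfolding y(1) const by (simp add: algebra_simps)
      also have "\<dots> = pCons a p * [:x $ i:] - [:poly_op (pCons a p) T x $ i:]"
        by (simp add: poly_op_pCons[OF assms])
      finally show ?thesis .
    qed
    moreover have "coeff (?y $ i) j = 0" if "degree (pCons a p) \<le> j" for i j
      using that False y(2) by (cases j) auto
    moreover have "coeff (?y $ i) (degree (pCons a p) - 1) = lead_coeff (pCons a p) * x $ i" for i
    proof (cases "degree p")
      case 0
      then obtain c where "p = [:c:]"
        using degree_eq_zeroE by blast
      then show ?thesis
        using False assms by (simp add: poly_op_pCons linear_0)
    next
      case (Suc d)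
      then show ?thesis
        using False y(3) by simp
    qed
    ultimately show ?thesis
      by (intro exI[of _ ?y]) simp
  qed
qed

text \<open>With \<open>poly_op p T x = 0\<close>, the vector \<open>y\<close> of
  \<open>charmatrix_quotient\<close> satisfies \<open>M y = p x\<close>, and Cramer's rule makes
  \<open>p\<close> divide \<open>y $ k * charpoly T\<close>. If \<open>x $ k\<close> is nonzero,
  then \<open>y $ k\<close> is nonzero of degree below that of \<open>p\<close>, so the prime
  \<open>p\<close> must divide the other factor. Staying over the reals treats quadratic
  \<open>p\<close> like linear ones.\<close>

lemma irreducible_dvd_charpoly:
  fixes T :: "real^'n::finite \<Rightarrow> real^'n"
  assumes "linear T" "irreducible p" "x \<noteq> 0" "poly_op p T x = 0"
  shows "p dvd charpoly T"
proof -
  let ?M = "\<chi> i j. (if i = j then [:0, 1:] else 0) - [:matrix T $ i $ j:]"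
  have deg: "degree p > 0"
    using assms(2) by (metis gr0I irreducible_def is_unit_iff_degree)
  obtain y where y: "\<And>i. (?M *v y) $ i = p * [:x $ i:] - [:poly_op p T x $ i:]"
      "\<And>i j. degree p \<le> j \<Longrightarrow> coeff (y $ i) j = 0"
      "\<And>i. coeff (y $ i) (degree p - 1) = lead_coeff p * x $ i"
    using charmatrix_quotient[OF assms(1), of p x] deg by auto
  obtain k where k: "x $ k \<noteq> 0"
    using assms(3) by (auto simp: vec_eq_iff)
  have "y $ k \<noteq> 0"
    using y(3)[of k] k deg by auto
  moreover have "degree (y $ k) < degree p"
    using y(2)[of _ k] deg by (metis \<open>y $ k \<noteq> 0\<close> leading_coeff_neq_0 not_le)
  ultimately have ndvd: "\<not> p dvd y $ k"
    using dvd_imp_degree_le not_le by blast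
  have "y $ k * det ?M = det (\<chi> i j. if j = k then p * [:x $ i:] else ?M $ i $ j)"
    using cramer_comm_ring[of k ?M y] y(1) assms(4) by (simp cong: if_cong)
  also have "\<dots> = det (transpose (\<chi> i j. if j = k then p * [:x $ i:] else ?M $ i $ j))"
    by simp
  also have "transpose (\<chi> i j. if j = k then p * [:x $ i:] else ?M $ i $ j) =
      (\<chi> i. if i = k then p *s (\<chi> j. [:x $ j:]) else (\<chi> j. ?M $ j $ i))"
    by (auto simp: vec_eq_iff transpose_def)
  also have "det \<dots> = p * det (\<chi> i. if i = k then (\<chi> j. [:x $ j:]) else (\<chi> j. ?M $ j $ i))"
    by (rule det_row_mul)
  finally have "p dvd y $ k * charpoly T"
    unfolding charpoly_def by simp
  then show ?thesis
    using ndvd assms(2) by (metis irreducible_imp_prime_elem prime_elem_dvd_multD)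
qed

text \<open>The last nonzero iterate of \<open>x\<close> under \<open>p(T)\<close> is killed by
  \<open>p(T)\<close>. Since \<open>Vs\<close> and \<open>Vt\<close> admit only factors of
  \<open>charpoly T\<close>, this guarantees that no nonzero component of an irreducible monic
  polynomial is overlooked.\<close>

lemma primary_comp_nontrivial_dvd_charpoly:
  fixes T :: "real^'n::finite \<Rightarrow> real^'n"
  assumes "linear T" "irreducible p" "x \<in> primary_comp p T" "x \<noteq> 0"
  shows "p dvd charpoly T"
proof -
  obtain N where "(poly_op p T ^^ N) x = 0"
    using assms(3) by (auto simp: primary_comp_def)
  then show ?thesis
    using assms(4)
  proof (induction N arbitrary: x)
    case (Suc N)
    show ?case
    proof (cases "poly_op p T x = 0")
      case True
      then show ?thesis
        using irreducible_dvd_charpoly assms Suc by blast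
    next
      case False
      then show ?thesis
        using Suc by (simp add: funpow_swap1)
    qed
  qed simp
qed

text \<open>Write \<open>f = p ^ k * g\<close> with coprime factors and
  \<open>a * p ^ k + b * g = 1\<close>. Applied to \<open>x\<close>, the first summand gives a
  vector killed by \<open>g\<close>, of smaller degree, and the second a vector killed by
  \<open>p ^ k\<close>.\<close>

lemma poly_op_in_span_primary_comps:
  fixes T :: "real^'n::finite \<Rightarrow> real^'n"
  assumes T: "linear T" and "f \<noteq> 0" "poly_op f T x = 0"
  shows "x \<in> span (\<Union>p\<in>primary_factors T. primary_comp p T)"
  using assms(2,3)
proof (induction "degree f" arbitrary: f x rule: less_induct)
  case less
  show ?case
  proof (cases "is_unit f")
    case True
    then obtain c where "f = [:c:]"
      using is_unit_poly_iff by blast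
    moreover from this have "c \<noteq> 0"
      using less(2) by auto
    ultimately have "x = 0"
      using less(3) linear_0[OF T] by (simp add: poly_op_pCons[OF T])
    then show ?thesis
      by (simp add: span_zero)
  next
    case False
    then obtain p where p: "prime p" "p dvd f"
      using prime_divisor_exists less(2) by blast
    have irr: "irreducible p"
      using p by (simp add: prime_elem_imp_irreducible)
    have monic: "lead_coeff p = 1"
    proof -
      have "normalize p = p" "p \<noteq> 0"
        using p(1) by (auto simp: prime_def)
      then show ?thesis
        using coeff_normalize[of p "degree p"] by (simp add: unit_factor_real_def)
    qed
    have deg: "degree p > 0"
      using irr by (metis gr0I irreducible_def is_unit_iff_degree)
    obtain g where g: "f = p ^ multiplicity p f * g" "\<not> p dvd g"
      using multiplicity_decompose'[of f p] less(2) p(1) not_prime_unit by blast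
    define k where "k = multiplicity p f"
    have "k \<noteq> 0"
      using g p(2) by (metis k_def mult_1 power_0)
    moreover have g0: "g \<noteq> 0"
      using g less(2) by auto
    ultimately have "degree g < degree f"
      using deg p(1) by (subst g(1)[folded k_def]) (auto simp: degree_mult_eq degree_power_eq)
    have "coprime (p ^ k) g"
      using g(2) p(1) by (simp add: prime_imp_coprime)
    then obtain a b where ab: "a * p ^ k + b * g = 1"
      using bezout_coefficients_fst_snd[of "p ^ k" g] by (metis coprime_imp_gcd_eq_1)
    define u where "u = poly_op (b * g) T x"
    define v where "v = poly_op (a * p ^ k) T x"
    have x: "x = v + u"
      unfolding u_def v_def using poly_op_add[OF T, of "a * p ^ k" "b * g" x] ab by simp
    have "poly_op g T v = poly_op (a * f) T x"
      unfolding v_def by (subst g(1)) (simp add: poly_op_mult[OF T, symmetric] k_def mult_ac)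
    then have "poly_op g T v = 0"
      using less(3) linear_0[OF linear_poly_op[OF T]] by (simp add: poly_op_mult[OF T])
    then have v: "v \<in> span (\<Union>p\<in>primary_factors T. primary_comp p T)"
      using less(1)[OF \<open>degree g < degree f\<close> g0] by blast
    have "poly_op (p ^ k) T u = poly_op (b * f) T x"
      unfolding u_def by (subst g(1)) (simp add: poly_op_mult[OF T, symmetric] k_def mult_ac)
    then have "poly_op (p ^ k) T u = 0"
      using less(3) linear_0[OF linear_poly_op[OF T]] by (simp add: poly_op_mult[OF T])
    then have up: "u \<in> primary_comp p T"
      unfolding primary_comp_def by (auto simp: poly_op_power[OF T])
    have "u \<in> span (\<Union>p\<in>primary_factors T. primary_comp p T)"
    proof (cases "u = 0")
      case False
      then have "p \<in> primary_factors T"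
        using primary_comp_nontrivial_dvd_charpoly[OF T irr up] irr monic
        by (simp add: primary_factors_def)
      with up show ?thesis
        by (auto intro: span_base)
    qed (simp add: span_zero)
    with v show ?thesis
      unfolding x by (intro span_add)
  qed
qed

text \<open>If no iterate of \<open>x\<close> were in the span of the earlier ones,
  \<open>CARD('n) + 1\<close> iterates would be independent.\<close>

lemma ex_annihilating_poly:
  fixes T :: "real^'n::finite \<Rightarrow> real^'n"
  assumes T: "linear T"
  obtains f where "f \<noteq> 0" "poly_op f T x = 0"
proof -
  have "\<exists>k. (T ^^ k) x \<in> span ((\<lambda>i. (T ^^ i) x) ` {..<k})"
  proof (rule ccontr)
    assume "\<nexists>k. (T ^^ k) x \<in> span ((\<lambda>i. (T ^^ i) x) ` {..<k})"
    then have *: "(T ^^ k) x \<notin> span ((\<lambda>i. (T ^^ i) x) ` {..<k})" for k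
      by blast
    have "independent ((\<lambda>i. (T ^^ i) x) ` {..<k}) \<and> card ((\<lambda>i. (T ^^ i) x) ` {..<k}) = k" for k
    proof (induction k)
      case (Suc k)
      have "(T ^^ k) x \<notin> (\<lambda>i. (T ^^ i) x) ` {..<k}"
        using *[of k] span_base by metis
      then show ?case
        using Suc *[of k] by (simp add: lessThan_Suc independent_insert)
    qed (simp add: independent_empty)
    from this[of "Suc CARD('n)"] independent_bound[of "(\<lambda>i. (T ^^ i) x) ` {..<Suc CARD('n)}"]
    show False by simp
  qed
  then obtain k where k: "(T ^^ k) x \<in> span ((\<lambda>i. (T ^^ i) x) ` {..<k})"
    by blast
  \<comment> \<open>These are the values at \<open>x\<close> of polynomials of degree below
    \<open>k\<close>; as a subspace containing the earlier iterates, the set contains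
    \<open>(T ^^ k) x\<close>.\<close>
  let ?S = "{poly_op g T x |g. \<forall>j\<ge>k. coeff g j = 0}"
  have "subspace ?S"
  proof (rule subspaceI)
    show "0 \<in> ?S"
      by (auto intro: exI[of _ 0])
    show "a + b \<in> ?S" if ab: "a \<in> ?S" "b \<in> ?S" for a b
    proof -
      obtain g h where "a = poly_op g T x" "b = poly_op h T x" "\<forall>j\<ge>k. coeff g j = 0" "\<forall>j\<ge>k. coeff h j = 0"
        using ab by blast
      then show ?thesis
        by (intro CollectI exI[of _ "g + h"]) (simp add: poly_op_add[OF T])
    qed
    show "c *\<^sub>R a \<in> ?S" if a: "a \<in> ?S" for c a
    proof -
      obtain g where "a = poly_op g T x" "\<forall>j\<ge>k. coeff g j = 0"
        using a by blast
      then show ?thesis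
        by (intro CollectI exI[of _ "smult c g"]) (simp add: poly_op_smult[OF T])
    qed
  qed
  moreover have "(\<lambda>i. (T ^^ i) x) ` {..<k} \<subseteq> ?S"
  proof
    fix z assume "z \<in> (\<lambda>i. (T ^^ i) x) ` {..<k}"
    then obtain i where "i < k" "z = (T ^^ i) x"
      by auto
    then show "z \<in> ?S"
      by (intro CollectI exI[of _ "monom 1 i"]) (simp add: poly_op_monom)
  qed
  ultimately have "(T ^^ k) x \<in> ?S"
    using k span_minimal by blast
  then obtain g where g: "(T ^^ k) x = poly_op g T x" "\<forall>j\<ge>k. coeff g j = 0"
    by blast
  have "coeff (monom 1 k - g) k \<noteq> 0"
    using g(2) by simp
  then have "monom 1 k - g \<noteq> 0"
    by (metis coeff_0)
  moreover have "poly_op (monom 1 k - g) T x = 0"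
    using g(1) poly_op_add[OF T, of "monom 1 k - g" g x] by (simp add: poly_op_monom)
  ultimately show ?thesis
    using that by blast
qed

lemma span_primary_comps:
  fixes T :: "real^'n::finite \<Rightarrow> real^'n"
  assumes "linear T"
  shows "span (\<Union>p\<in>primary_factors T. primary_comp p T) = UNIV"
  using ex_annihilating_poly[OF assms] poly_op_in_span_primary_comps[OF assms] by (metis UNIV_eq_I)

section \<open>The Lorentz form\<close>

lemma lform_inner: "lform i0 x y = x \<bullet> y - 2 * (x $ i0 * y $ i0)"
proof -
  have "x \<bullet> y = (\<Sum>i\<in>UNIV. x $ i * y $ i)"
    by (simp add: inner_vec_def)
  also have "\<dots> = x $ i0 * y $ i0 + (\<Sum>i\<in>UNIV - {i0}. x $ i * y $ i)"
    by (simp add: sum.remove)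
  finally show ?thesis
    by (simp add: lform_def)
qed

lemma lform_commute: "lform i0 x y = lform i0 y x"
  by (simp add: lform_inner inner_commute mult.commute)

lemma lform_bilinear:
  "lform i0 (x + y) z = lform i0 x z + lform i0 y z"
  "lform i0 z (x + y) = lform i0 z x + lform i0 z y"
  "lform i0 (x - y) z = lform i0 x z - lform i0 y z"
  "lform i0 z (x - y) = lform i0 z x - lform i0 z y"
  "lform i0 (c *\<^sub>R x) z = c * lform i0 x z"
  "lform i0 z (c *\<^sub>R x) = c * lform i0 z x"
  "lform i0 (- x) z = - lform i0 x z"
  "lform i0 z (- x) = - lform i0 z x"
  "lform i0 0 z = 0"
  "lform i0 z 0 = 0"
  by (simp_all add: lform_inner inner_simps algebra_simps)

text \<open>Pairing \<open>x\<close> with its reflection in the time coordinate returns the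
  Euclidean \<open>x \<bullet> x\<close>.\<close>

lemma lform_nondegenerate:
  assumes "\<And>y. lform i0 x y = 0" shows "x = 0"
proof -
  have "x \<bullet> x = lform i0 x (x - 2 *\<^sub>R (x $ i0 *\<^sub>R axis i0 1))"
    by (simp add: lform_inner inner_diff_right inner_axis algebra_simps)
  then show ?thesis
    using assms by simp
qed

lemma causal_time_nonzero:
  assumes "lform i0 w w \<le> 0" "w \<noteq> 0" shows "w $ i0 \<noteq> 0"
proof
  assume "w $ i0 = 0"
  then have "lform i0 w w = w \<bullet> w"
    by (simp add: lform_inner)
  moreover have "w \<bullet> w > 0"
    using assms(2) by simp
  ultimately show False
    using assms(1) by linarith
qed

text \<open>Subtracting a multiple of the causal vector \<open>w\<close> leaves a purely spatial vector.\<close>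
lemma lform_orthogonal_causal:
  assumes "lform i0 w w \<le> 0" "w \<noteq> 0" "lform i0 x w = 0"
  shows "lform i0 x x \<ge> 0" "lform i0 x x = 0 \<Longrightarrow> \<exists>c. x = c *\<^sub>R w"
proof -
  define c where "c = x $ i0 / w $ i0"
  define y where "y = x - c *\<^sub>R w"
  have "y $ i0 = 0"
    using causal_time_nonzero[OF assms(1,2)] by (simp add: y_def c_def)
  then have "lform i0 y y = y \<bullet> y"
    by (simp add: lform_inner)
  moreover have "lform i0 y y = lform i0 x x + c\<^sup>2 * lform i0 w w"
    using assms(3) by (simp add: y_def lform_bilinear lform_commute[of i0 w x] power2_eq_square)
  moreover have "c\<^sup>2 * lform i0 w w \<le> 0"
    using assms(1) by (simp add: mult_nonneg_nonpos)
  moreover have "y \<bullet> y \<ge> 0"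
    by simp
  ultimately show "lform i0 x x \<ge> 0" and "lform i0 x x = 0 \<Longrightarrow> \<exists>c. x = c *\<^sub>R w"
    by (linarith, metis (no_types) add_0 inner_eq_zero_iff order_antisym right_minus_eq y_def)
qed

lemma lform_orthogonal_timelike:
  assumes "lform i0 w w < 0" "lform i0 x w = 0" "x \<noteq> 0"
  shows "lform i0 x x > 0"
proof -
  have "w \<noteq> 0"
    using assms(1) by (auto simp: lform_bilinear)
  then have *: "lform i0 x x \<ge> 0" "lform i0 x x = 0 \<Longrightarrow> \<exists>c. x = c *\<^sub>R w"
    using lform_orthogonal_causal[of i0 w x] assms by auto
  have "lform i0 x x \<noteq> 0"
  proof
    assume "lform i0 x x = 0"
    then obtain c where "x = c *\<^sub>R w"
      using * by blast
    then show False
      using assms by (auto simp: lform_bilinear)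
  qed
  with * show ?thesis by simp
qed

section \<open>Orthogonal complements for the Lorentz form\<close>

definition lperp :: "'n::finite \<Rightarrow> (real^'n) set \<Rightarrow> (real^'n) set" where
  "lperp i0 K = {x. \<forall>t\<in>K. lform i0 x t = 0}"

lemma subspace_lperp: "subspace (lperp i0 K)"
  by (auto simp: lperp_def subspace_def lform_bilinear)

lemma lperp_Int:
  assumes "pos_def_on i0 (lperp i0 K)" "x \<in> K" "x \<in> lperp i0 K" shows "x = 0"
  using assms unfolding pos_def_on_def lperp_def by (metis (mono_tags, lifting) less_irrefl mem_Collect_eq)

lemma dim_lperp:
  fixes K :: "(real^'n::finite) set"
  assumes "subspace K"
  shows "dim K + dim (lperp i0 K) = CARD('n)"
proof -
  define J where "J = (\<lambda>x::real^'n. x - 2 *\<^sub>R (x $ i0 *\<^sub>R axis i0 1))"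
  have J: "linear J"
    by (rule linearI) (simp_all add: J_def algebra_simps)
  have lJ: "lform i0 x y = J y \<bullet> x" for x y
    by (simp add: J_def lform_inner inner_diff_right inner_diff_left inner_commute inner_axis algebra_simps)
  have "inj J"
    using lform_nondegenerate[of i0] lJ
    by (subst linear_injective_0[OF J]) (metis inner_zero_left lform_commute)
  then have "dim (J ` K) = dim K"
    by (intro dim_image_eq[OF J]) (auto simp: inj_on_def)
  moreover have "lperp i0 K = {y \<in> UNIV. \<forall>x\<in>J ` K. orthogonal x y}"
    by (auto simp: lperp_def lJ orthogonal_def)
  ultimately show ?thesis
    using dim_subspace_orthogonal_to_vectors[of "J ` K" UNIV] linear_subspace_image[OF J assms]
    by simp
qed

text \<open>A common vector of \<open>K\<close> and its complement would be orthogonal to itself,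
  which positive definiteness excludes unless it is 0; counting dimensions then gives
  everything.\<close>

lemma lperp_decomposition:
  fixes K :: "(real^'n::finite) set"
  assumes K: "subspace K" and pd: "pos_def_on i0 (lperp i0 K)"
  shows "\<exists>k\<in>K. \<exists>s\<in>lperp i0 K. x = k + s"
proof -
  let ?S = "{a + b |a b. a \<in> K \<and> b \<in> lperp i0 K}"
  have "K \<inter> lperp i0 K = {0}"
    using lperp_Int[OF pd] subspace_0 K subspace_lperp by blast
  then have "dim ?S = CARD('n)"
    using dim_sums_Int[OF K subspace_lperp[of i0 K]] dim_lperp[OF K, of i0] by simp
  then have "span ?S = UNIV"
    using dim_eq_full[of ?S] by simp
  then have "?S = UNIV"
    using subspace_sums[OF K subspace_lperp[of i0 K]] by (simp only: span_eq_iff[THEN iffD2])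
  then show ?thesis
    by blast
qed

section \<open>Isometries\<close>

lemma PO_linear: "PO i0 T \<Longrightarrow> linear T"
  and PO_lform: "PO i0 T \<Longrightarrow> lform i0 (T x) (T y) = lform i0 x y"
  by (auto simp: PO_def)

lemma PO_inj:
  assumes "PO i0 T" shows "inj T"
proof (subst linear_injective_0[OF PO_linear[OF assms]], intro allI impI)
  fix x assume "T x = 0"
  then show "x = 0"
    using PO_lform[OF assms, of x] by (intro lform_nondegenerate[of i0]) (metis lform_bilinear(9))
qed

lemma PO_image_eq:
  assumes "PO i0 T" "subspace U" "T ` U \<subseteq> U"
  shows "T ` U = U"
proof (rule subspace_dim_equal)
  show "dim U \<le> dim (T ` U)"
    using dim_image_eq[OF PO_linear[OF assms(1)], of U] PO_inj[OF assms(1)] by (simp add: inj_on_def)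
qed (use assms PO_linear linear_subspace_image in blast)+

lemma PO_lperp_invariant:
  assumes "PO i0 T" "subspace K" "T ` K \<subseteq> K"
  shows "T ` lperp i0 K \<subseteq> lperp i0 K"
proof -
  have "lform i0 (T x) t = 0" if x: "x \<in> lperp i0 K" and t: "t \<in> K" for x t
  proof -
    obtain t' where "t' \<in> K" "t = T t'"
      using PO_image_eq[OF assms] t by blast
    then show ?thesis
      using x PO_lform[OF assms(1)] by (auto simp: lperp_def)
  qed
  then show ?thesis
    by (auto simp: lperp_def)
qed

lemma lform_axis: "lform i0 (axis i0 1) (axis i0 1) = -1" "lform i0 x (axis i0 1) = - x $ i0"
  by (simp_all add: lform_inner inner_axis)

text \<open>\<open>PO\<close> speaks only of timelike vectors, whereas the compact disc used for the
  fixed point also contains null directions. If \<open>T x\<close> pointed to the past, subtracting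
  a negative multiple of the image \<open>u\<close> of the time axis would leave a purely spatial
  vector on which the form is negative.\<close>

lemma PO_causal_time_pos:
  assumes "PO i0 T" "lform i0 x x \<le> 0" "x $ i0 > 0"
  shows "(T x) $ i0 > 0"
proof (rule ccontr)
  assume neg: "\<not> (T x) $ i0 > 0"
  define u where "u = T (axis i0 1)"
  have u: "u $ i0 > 0" "lform i0 u u = -1" "lform i0 (T x) u < 0"
    using assms unfolding u_def PO_lform[OF assms(1)] lform_axis
    by (auto simp: PO_def lform_axis)
  have Tx: "lform i0 (T x) (T x) \<le> 0"
    using assms PO_lform by metis
  have "T x \<noteq> 0"
    using u(3) by (auto simp: lform_bilinear)
  then have "(T x) $ i0 < 0"
    using causal_time_nonzero[OF Tx] neg by simp
  define c where "c = (T x) $ i0 / u $ i0"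
  have c: "c < 0"
    using \<open>(T x) $ i0 < 0\<close> u(1) by (simp add: c_def divide_neg_pos)
  define y where "y = T x - c *\<^sub>R u"
  have "y $ i0 = 0"
    using u(1) by (simp add: y_def c_def)
  then have "lform i0 y y \<ge> 0"
    by (simp add: lform_inner)
  moreover have "lform i0 y y = lform i0 (T x) (T x) - 2 * (c * lform i0 (T x) u) + c\<^sup>2 * lform i0 u u"
    by (simp add: y_def lform_bilinear lform_commute[of i0 u "T x"] power2_eq_square algebra_simps)
  moreover have "c * lform i0 (T x) u > 0"
    using c u(3) by (simp add: mult_neg_neg)
  ultimately show False
    using Tx u(2) by simp (smt (verit) zero_le_power2)
qed

text \<open>The closed light cone section \<open>x\<^sub>0 = 1\<close> is a disc on which \<open>T\<close> acts projectively.\<close>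
lemma PO_causal_eigenvector:
  fixes i0 :: "'n::finite"
  assumes T: "PO i0 T"
  obtains w l where "w \<noteq> 0" "lform i0 w w \<le> 0" "l > 0" "T w = l *\<^sub>R w"
proof -
  \<comment> \<open>For time coordinate 1, being causal means spatial norm at most 1, that is
    Euclidean norm at most \<open>sqrt 2\<close>.\<close>
  define S where "S = cball 0 (sqrt 2) \<inter> {x::real^'n. x $ i0 = 1}"
  have S_iff: "x \<in> S \<longleftrightarrow> x $ i0 = 1 \<and> lform i0 x x \<le> 0" for x
    by (auto simp: S_def lform_inner norm_eq_sqrt_inner)
  have hyp: "{x::real^'n. x $ i0 = 1} = {x. axis i0 1 \<bullet> x = 1}"
    by (simp add: inner_axis')
  have "compact S" "convex S"
    unfolding S_def hyp by (auto intro!: compact_Int_closed closed_hyperplane convex_Int convex_hyperplane)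
  moreover have "axis i0 1 \<in> S"
    by (simp add: S_iff lform_axis)
  moreover define f where "f = (\<lambda>x. (1 / (T x) $ i0) *\<^sub>R T x)"
  have pos: "(T x) $ i0 > 0" if "x \<in> S" for x
    using that PO_causal_time_pos[OF T] by (auto simp: S_iff)
  have "continuous_on S T"
    using PO_linear[OF T] linear_continuous_on linear_conv_bounded_linear by blast
  then have "continuous_on S f"
    unfolding f_def using pos by (intro continuous_intros) force+
  moreover have "f \<in> S \<rightarrow> S"
  proof
    fix x assume x: "x \<in> S"
    have "lform i0 (f x) (f x) = (1 / (T x) $ i0)\<^sup>2 * lform i0 x x"
      unfolding f_def by (simp add: lform_bilinear PO_lform[OF T] power2_eq_square)
    then show "f x \<in> S"
      using pos[OF x] x by (simp add: S_iff f_def mult_nonneg_nonpos)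
  qed
  ultimately obtain w where w: "w \<in> S" "f w = w"
    using brouwer[of S f] by blast
  show ?thesis
  proof
    show "w \<noteq> 0" "lform i0 w w \<le> 0"
      using w(1) by (auto simp: S_iff)
    show "(T w) $ i0 > 0"
      using pos w(1) .
    then show "T w = (T w) $ i0 *\<^sub>R w"
      by (subst (3) w(2)[symmetric]) (simp add: f_def)
  qed
qed

section \<open>The splitting into spacelike and timelike part\<close>

text \<open>\<open>K\<close> is the candidate for \<open>Vt\<close>, confirmed later by
  \<open>Vt_Vs_eq\<close>. The polynomial \<open>g\<close> tells the action of \<open>T\<close> on
  \<open>K\<close> from that on the complement: \<open>g(T)\<close> is zero on the former and
  injective on the latter.\<close>

locale lorentz_splitting =
  fixes i0 :: "'n::finite" and T :: "real^'n \<Rightarrow> real^'n" and K :: "(real^'n) set"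
    and g :: "real poly"
  assumes PO: "PO i0 T"
    and subspace_K: "subspace K"
    and T_K: "T ` K \<subseteq> K"
    and pos_def: "pos_def_on i0 (lperp i0 K)"
    and g_K: "\<And>x. x \<in> K \<Longrightarrow> poly_op g T x = 0"
    and g_inj: "\<And>x. x \<in> lperp i0 K \<Longrightarrow> poly_op g T x = 0 \<Longrightarrow> x = 0"
begin

lemma linear_T: "linear T"
  using PO PO_linear by blast

lemma T_lperp: "T ` lperp i0 K \<subseteq> lperp i0 K"
  using PO_lperp_invariant PO subspace_K T_K .

lemma K_lperp_0: "x \<in> K \<Longrightarrow> x \<in> lperp i0 K \<Longrightarrow> x = 0"
  using lperp_Int pos_def by blast

lemma decomposition: "\<exists>k\<in>K. \<exists>s\<in>lperp i0 K. x = k + s"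
  using lperp_decomposition subspace_K pos_def .

lemma poly_op_components:
  assumes "k \<in> K" "s \<in> lperp i0 K" "poly_op q T (k + s) = 0"
  shows "poly_op q T k = 0" "poly_op q T s = 0"
proof -
  have "poly_op q T k \<in> K" "poly_op q T s \<in> lperp i0 K"
    using assms poly_op_invariant[OF linear_T subspace_K T_K]
      poly_op_invariant[OF linear_T subspace_lperp T_lperp] by auto
  moreover have eq: "poly_op q T k = - poly_op q T s"
    using assms(3) linear_add[OF linear_poly_op[OF linear_T]] eq_neg_iff_add_eq_0 by metis
  ultimately show "poly_op q T k = 0"
    using K_lperp_0 subspace_lperp subspace_neg by metis
  with eq show "poly_op q T s = 0"
    by simp
qed

text \<open>The image \<open>W\<close> of \<open>U\<close> under \<open>g(T)\<close> lies in
  \<open>U\<close> and in the complement of \<open>K\<close>, so \<open>g(T)\<close> maps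
  \<open>W\<close> bijectively to itself. As \<open>k\<close> is killed, \<open>g(T) s\<close>
  belongs to \<open>W\<close>; its preimage in \<open>W\<close> can only be
  \<open>s\<close>.\<close>

lemma invariant_subspace_components:
  assumes U: "subspace U" "T ` U \<subseteq> U" and ks: "k \<in> K" "s \<in> lperp i0 K" "k + s \<in> U"
  shows "k \<in> U" "s \<in> U"
proof -
  let ?S = "poly_op g T"
  have lin: "linear ?S"
    using linear_poly_op linear_T by blast
  have im: "?S x \<in> U" "?S x \<in> lperp i0 K" if x: "x \<in> U" for x
  proof -
    obtain a b where ab: "a \<in> K" "b \<in> lperp i0 K" "x = a + b"
      using decomposition by blast
    then have "?S x = ?S b"
      using g_K linear_add[OF lin] by simp
    moreover have "?S b \<in> lperp i0 K"
      using poly_op_invariant[OF linear_T subspace_lperp T_lperp ab(2)] .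
    ultimately show "?S x \<in> lperp i0 K"
      by simp
    show "?S x \<in> U"
      using poly_op_invariant[OF linear_T U x] .
  qed
  define W where "W = ?S ` U"
  have W: "subspace W" "W \<subseteq> U" "W \<subseteq> lperp i0 K"
    using im linear_subspace_image[OF lin U(1)] by (auto simp: W_def)
  have inj: "inj_on ?S W"
    using g_inj W by (subst linear_inj_on_iff_eq_0[OF lin]) (auto simp: subset_iff)
  have "?S ` W = W"
  proof (rule subspace_dim_equal)
    show "dim W \<le> dim (?S ` W)"
      using dim_image_eq[OF lin, of W] inj W(1) by (simp add: span_eq_iff[THEN iffD2])
  qed (use W lin linear_subspace_image in \<open>auto simp: W_def\<close>)
  moreover have "?S s = ?S (k + s)"
    using ks g_K linear_add[OF lin] by simp
  ultimately have "?S s \<in> ?S ` W"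
    using ks(3) by (simp add: W_def)
  then obtain y where y: "y \<in> W" "?S s = ?S y"
    by blast
  then have "?S (s - y) = 0" "s - y \<in> lperp i0 K"
    using subspace_diff[OF subspace_lperp ks(2), of y] W(3) y linear_diff[OF lin] by auto
  then have "s = y"
    using g_inj[of "s - y"] by simp
  then show "s \<in> U"
    using y W by blast
  then show "k \<in> U"
    using ks(3) U(1) by (metis add_diff_cancel_right' subspace_diff)
qed

text \<open>The \<open>K\<close>-component of such a vector is killed both by a power of
  \<open>p\<close> and by \<open>g\<close>, hence by 1.\<close>

lemma primary_comp_subset_lperp:
  assumes "coprime p g" shows "primary_comp p T \<subseteq> lperp i0 K"
proof
  fix x assume "x \<in> primary_comp p T"
  then obtain N where N: "poly_op (p ^ N) T x = 0"
    by (auto simp: primary_comp_def poly_op_power[OF linear_T])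
  obtain k s where ks: "k \<in> K" "s \<in> lperp i0 K" "x = k + s"
    using decomposition by blast
  have k: "poly_op (p ^ N) T k = 0" "poly_op g T k = 0"
    using poly_op_components ks N g_K by auto
  have "coprime (p ^ N) g"
    using assms by simp
  then obtain a b where ab: "a * p ^ N + b * g = 1"
    using bezout_coefficients_fst_snd[of "p ^ N" g] by (metis coprime_imp_gcd_eq_1)
  have "k = poly_op (a * p ^ N + b * g) T k"
    using ab by simp
  also have "\<dots> = 0"
    using k linear_0[OF linear_poly_op[OF linear_T]]
    by (simp only: poly_op_add[OF linear_T] poly_op_mult[OF linear_T] add_0_left)
  finally show "x \<in> lperp i0 K"
    using ks by simp
qed

text \<open>The factors in \<open>P\<close> are exactly those counted in \<open>Vt\<close>: each has
  a causal vector in its component, while any other factor is coprime to \<open>g\<close> and so has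
  its component inside the positive definite complement. As \<open>Vt\<close> and \<open>Vs\<close>
  together span the space, \<open>Vs\<close> then fills that complement.\<close>

lemma Vt_Vs_eq:
  assumes P: "\<And>p. p \<in> P \<Longrightarrow> irreducible p \<and> lead_coeff p = 1 \<and> primary_comp p T \<subseteq> K
        \<and> (\<exists>x\<in>primary_comp p T. x \<noteq> 0 \<and> lform i0 x x \<le> 0)"
    and K: "K \<subseteq> span (\<Union>p\<in>P. primary_comp p T)"
    and coprime: "\<And>p. irreducible p \<Longrightarrow> lead_coeff p = 1 \<Longrightarrow> p \<notin> P \<Longrightarrow> coprime p g"
  shows "Vt i0 T = K" "Vs i0 T = lperp i0 K"
proof -
  let ?F = "primary_factors T"
  have PF: "p \<in> ?F" "\<not> pos_def_on i0 (primary_comp p T)" if pP: "p \<in> P" for p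
  proof -
    obtain x where x: "x \<in> primary_comp p T" "x \<noteq> 0" "lform i0 x x \<le> 0"
      using P pP by blast
    then show "p \<in> ?F" "\<not> pos_def_on i0 (primary_comp p T)"
      using primary_comp_nontrivial_dvd_charpoly[OF linear_T _ x(1,2)] P[OF pP]
      by (auto simp: primary_factors_def pos_def_on_def not_less)
  qed
  have nPF: "primary_comp p T \<subseteq> lperp i0 K" "pos_def_on i0 (primary_comp p T)" if "p \<in> ?F" "p \<notin> P" for p
  proof -
    show sub: "primary_comp p T \<subseteq> lperp i0 K"
      using that coprime by (intro primary_comp_subset_lperp) (auto simp: primary_factors_def)
    then show "pos_def_on i0 (primary_comp p T)"
      using pos_def by (auto simp: pos_def_on_def)
  qed
  have "{primary_comp p T |p. p \<in> ?F \<and> \<not> pos_def_on i0 (primary_comp p T)} = (\<lambda>p. primary_comp p T) ` P"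
    using PF nPF(2) by blast
  then have Vt: "Vt i0 T = span (\<Union>p\<in>P. primary_comp p T)"
    unfolding Vt_def by simp
  then show VtK: "Vt i0 T = K"
    using K P subspace_K by (metis (no_types, lifting) UN_least span_minimal subset_antisym)
  have "\<Union>{primary_comp p T |p. p \<in> ?F \<and> pos_def_on i0 (primary_comp p T)} \<subseteq> lperp i0 K"
    using PF nPF by blast
  then have Vs: "Vs i0 T \<subseteq> lperp i0 K"
    unfolding Vs_def by (rule span_minimal[OF _ subspace_lperp])
  moreover have "lperp i0 K \<subseteq> Vs i0 T"
  proof
    fix x assume x: "x \<in> lperp i0 K"
    have "span (\<Union>p\<in>?F. primary_comp p T) \<subseteq> {a + b |a b. a \<in> Vt i0 T \<and> b \<in> Vs i0 T}"
    proof (rule span_minimal)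
      show "subspace {a + b |a b. a \<in> Vt i0 T \<and> b \<in> Vs i0 T}"
        unfolding Vt_def Vs_def by (intro subspace_sums subspace_span)
      show "(\<Union>p\<in>?F. primary_comp p T) \<subseteq> {a + b |a b. a \<in> Vt i0 T \<and> b \<in> Vs i0 T}"
      proof
        fix x assume "x \<in> (\<Union>p\<in>?F. primary_comp p T)"
        then obtain p where p: "p \<in> ?F" "x \<in> primary_comp p T"
          by blast
        have "x \<in> Vt i0 T \<or> x \<in> Vs i0 T"
        proof (cases "pos_def_on i0 (primary_comp p T)")
          case True
          then have "x \<in> Vs i0 T"
            unfolding Vs_def using p by (intro span_base) blast
          then show ?thesis ..
        next
          case False
          then have "x \<in> Vt i0 T"
            unfolding Vt_def using p by (intro span_base) blast
          then show ?thesis ..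
        qed
        moreover have "0 \<in> Vt i0 T" "0 \<in> Vs i0 T"
          unfolding Vt_def Vs_def by (simp_all add: span_zero)
        ultimately show "x \<in> {a + b |a b. a \<in> Vt i0 T \<and> b \<in> Vs i0 T}"
          by force
      qed
    qed
    then obtain a b where ab: "x = a + b" "a \<in> Vt i0 T" "b \<in> Vs i0 T"
      using span_primary_comps[OF linear_T] by blast
    then have "a = x - b" "b \<in> lperp i0 K"
      using Vs by auto
    then have "a \<in> lperp i0 K"
      using x subspace_lperp subspace_diff by blast
    then have "a = 0"
      using ab(2) VtK K_lperp_0 by blast
    then show "x \<in> Vs i0 T"
      using ab by simp
  qed
  ultimately show "Vs i0 T = lperp i0 K"
    by blast
qed

end

lemma monic_irreducible_coprime:
  fixes p q :: "real poly"
  assumes "irreducible p" "irreducible q" "lead_coeff p = 1" "lead_coeff q = 1" "p \<noteq> q"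
  shows "coprime p q"
proof -
  have "\<not> p dvd q"
  proof
    assume pq: "p dvd q"
    then have "q dvd p"
      using assms irreducibleD' unfolding irreducible_def by blast
    have "normalize p = p" "normalize q = q"
      using assms(3,4) by (auto intro!: poly_eqI simp: unit_factor_real_def)
    then show False
      using associatedI[OF pq \<open>q dvd p\<close>] assms(5) by simp
  qed
  then show ?thesis
    using assms(1) irreducible_imp_prime_elem prime_elem_imp_coprime by blast
qed

lemma irreducible_linear_factor: "irreducible [:- a, 1::real:]"
proof (rule irreducibleI)
  fix p q assume pq: "[:- a, 1:] = p * q"
  then have "p \<noteq> 0" "q \<noteq> 0"
    by auto
  then have "degree p + degree q = 1"
    using arg_cong[OF pq, of degree] by (simp add: degree_mult_eq)
  then show "is_unit p \<or> is_unit q"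
    using \<open>p \<noteq> 0\<close> \<open>q \<noteq> 0\<close> by (auto simp: is_unit_iff_degree)
qed (auto simp: is_unit_iff_degree)

subsection \<open>A fixed causal direction\<close>

text \<open>With \<open>D = T - 1\<close>, invariance gives
  \<open>lform (D z) t = - lform (T z) (D t)\<close>: each \<open>D\<close> moves to the right at
  the price of one \<open>T\<close>, which commutes with \<open>D\<close>. So the range of
  \<open>D ^ N\<close> is orthogonal to its kernel.\<close>

lemma PO_lform_funpow_minus_id:
  assumes "PO i0 T" "((\<lambda>y. T y - y) ^^ N) t = 0"
  shows "lform i0 (((\<lambda>y. T y - y) ^^ N) x) t = 0"
  using assms(2)
proof (induction N arbitrary: x t)
  case 0
  then show ?case by (simp add: lform_bilinear)
next
  case (Suc N)
  let ?D = "\<lambda>y. T y - y"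
  have T: "linear T"
    using PO_linear assms(1) .
  have comm: "T ((?D ^^ N) x) = (?D ^^ N) (T x)" for x
    by (induction N) (simp_all add: linear_diff[OF T])
  have "lform i0 ((?D ^^ Suc N) x) t = - lform i0 (T ((?D ^^ N) x)) (?D t)"
    by (simp add: lform_bilinear PO_lform[OF assms(1)])
  also have "\<dots> = - lform i0 ((?D ^^ N) (T x)) (?D t)"
    by (simp add: comm)
  also have "\<dots> = 0"
    using Suc.IH[of "?D t"] Suc.prems by (simp only: funpow_Suc_right o_apply)
  finally show ?case .
qed

text \<open>Take \<open>N\<close> with kernel of largest dimension. This replaces the exponents
  depending on the vector in \<open>primary_comp\<close> by a single one.\<close>

lemma ex_kernel_stable:
  fixes D :: "real^'n::finite \<Rightarrow> real^'n"
  assumes "linear D"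
  obtains N where "\<And>M x. (D ^^ M) x = 0 \<Longrightarrow> (D ^^ N) x = 0"
proof -
  define k where "k = (\<lambda>N. {x. (D ^^ N) x = 0})"
  have lin: "linear (D ^^ N)" for N
  proof (induction N)
    case 0
    then show ?case by (simp add: id_def linear_ident)
  next
    case (Suc N)
    then show ?case
      unfolding funpow.simps by (rule linear_compose) fact
  qed
  have sub: "subspace (k N)" for N
    unfolding k_def by (rule linear_subspace_kernel[OF lin])
  have mono: "k N \<subseteq> k M" if "N \<le> M" for N M
  proof
    fix x assume "x \<in> k N"
    moreover have "(D ^^ M) x = (D ^^ (M - N)) ((D ^^ N) x)"
      using that by (metis comp_apply funpow_add le_add_diff_inverse2)
    ultimately show "x \<in> k M"
      using linear_0[OF lin] by (simp add: k_def)
  qed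
  have "\<forall>N. dim (k N) \<le> CARD('n)"
    using dim_subset_UNIV[where 'a = "real^'n"] by simp
  then obtain N where N: "\<And>M. dim (k M) \<le> dim (k N)"
    using ex_has_greatest_nat[of "\<lambda>_. True" 0 "\<lambda>N. dim (k N)" "Suc CARD('n)"] by (auto simp: less_Suc_eq_le)
  have "k M \<subseteq> k N" for M
  proof -
    have "k N = k (max N M)"
      using sub mono[of N "max N M"] N by (intro subspace_dim_equal) auto
    then show ?thesis
      using mono[of M "max N M"] by simp
  qed
  then show ?thesis
    using that[of N] by (auto simp: k_def)
qed

lemma dim_range_kernel:
  fixes f :: "'a::euclidean_space \<Rightarrow> 'b::euclidean_space"
  assumes "linear f"
  shows "DIM('a) \<le> dim (range f) + dim {x. f x = 0}"
proof -
  let ?C = "{y \<in> UNIV. \<forall>x\<in>{x. f x = 0}. orthogonal x y}"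
  have "subspace ?C"
    by (auto simp: subspace_def orthogonal_clauses)
  have "inj_on f ?C"
    using \<open>subspace ?C\<close> by (subst linear_inj_on_iff_eq_0[OF assms]) (auto simp: orthogonal_def)
  then have "dim ?C = dim (f ` ?C)"
    using \<open>subspace ?C\<close> by (intro dim_image_eq[OF assms, symmetric]) (simp only: span_eq_iff[THEN iffD2])
  also have "\<dots> \<le> dim (range f)"
    by (intro dim_subset) auto
  finally show ?thesis
    using dim_subspace_orthogonal_to_vectors[of "{x. f x = 0}" UNIV] linear_subspace_kernel[OF assms] by simp
qed

text \<open>The Fitting decomposition for \<open>D = T - 1\<close> is orthogonal: the range of
  \<open>D ^ N\<close> is the Lorentz complement of the kernel \<open>K\<close>. Vectors of the
  range are orthogonal to the causal \<open>w\<close>, which is itself not in the range, so the form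
  is positive definite there.\<close>

lemma fixed_causal_splitting:
  fixes i0 :: "'n::finite"
  assumes PO: "PO i0 T" and w: "w \<noteq> 0" "lform i0 w w \<le> 0" "T w = w"
  obtains g where "lorentz_splitting i0 T (Vt i0 T) g" "Vs i0 T = lperp i0 (Vt i0 T)"
    "unipotent_on (Vt i0 T) T" "w \<in> Vt i0 T"
proof -
  let ?D = "\<lambda>y. T y - y"
  have T: "linear T"
    using PO_linear PO .
  have D: "linear ?D"
    using linear_compose_sub[OF T linear_ident] .
  let ?p = "[:- 1, 1::real:]"
  have pD: "poly_op ?p T = ?D"
    using poly_op_linear_factor[OF T, of 1] by (simp add: fun_eq_iff)
  have pN: "poly_op (?p ^ N) T x = (?D ^^ N) x" for N x
    by (simp only: poly_op_power[OF T] pD)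
  obtain N where N: "\<And>M x. (?D ^^ M) x = 0 \<Longrightarrow> (?D ^^ N) x = 0"
    by (rule ex_kernel_stable[OF D]) blast
  define K where "K = {x. (?D ^^ N) x = 0}"
  have comp: "primary_comp ?p T = K"
    using N unfolding primary_comp_def K_def pD by blast
  have lin: "linear (?D ^^ N)"
    using linear_poly_op[OF T, of "?p ^ N"] pN ext by metis
  have K: "subspace K"
    using comp subspace_primary_comp[OF T] by metis
  have TK: "T ` K \<subseteq> K"
  proof
    fix y assume "y \<in> T ` K"
    then obtain x where x: "x \<in> K" "y = T x"
      by blast
    have "(?D ^^ N) (T x) = T ((?D ^^ N) x)"
      using poly_op_commute[OF T, of "?p ^ N" x] by (simp only: pN)
    then show "y \<in> K"
      using x linear_0[OF T] by (simp add: K_def)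
  qed
  have wK: "w \<in> K"
    using N[of 1 w] w(3) by (simp add: K_def)
  have range: "range (?D ^^ N) = lperp i0 K"
  proof (rule subspace_dim_equal)
    show "subspace (range (?D ^^ N))"
      using linear_subspace_image[OF lin subspace_UNIV] .
    show "range (?D ^^ N) \<subseteq> lperp i0 K"
      using PO_lform_funpow_minus_id[OF PO] by (auto simp: lperp_def K_def)
    have "CARD('n) \<le> dim (range (?D ^^ N)) + dim K"
      using dim_range_kernel[OF lin] by (simp add: K_def)
    then show "dim (lperp i0 K) \<le> dim (range (?D ^^ N))"
      using dim_lperp[OF K, of i0] by simp
  qed (rule subspace_lperp)
  \<comment> \<open>If \<open>w\<close> were \<open>D ^ N\<close> of some \<open>y\<close>, then
    \<open>D w = 0\<close> would put \<open>y\<close> in the kernel of the next power, hence of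
    \<open>D ^ N\<close>, and \<open>w\<close> would be 0.\<close>
  have "w \<notin> lperp i0 K"
  proof
    assume "w \<in> lperp i0 K"
    then obtain y where y: "w = (?D ^^ N) y"
      using range by blast
    then have "(?D ^^ Suc N) y = 0"
      using w(3) by simp
    then show False
      using N y w(1) by blast
  qed
  have pd: "pos_def_on i0 (lperp i0 K)"
    unfolding pos_def_on_def
  proof (intro ballI impI)
    fix x assume x: "x \<in> lperp i0 K" "x \<noteq> 0"
    have xw: "lform i0 x w = 0"
      using x wK by (simp add: lperp_def)
    have "lform i0 x x \<noteq> 0"
    proof
      assume "lform i0 x x = 0"
      then obtain c where c: "x = c *\<^sub>R w"
        using lform_orthogonal_causal(2)[OF w(2,1) xw] by blast
      then have "w = (1 / c) *\<^sub>R x"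
        using x(2) by auto
      then show False
        using x(1) \<open>w \<notin> lperp i0 K\<close> subspace_scale[OF subspace_lperp] by metis
    qed
    then show "lform i0 x x > 0"
      using lform_orthogonal_causal(1)[OF w(2,1) xw] by simp
  qed
  interpret lorentz_splitting i0 T K "?p ^ N"
  proof
    show "poly_op (?p ^ N) T x = 0" if "x \<in> K" for x
      using that by (simp only: pN K_def mem_Collect_eq)
    show "x = 0" if "x \<in> lperp i0 K" "poly_op (?p ^ N) T x = 0" for x
    proof -
      have "x \<in> K"
        using that(2) by (simp only: pN K_def mem_Collect_eq)
      then show ?thesis
        using lperp_Int[OF pd _ that(1)] by blast
    qed
  qed fact+
  have "coprime q (?p ^ N)" if "irreducible q" "lead_coeff q = 1" "q \<notin> {?p}" for q
    using that monic_irreducible_coprime[of q ?p] irreducible_linear_factor[of 1] by simp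
  moreover have "K \<subseteq> span (\<Union>p\<in>{?p}. primary_comp p T)"
    using comp by (simp add: span_superset)
  ultimately have eq: "Vt i0 T = K" "Vs i0 T = lperp i0 K"
    using Vt_Vs_eq[of "{?p}"] comp wK w irreducible_linear_factor[of 1] by auto
  show ?thesis
  proof
    show "lorentz_splitting i0 T (Vt i0 T) (?p ^ N)"
      unfolding eq by (rule lorentz_splitting_axioms)
    show "unipotent_on (Vt i0 T) T"
      unfolding eq unipotent_on_def K_def by blast
  qed (use eq wK in auto)
qed

subsection \<open>A null direction that is not fixed\<close>

text \<open>An eigenvector for a positive eigenvalue other than 1 is null. Two independent null
  vectors are not orthogonal, so \<open>w\<close> and \<open>w'\<close> span a Lorentzian
  plane.\<close>

lemma moved_null_splitting:
  fixes i0 :: "'n::finite"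
  assumes PO: "PO i0 T" and w: "w \<noteq> 0" "lform i0 w w \<le> 0" "T w = l *\<^sub>R w" "l > 0" "l \<noteq> 1"
  obtains g w' where "lorentz_splitting i0 T (Vt i0 T) g" "Vs i0 T = lperp i0 (Vt i0 T)"
    "T w' = (1 / l) *\<^sub>R w'" "lform i0 w w = 0" "lform i0 w' w' = 0" "lform i0 w w' \<noteq> 0"
    "Vt i0 T = span {w, w'}"
proof -
  have T: "linear T"
    using PO_linear PO .
  have null: "lform i0 x x = 0" if "T x = a *\<^sub>R x" "a > 0" "a \<noteq> 1" for x a
  proof -
    have "lform i0 x x = a\<^sup>2 * lform i0 x x"
      using PO_lform[OF PO, of x x] that(1) by (simp add: lform_bilinear power2_eq_square)
    moreover have "a\<^sup>2 \<noteq> 1"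
      using that by (simp add: power2_eq_1_iff)
    ultimately show ?thesis by simp
  qed
  have l: "1 / l > 0" "1 / l \<noteq> 1" "l \<noteq> 1 / l"
    using w(4,5) by (auto simp: field_simps) (metis power2_eq_1_iff power2_eq_square less_minus_one_simps(1) not_less_iff_gr_or_eq order_less_trans zero_less_one)
  have w0: "lform i0 w w = 0"
    using null w by blast
  \<comment> \<open>The range of \<open>T - 1 / l\<close> is orthogonal to \<open>w\<close>, so this
    operator is not onto; its kernel supplies \<open>w'\<close>.\<close>
  have "\<not> inj (\<lambda>x. T x - (1 / l) *\<^sub>R x)"
  proof
    have lin: "linear (\<lambda>x. T x - (1 / l) *\<^sub>R x)"
      using T by (simp add: linear_compose_sub linear_scale_self)
    assume "inj (\<lambda>x. T x - (1 / l) *\<^sub>R x)"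
    then have surj: "surj (\<lambda>x. T x - (1 / l) *\<^sub>R x)"
      using linear_injective_imp_surjective lin by blast
    have "lform i0 w y = 0" for y
    proof -
      obtain x where "y = T x - (1 / l) *\<^sub>R x"
        using surj by blast
      moreover have "lform i0 w (T x) = (1 / l) * lform i0 w x"
        using PO_lform[OF PO, of w x] w(3,4) by (simp add: lform_bilinear field_simps)
      ultimately show ?thesis
        by (simp add: lform_bilinear)
    qed
    then show False
      using lform_nondegenerate w(1) by blast
  qed
  then obtain w' where w': "w' \<noteq> 0" "T w' = (1 / l) *\<^sub>R w'"
    using linear_injective_0[of "\<lambda>x. T x - (1 / l) *\<^sub>R x"] T
    by (auto simp: linear_compose_sub linear_scale_self)
  have w'0: "lform i0 w' w' = 0"
    using null w'(2) l by blast
  have ww': "lform i0 w w' \<noteq> 0"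
  proof
    assume "lform i0 w w' = 0"
    then obtain c where c: "w' = c *\<^sub>R w"
      using lform_orthogonal_causal(2)[OF w(2,1), of w'] w'0 by (auto simp: lform_commute)
    then have "(c * l) *\<^sub>R w = (c * (1 / l)) *\<^sub>R w"
      using w'(2) w(3) linear_cmul[OF T] by (simp add: mult.commute)
    then have "c * l = c * (1 / l)"
      using w(1) by (simp only: scaleR_cancel_right) simp
    then show False
      using c w'(1) l(3) by (simp only: mult_cancel_left) auto
  qed
  define K where "K = span {w, w'}"
  have K: "subspace K" "w \<in> K" "w' \<in> K"
    unfolding K_def by (auto simp: span_base)
  have TK: "T ` K \<subseteq> K"
  proof -
    have "T ` K = span (T ` {w, w'})"
      unfolding K_def by (rule linear_span_image[OF T, symmetric])
    also have "\<dots> \<subseteq> K"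
      using K w(3) w'(2) by (intro span_minimal) (auto intro: subspace_scale)
    finally show ?thesis .
  qed
  have pd: "pos_def_on i0 (lperp i0 K)"
    unfolding pos_def_on_def
  proof (intro ballI impI)
    fix x assume x: "x \<in> lperp i0 K" "x \<noteq> 0"
    \<comment> \<open>The form takes the value \<open>- 2 * (lform i0 w w')\<^sup>2\<close> at this
      vector, so the plane contains a timelike vector.\<close>
    let ?v = "w - lform i0 w w' *\<^sub>R w'"
    have "lform i0 ?v ?v < 0"
      using w0 w'0 ww' by (simp add: lform_bilinear lform_commute[of i0 w' w] sum_squares_gt_zero_iff)
        (metis not_real_square_gt_zero)
    moreover have "?v \<in> K"
      using K by (intro subspace_diff subspace_scale)
    ultimately show "lform i0 x x > 0"
      using x lform_orthogonal_timelike[of i0 ?v x] by (auto simp: lperp_def)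
  qed
  have inj: "x = 0" if "x \<in> lperp i0 K" "T x = a *\<^sub>R x" "a > 0" "a \<noteq> 1" for x a
    using null[OF that(2-4)] pd that(1) unfolding pos_def_on_def by force
  let ?p = "[:- l, 1:]" and ?q = "[:- (1 / l), 1:]"
  have p: "poly_op ?p T x = T x - l *\<^sub>R x" and q: "poly_op ?q T x = T x - (1 / l) *\<^sub>R x" for x
    using poly_op_linear_factor[OF T] by auto
  have lK: "T ` lperp i0 K \<subseteq> lperp i0 K"
    using PO_lperp_invariant[OF PO K(1) TK] .
  interpret lorentz_splitting i0 T K "?p * ?q"
  proof
    show "poly_op (?p * ?q) T x = 0" if "x \<in> K" for x
    proof -
      have "K \<subseteq> {x. poly_op (?p * ?q) T x = 0}"
        unfolding K_def
      proof (rule span_minimal)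
        have "poly_op (?p * ?q) T w = 0"
          using w(3) linear_0[OF linear_poly_op[OF T]] by (simp only: mult.commute[of ?p] poly_op_mult[OF T] p) simp
        moreover have "poly_op (?p * ?q) T w' = 0"
          using w'(2) linear_0[OF linear_poly_op[OF T]] by (simp only: poly_op_mult[OF T] q) simp
        ultimately show "{w, w'} \<subseteq> {x. poly_op (?p * ?q) T x = 0}"
          by blast
        show "subspace {x. poly_op (?p * ?q) T x = 0}"
          by (rule linear_subspace_kernel[OF linear_poly_op[OF T]])
      qed
      then show ?thesis
        using that by blast
    qed
    show "x = 0" if x: "x \<in> lperp i0 K" "poly_op (?p * ?q) T x = 0" for x
    proof -
      have "poly_op ?q T x \<in> lperp i0 K"
        using poly_op_invariant[OF T subspace_lperp lK x(1)] .
      moreover have "T (poly_op ?q T x) = l *\<^sub>R poly_op ?q T x"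
        using x(2) by (simp add: poly_op_mult[OF T] p del: mult_pCons_left mult_pCons_right)
      ultimately have "poly_op ?q T x = 0"
        using inj w(4,5) by blast
      then show ?thesis
        using inj[OF x(1), of "1 / l"] l by (simp add: q)
    qed
  qed fact+
  \<comment> \<open>The complement has no eigenvector for \<open>a\<close>, since it would be null.
    Hence \<open>T - a\<close> is injective there and so are its powers.\<close>
  have comp: "primary_comp [:- a, 1:] T \<subseteq> K" if a: "a > 0" "a \<noteq> 1" for a
  proof
    fix x assume "x \<in> primary_comp [:- a, 1:] T"
    then obtain N where N: "poly_op ([:- a, 1:] ^ N) T x = 0"
      by (auto simp: primary_comp_def poly_op_power[OF T])
    obtain k s where ks: "k \<in> K" "s \<in> lperp i0 K" "x = k + s"
      using decomposition by blast
    have "poly_op ([:- a, 1:] ^ N) T s = 0"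
      using poly_op_components(2)[OF ks(1,2)] N ks(3) by blast
    then have "s = 0"
      using ks(2)
    proof (induction N arbitrary: s)
      case (Suc N)
      have "poly_op [:- a, 1:] T s \<in> lperp i0 K"
        using poly_op_invariant[OF T subspace_lperp lK Suc(3)] .
      moreover have "poly_op ([:- a, 1:] ^ N) T (poly_op [:- a, 1:] T s) = 0"
        using Suc(2) by (simp only: power_Suc2 poly_op_mult[OF T])
      ultimately have "poly_op [:- a, 1:] T s = 0"
        using Suc(1) by blast
      then show ?case
        using inj[OF Suc(3) _ a] by (simp add: poly_op_linear_factor[OF T])
    qed simp
    then show "x \<in> K"
      using ks by simp
  qed
  have ev: "x \<in> primary_comp [:- a, 1:] T" if "T x = a *\<^sub>R x" for x a
    using that unfolding primary_comp_def
    by (intro CollectI exI[of _ 1]) (simp add: poly_op_linear_factor[OF T])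
  have "coprime r (?p * ?q)" if "irreducible r" "lead_coeff r = 1" "r \<notin> {?p, ?q}" for r
  proof -
    have "coprime r ?p" "coprime r ?q"
      using that irreducible_linear_factor
      by (auto intro!: monic_irreducible_coprime simp del: minus_divide_left)
    then show ?thesis
      by (simp del: mult_pCons_left mult_pCons_right)
  qed
  moreover have "K \<subseteq> span (\<Union>p\<in>{?p, ?q}. primary_comp p T)"
    unfolding K_def using ev[OF w(3)] ev[OF w'(2)] by (intro span_mono) auto
  moreover have "irreducible r \<and> lead_coeff r = 1 \<and> primary_comp r T \<subseteq> K
        \<and> (\<exists>x\<in>primary_comp r T. x \<noteq> 0 \<and> lform i0 x x \<le> 0)" if "r \<in> {?p, ?q}" for r
    using that
  proof
    assume "r = ?p"
    then show ?thesis
      using ev[OF w(3)] w comp irreducible_linear_factor[of l] by auto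
  next
    assume "r \<in> {?q}"
    then show ?thesis
      using ev[OF w'(2)] w'(1) w'0 comp[OF l(1,2)] irreducible_linear_factor[of "1 / l"] by auto
  qed
  ultimately have eq: "Vt i0 T = K" "Vs i0 T = lperp i0 K"
    using Vt_Vs_eq[of "{?p, ?q}"] by (auto simp del: mult_pCons_left mult_pCons_right)
  show ?thesis
  proof
    show "lorentz_splitting i0 T (Vt i0 T) (?p * ?q)"
      unfolding eq by (rule lorentz_splitting_axioms)
    show "Vt i0 T = span {w, w'}"
      using eq K_def by simp
  qed (use eq w0 w'0 ww' w'(2) in auto)
qed

section \<open>Stratified homeomorphisms\<close>

abbreviation set_sum :: "'a::plus set \<Rightarrow> 'a set \<Rightarrow> 'a set" where
  "set_sum X Y \<equiv> {a + b |a b. a \<in> X \<and> b \<in> Y}"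

text \<open>\<open>U\<close> corresponds to the pair of images under \<open>A\<close> and
  \<open>P\<close>, with inverse \<open>(W1, W2)\<close> going to \<open>B W1 + C + W2\<close>. The
  \<open>Suc j\<close> for \<open>R\<close> reflects that hyperbolic and affine subspaces of
  dimension \<open>j\<close> are encoded by linear ones of dimension \<open>j + 1\<close>.\<close>

lemma homeomorphic_strata:
  fixes A :: "real^'n::finite \<Rightarrow> real^'m::finite" and B :: "real^'m \<Rightarrow> real^'n"
    and P :: "real^'n \<Rightarrow> real^'n" and R :: "nat \<Rightarrow> (real^'m) set set"
  assumes lin: "linear A" "linear B" "linear P"
    and G: "\<And>U. U \<in> G \<Longrightarrow> subspace U \<and> dim U = d"
    and R: "\<And>j W. W \<in> R j \<Longrightarrow> subspace W \<and> dim W = Suc j"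
    and S: "\<And>j W. W \<in> S j \<Longrightarrow> subspace W \<and> dim W = j"
    and I: "I = {(k1, k2). k1 + k2 + c = k}"
    and fwd: "\<And>U. U \<in> G \<Longrightarrow> \<exists>(k1, k2)\<in>I. A ` U \<in> R k1 \<and> P ` U \<in> S k2"
    and inv: "\<And>U. U \<in> G \<Longrightarrow> set_sum (B ` A ` U) (set_sum C (P ` U)) = U"
    and bwd: "\<And>k1 k2 W1 W2. (k1, k2) \<in> I \<Longrightarrow> W1 \<in> R k1 \<Longrightarrow> W2 \<in> S k2 \<Longrightarrow>
      set_sum (B ` W1) (set_sum C W2) \<in> G \<and> A ` set_sum (B ` W1) (set_sum C W2) = W1
      \<and> P ` set_sum (B ` W1) (set_sum C W2) = W2"
  shows "subsp_top G homeomorphic_space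
    sum_topology (\<lambda>(k1, k2). prod_topology (subsp_top (R k1)) (subsp_top (S k2))) I"
proof (rule homeomorphic_sum_topology)
  let ?R = "\<lambda>i. {U \<in> G. A ` U \<in> R (fst i) \<and> P ` U \<in> S (snd i)}"
  have lscG: "lsc_family (subsp_top H) (\<lambda>U. U)" if "H \<subseteq> G" for H
    using that G by (intro lsc_family_subsp_top) blast
  show "topspace (subsp_top G) = (\<Union>i\<in>I. ?R i)"
    using fwd by fastforce
  show "i = j" if "i \<in> I" "j \<in> I" "U \<in> ?R i" "U \<in> ?R j" for i j U
    using that R[of "A ` U"] S[of "P ` U"] by (metis (mono_tags, lifting) Suc_inject mem_Collect_eq prod_eqI)
  show "openin (subsp_top G) (?R i)" if i: "i \<in> I" for i
  proof -
    have "subspace (A ` U)" "subspace (P ` U)" if "U \<in> topspace (subsp_top G)" for U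
      using that G lin linear_subspace_image by auto
    then have "openin (subsp_top G) ({U \<in> G. Suc (fst i) \<le> dim (A ` U)} \<inter> {U \<in> G. snd i \<le> dim (P ` U)})"
      using lsc_family_dim_ge[OF lsc_family_linear_image[OF lscG[OF order_refl] lin(1)], of "Suc (fst i)"]
        lsc_family_dim_ge[OF lsc_family_linear_image[OF lscG[OF order_refl] lin(3)], of "snd i"]
      by (intro openin_Int) simp_all
    \<comment> \<open>On \<open>I\<close> the sum \<open>k1 + k2\<close> is fixed, so lower bounds
      for both dimensions force equality in both.\<close>
    also have "{U \<in> G. Suc (fst i) \<le> dim (A ` U)} \<inter> {U \<in> G. snd i \<le> dim (P ` U)} = ?R i"
    proof (intro equalityI subsetI)
      fix U assume U: "U \<in> {U \<in> G. Suc (fst i) \<le> dim (A ` U)} \<inter> {U \<in> G. snd i \<le> dim (P ` U)}"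
      then obtain k1 k2 where k: "(k1, k2) \<in> I" "A ` U \<in> R k1" "P ` U \<in> S k2"
        using fwd[of U] by blast
      then have "fst i \<le> k1" "snd i \<le> k2"
        using U R S by fastforce+
      then have "fst i = k1" "snd i = k2"
        using k(1) i by (auto simp: I)
      then show "U \<in> ?R i"
        using U k by auto
    next
      fix U assume "U \<in> ?R i"
      then show "U \<in> {U \<in> G. Suc (fst i) \<le> dim (A ` U)} \<inter> {U \<in> G. snd i \<le> dim (P ` U)}"
        using R S by fastforce
    qed
    finally show ?thesis .
  qed
  show "subtopology (subsp_top G) (?R i) homeomorphic_space
      (case i of (k1, k2) \<Rightarrow> prod_topology (subsp_top (R k1)) (subsp_top (S k2)))" if i: "i \<in> I" for i
  proof -
    obtain k1 k2 where i_eq: "i = (k1, k2)"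
      by force
    have sub: "?R i \<subseteq> G"
      by blast
    let ?f = "\<lambda>U. (A ` U, P ` U)"
    let ?g = "\<lambda>W. set_sum (B ` fst W) (set_sum C (snd W))"
    let ?Y = "prod_topology (subsp_top (R k1)) (subsp_top (S k2))"
    have "continuous_map (subsp_top (?R i)) (subsp_top (R k1)) (\<lambda>U. A ` U)"
      by (rule continuous_map_subsp_top[OF lsc_family_linear_image[OF lscG[OF sub] lin(1)]])
        (use R i_eq in auto)
    moreover have "continuous_map (subsp_top (?R i)) (subsp_top (S k2)) (\<lambda>U. P ` U)"
      by (rule continuous_map_subsp_top[OF lsc_family_linear_image[OF lscG[OF sub] lin(3)]])
        (use S i_eq in auto)
    ultimately have f: "continuous_map (subsp_top (?R i)) ?Y ?f"
      by (rule continuous_map_pairedI)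
    have R1: "lsc_family (subsp_top (R k1)) (\<lambda>U. U)"
      using R by (intro lsc_family_subsp_top) blast
    have S2: "lsc_family (subsp_top (S k2)) (\<lambda>U. U)"
      using S by (intro lsc_family_subsp_top) blast
    have g: "continuous_map ?Y (subsp_top (?R i)) ?g"
    proof (rule continuous_map_subsp_top)
      show "lsc_family ?Y ?g"
        by (intro lsc_family_sum lsc_family_linear_image lsc_family_const lin
            lsc_family_compose[OF continuous_map_fst R1] lsc_family_compose[OF continuous_map_snd S2])
      show "?g W \<in> ?R i" if "W \<in> topspace ?Y" for W
      proof -
        have "fst W \<in> R k1" "snd W \<in> S k2"
          using that by auto
        then show ?thesis
          using bwd[of k1 k2 "fst W" "snd W"] i unfolding i_eq by simp
      qed
      show "subspace U \<and> dim U = d" if "U \<in> ?R i" for U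
        using that G by blast
    qed
    have "homeomorphic_maps (subsp_top (?R i)) ?Y ?f ?g"
      unfolding homeomorphic_maps_def
    proof (intro conjI ballI f g)
      show "?g (?f U) = U" if "U \<in> topspace (subsp_top (?R i))" for U
        using that inv[of U] by simp
      show "?f (?g W) = W" if "W \<in> topspace ?Y" for W
      proof -
        have "fst W \<in> R k1" "snd W \<in> S k2"
          using that by auto
        then have "?f (?g W) = (fst W, snd W)"
          using bwd[of k1 k2 "fst W" "snd W"] i unfolding i_eq by blast
        then show ?thesis
          by simp
      qed
    qed
    then show ?thesis
      unfolding i_eq subtopology_subsp_top[OF sub[unfolded i_eq]] homeomorphic_space_def by auto
  qed
qed

section \<open>Invariant subspaces containing a timelike vector\<close>

context lorentz_splitting
begin

lemma ex_projection:
  obtains \<pi> where "linear \<pi>" "\<And>x. \<pi> x \<in> K" "\<And>x. x - \<pi> x \<in> lperp i0 K"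
    "\<And>k s. k \<in> K \<Longrightarrow> s \<in> lperp i0 K \<Longrightarrow> \<pi> (k + s) = k"
proof -
  have "\<forall>x. \<exists>k. k \<in> K \<and> x - k \<in> lperp i0 K"
  proof
    fix x
    obtain k s where "k \<in> K" "s \<in> lperp i0 K" "x = k + s"
      using decomposition by blast
    then show "\<exists>k. k \<in> K \<and> x - k \<in> lperp i0 K"
      by (intro exI[of _ k]) simp
  qed
  then obtain \<pi> where \<pi>: "\<And>x. \<pi> x \<in> K" "\<And>x. x - \<pi> x \<in> lperp i0 K"
    by metis
  have unique: "\<pi> x = k" if "k \<in> K" "x - k \<in> lperp i0 K" for x k
  proof -
    have "\<pi> x - k \<in> K"
      using \<pi>(1) that(1) subspace_K by (rule subspace_diff[rotated])
    moreover have "(x - k) - (x - \<pi> x) \<in> lperp i0 K"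
      using that(2) \<pi>(2) by (rule subspace_diff[OF subspace_lperp])
    then have "\<pi> x - k \<in> lperp i0 K"
      by simp
    ultimately show ?thesis
      using K_lperp_0 by force
  qed
  have "linear \<pi>"
  proof (rule linearI)
    fix x y and c :: real
    have "(x - \<pi> x) + (y - \<pi> y) \<in> lperp i0 K" "c *\<^sub>R (x - \<pi> x) \<in> lperp i0 K"
      using \<pi>(2) subspace_lperp by (blast intro: subspace_add subspace_scale)+
    then show "\<pi> (x + y) = \<pi> x + \<pi> y" "\<pi> (c *\<^sub>R x) = c *\<^sub>R \<pi> x"
      using \<pi>(1) subspace_K
      by (auto intro!: unique subspace_add subspace_scale simp: algebra_simps)
  qed
  then show ?thesis
    using \<pi> unique that by simp
qed

lemma lform_decomposed:
  assumes "k \<in> K" "s \<in> lperp i0 K"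
  shows "lform i0 (k + s) (k + s) = lform i0 k k + lform i0 s s"
proof -
  have "lform i0 s k = 0"
    using assms by (simp add: lperp_def)
  then show ?thesis
    by (simp add: lform_bilinear lform_commute[of i0 k s])
qed

lemma timelike_component:
  assumes "k \<in> K" "s \<in> lperp i0 K" "lform i0 (k + s) (k + s) < 0"
  shows "lform i0 k k < 0"
proof -
  have "lform i0 s s \<ge> 0"
    using assms(2) pos_def unfolding pos_def_on_def by (cases "s = 0") (force simp: lform_bilinear)+
  then show ?thesis
    using lform_decomposed assms by simp
qed

lemma ex_timelike: "\<exists>v\<in>K. lform i0 v v < 0"
proof -
  obtain k s where "k \<in> K" "s \<in> lperp i0 K" "axis i0 1 = k + s"
    using decomposition by blast
  then show ?thesis
    using timelike_component[of k s] lform_axis(1)[of i0] by auto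
qed

lemma T_diff_invariant: "subspace U \<Longrightarrow> T ` U \<subseteq> U \<Longrightarrow> x \<in> U \<Longrightarrow> T x - x \<in> U"
  by (blast intro: subspace_diff)

text \<open>The subspaces of \<open>K\<close> containing \<open>C\<close> are parametrised by the subspaces of the
  quotient \<open>K / C\<close>, modelled by \<open>real^'m\<close> through the quotient map \<open>a\<close> and its section \<open>b\<close>.\<close>
lemma GammaT_homeomorphic:
  fixes a :: "real^'n \<Rightarrow> real^'m::finite" and b :: "real^'m \<Rightarrow> real^'n"
  assumes a: "linear a" and b: "linear b" and C: "subspace C" "C \<subseteq> K"
    and ab: "\<And>y. a (b y) = y" and bK: "\<And>y. b y \<in> K" and ba: "\<And>x. x \<in> K \<Longrightarrow> x - b (a x) \<in> C"
    and aC: "\<And>x. x \<in> C \<Longrightarrow> a x = 0"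
    and TC: "\<And>x. x \<in> K \<Longrightarrow> T x - x \<in> C"
    and C_min: "\<And>U v. subspace U \<Longrightarrow> T ` U \<subseteq> U \<Longrightarrow> v \<in> U \<Longrightarrow> v \<in> K \<Longrightarrow> lform i0 v v < 0 \<Longrightarrow> C \<subseteq> U"
    and good: "\<And>X. subspace X \<Longrightarrow> C \<subseteq> X \<Longrightarrow> X \<subseteq> K \<Longrightarrow> (\<exists>v\<in>X. lform i0 v v < 0) \<longleftrightarrow> good (a ` X)"
    and good0: "\<not> good {0}"
    and R: "\<And>j. R j = {W. subspace W \<and> dim W = j + 1 \<and> good W}"
  shows "subsp_top (GammaT i0 T k) homeomorphic_space
    sum_topology (\<lambda>(k1, k2). prod_topology (subsp_top (R k1)) (subsp_top (S_inv (lperp i0 K) T k2)))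
      {(k1, k2). k1 + k2 + dim C = k}"
proof -
  obtain \<pi> where \<pi>: "linear \<pi>" "\<And>x. \<pi> x \<in> K" "\<And>x. x - \<pi> x \<in> lperp i0 K"
    "\<And>k s. k \<in> K \<Longrightarrow> s \<in> lperp i0 K \<Longrightarrow> \<pi> (k + s) = k"
    using ex_projection by metis
  let ?P = "\<lambda>x. x - \<pi> x"
  have P: "linear ?P"
    using linear_compose_sub[OF linear_ident \<pi>(1)] .
  have A: "linear (a \<circ> \<pi>)"
    using \<pi>(1) a by (rule linear_compose)
  have \<pi>K: "\<pi> x = x" if "x \<in> K" for x
    using \<pi>(4)[OF that subspace_0[OF subspace_lperp]] by simp
  have TP: "T (?P x) = ?P (T x)" for x
  proof -
    have "\<pi> (T x) = \<pi> (T (\<pi> x) + T (?P x))"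
      by (simp add: linear_diff[OF linear_T])
    also have "\<dots> = T (\<pi> x)"
      using \<pi>(2,3) T_K T_lperp by (intro \<pi>(4)) blast+
    finally show ?thesis
      by (simp add: linear_diff[OF linear_T])
  qed
  have dim_b: "dim (b ` W) = dim W" if "subspace W" for W
    using ab by (intro dim_image_eq[OF b]) (metis inj_on_def)
  have bC: "b ` W \<inter> C = {0}" if "subspace W" for W
  proof -
    have "b y = 0" if "b y \<in> C" for y
      using aC[OF that] ab linear_0[OF b] by simp
    moreover have "0 \<in> b ` W"
      using linear_0[OF b] subspace_0[OF that] by force
    ultimately show ?thesis
      using subspace_0[OF C(1)] by auto
  qed
  \<comment> \<open>\<open>homeomorphic_strata\<close> groups \<open>C\<close> with
    \<open>W2\<close>, while the arguments below use \<open>b W + C\<close>, the full preimage of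
    \<open>W\<close> in \<open>K\<close> under the quotient map.\<close>
  have assoc: "set_sum X (set_sum Y Z) = set_sum (set_sum X Y) Z" for X Y Z :: "(real^'n) set"
    by (auto simp: add.assoc) (metis add.assoc)+
  have C_sub_sum: "C \<subseteq> set_sum (b ` W) C" if "subspace W" for W
  proof
    fix x assume "x \<in> C"
    moreover have "0 \<in> b ` W"
      using linear_0[OF b] subspace_0[OF that] by force
    ultimately show "x \<in> set_sum (b ` W) C"
      by (metis (mono_tags, lifting) add_0 mem_Collect_eq)
  qed
  have sum_sub_K: "set_sum (b ` W) C \<subseteq> K" for W
    using bK C(2) subspace_K by (auto intro: subspace_add)
  have a_sum: "a ` set_sum (b ` W) C = W" for W
  proof -
    have "a ` set_sum (b ` W) C = {a (b y + c) |y c. y \<in> W \<and> c \<in> C}"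
      by blast
    also have "\<dots> = {y |y c. y \<in> W \<and> c \<in> C}"
      using linear_add[OF a] ab aC by (metis (no_types, lifting) add_0_right)
    also have "\<dots> = W"
      using subspace_0[OF C(1)] by blast
    finally show ?thesis .
  qed
  have subspace_sum: "subspace (set_sum (b ` W) C)" if "subspace W" for W
    using subspace_sums[OF linear_subspace_image[OF b that] C(1)] .
  have dim_sum: "dim (set_sum (b ` W) C) = dim W + dim C" if "subspace W" for W
    using dim_sums_Int[OF linear_subspace_image[OF b that] C(1)] bC[OF that] dim_b[OF that] by simp
  have dim_KP: "dim (set_sum X Y) = dim X + dim Y"
    if "subspace X" "subspace Y" "X \<subseteq> K" "Y \<subseteq> lperp i0 K" for X Y
  proof -
    have "X \<inter> Y = {0}"
      using that K_lperp_0 subspace_0 by blast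
    then show ?thesis
      using dim_sums_Int[OF that(1,2)] by simp
  qed
  have \<pi>_sum: "\<pi> ` set_sum X Y = X" "?P ` set_sum X Y = Y"
    if X: "subspace X" "X \<subseteq> K" and Y: "subspace Y" "Y \<subseteq> lperp i0 K" for X Y
  proof -
    have xy: "\<pi> (x + y) = x" "?P (x + y) = y" if "x \<in> X" "y \<in> Y" for x y
      using \<pi>(4)[OF subsetD[OF X(2) that(1)] subsetD[OF Y(2) that(2)]] by simp_all
    have 0: "0 \<in> X" "0 \<in> Y"
      using X(1) Y(1) by (simp_all add: subspace_0)
    have "\<pi> ` set_sum X Y = {\<pi> (x + y) |x y. x \<in> X \<and> y \<in> Y}"
      by blast
    also have "{\<pi> (x + y) |x y. x \<in> X \<and> y \<in> Y} = {x |x y. x \<in> X \<and> y \<in> Y}"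
      using xy(1) by metis
    also have "\<dots> = X"
      using 0(2) by blast
    finally show "\<pi> ` set_sum X Y = X" .
    have "?P ` set_sum X Y = {?P (x + y) |x y. x \<in> X \<and> y \<in> Y}"
      by blast
    also have "\<dots> = {y |x y. x \<in> X \<and> y \<in> Y}"
      using xy(2) by metis
    also have "\<dots> = Y"
      using 0(1) by blast
    finally show "?P ` set_sum X Y = Y" .
  qed
  have decomp: "\<pi> ` U \<subseteq> U" "?P ` U \<subseteq> U" "set_sum (\<pi> ` U) (?P ` U) = U"
    if U: "subspace U" "T ` U \<subseteq> U" for U
  proof -
    have *: "\<pi> x \<in> U" "?P x \<in> U" if "x \<in> U" for x
    proof -
      have "\<pi> x + ?P x \<in> U"
        using that by simp
      then show "\<pi> x \<in> U" "?P x \<in> U"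
        by (rule invariant_subspace_components[OF U \<pi>(2) \<pi>(3)])+
    qed
    then show "\<pi> ` U \<subseteq> U" "?P ` U \<subseteq> U"
      by auto
    show "set_sum (\<pi> ` U) (?P ` U) = U"
    proof
      show "set_sum (\<pi> ` U) (?P ` U) \<subseteq> U"
        using * U(1) by (auto intro: subspace_add simp del: add_diff_eq)
      show "U \<subseteq> set_sum (\<pi> ` U) (?P ` U)"
      proof
        fix x assume "x \<in> U"
        then show "x \<in> set_sum (\<pi> ` U) (?P ` U)"
          by (intro CollectI exI[of _ "\<pi> x"] exI[of _ "?P x"]) auto
      qed
    qed
  qed
  have Gamma: "subspace U" "T ` U \<subseteq> U" "dim U = k + 1" "C \<subseteq> \<pi> ` U" "\<exists>v\<in>\<pi> ` U. lform i0 v v < 0"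
    "set_sum (b ` a ` \<pi> ` U) C = \<pi> ` U" "a ` \<pi> ` U \<in> R (dim (a ` \<pi> ` U) - 1)"
    "dim (a ` \<pi> ` U) \<ge> 1"
    if U: "U \<in> GammaT i0 T k" for U
  proof -
    show UU: "subspace U" "T ` U \<subseteq> U" "dim U = k + 1"
      using U by (auto simp: GammaT_def)
    have sub: "subspace (\<pi> ` U)"
      using linear_subspace_image[OF \<pi>(1) UU(1)] .
    obtain v where v: "v \<in> U" "lform i0 v v < 0"
      using U by (auto simp: GammaT_def)
    then have \<pi>v: "lform i0 (\<pi> v) (\<pi> v) < 0"
      using timelike_component[of "\<pi> v" "?P v"] \<pi>(2,3) by simp
    then show tl: "\<exists>v\<in>\<pi> ` U. lform i0 v v < 0"
      using v by blast
    have "C \<subseteq> U"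
      using C_min[OF UU(1,2) _ \<pi>(2) \<pi>v] decomp(1)[OF UU(1,2)] v(1) by blast
    then show CU: "C \<subseteq> \<pi> ` U"
      using \<pi>K C(2) by (metis image_eqI subset_iff)
    have K: "\<pi> ` U \<subseteq> K"
      using \<pi>(2) by blast
    show "set_sum (b ` a ` \<pi> ` U) C = \<pi> ` U"
    proof
      have ba_in: "b (a x) \<in> \<pi> ` U" if "x \<in> \<pi> ` U" for x
        using subspace_diff[OF sub that, of "x - b (a x)"] ba[of x] K CU that by auto
      then show "set_sum (b ` a ` \<pi> ` U) C \<subseteq> \<pi> ` U"
        using CU sub subspace_add[OF sub] by blast
      show "\<pi> ` U \<subseteq> set_sum (b ` a ` \<pi> ` U) C"
      proof
        fix x assume "x \<in> \<pi> ` U"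
        then show "x \<in> set_sum (b ` a ` \<pi> ` U) C"
          using ba[of x] K by (intro CollectI exI[of _ "b (a x)"] exI[of _ "x - b (a x)"]) auto
      qed
    qed
    have g: "good (a ` \<pi> ` U)"
      using good[OF sub CU K] tl by blast
    have suba: "subspace (a ` \<pi> ` U)"
      using linear_subspace_image[OF a sub] .
    \<comment> \<open>By \<open>good0\<close> the quotient image is not 0, so subtracting 1 from its
      dimension is genuine.\<close>
    have dim0: "dim (a ` \<pi> ` U) \<noteq> 0"
    proof
      assume "dim (a ` \<pi> ` U) = 0"
      then have "a ` \<pi> ` U = {0}"
        using dim_eq_0[of "a ` \<pi> ` U"] subspace_0[OF suba] by blast
      then show False
        using g good0 by simp
    qed
    then show "dim (a ` \<pi> ` U) \<ge> 1"
      by linarith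
    have "dim (a ` \<pi> ` U) = dim (a ` \<pi> ` U) - 1 + 1"
      using dim0 by linarith
    then show "a ` \<pi> ` U \<in> R (dim (a ` \<pi> ` U) - 1)"
      unfolding R using g suba by blast
  qed
  show ?thesis
  proof (rule homeomorphic_strata[OF A b P, where d = "k + 1" and C = C and c = "dim C" and k = k])
    show "subspace U \<and> dim U = k + 1" if "U \<in> GammaT i0 T k" for U
      using that by (simp add: GammaT_def)
    show "subspace W \<and> dim W = Suc j" if "W \<in> R j" for j W
      using that by (simp add: R)
    show "subspace W \<and> dim W = j" if "W \<in> S_inv (lperp i0 K) T j" for j W
      using that by (simp add: S_inv_def)
    show "set_sum (b ` (a \<circ> \<pi>) ` U) (set_sum C (?P ` U)) = U" if U: "U \<in> GammaT i0 T k" for U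
      unfolding assoc image_comp[symmetric] Gamma(6)[OF U] using decomp(3) Gamma(1,2)[OF U] .
    show "\<exists>(k1, k2)\<in>{(k1, k2). k1 + k2 + dim C = k}.
        (a \<circ> \<pi>) ` U \<in> R k1 \<and> ?P ` U \<in> S_inv (lperp i0 K) T k2" if U: "U \<in> GammaT i0 T k" for U
    proof -
      note G = Gamma[OF U]
      have sub: "subspace (\<pi> ` U)" "subspace (?P ` U)" "subspace (a ` \<pi> ` U)"
        using linear_subspace_image[OF \<pi>(1) G(1)] linear_subspace_image[OF P G(1)]
          linear_subspace_image[OF a linear_subspace_image[OF \<pi>(1) G(1)]] .
      have "\<pi> ` U \<subseteq> K" and PU: "?P ` U \<subseteq> lperp i0 K"
        using \<pi>(2,3) by blast+
      then have "dim U = dim (\<pi> ` U) + dim (?P ` U)"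
        using dim_KP[OF sub(1,2)] unfolding decomp(3)[OF G(1,2)] by blast
      moreover have "dim (\<pi> ` U) = dim (a ` \<pi> ` U) + dim C"
        using dim_sum[OF sub(3)] unfolding G(6) .
      ultimately have "dim (a ` \<pi> ` U) - 1 + dim (?P ` U) + dim C = k"
        using G(3,8) by simp
      moreover have "?P ` U \<in> S_inv (lperp i0 K) T (dim (?P ` U))"
      proof -
        have "T ` ?P ` U \<subseteq> ?P ` U"
        proof
          fix z assume "z \<in> T ` ?P ` U"
          then obtain x where "x \<in> U" "z = T (?P x)"
            by blast
          then show "z \<in> ?P ` U"
            using TP[of x] G(2) by blast
        qed
        then show ?thesis
          unfolding S_inv_def using sub(2) PU by blast
      qed
      ultimately show ?thesis
        using G(7) unfolding image_comp[symmetric]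
        by (intro bexI[of _ "(dim (a ` \<pi> ` U) - 1, dim (?P ` U))"]) simp_all
    qed
    fix k1 k2 W1 W2
    assume k: "(k1, k2) \<in> {(k1, k2). k1 + k2 + dim C = k}" and W1: "W1 \<in> R k1"
      and W2: "W2 \<in> S_inv (lperp i0 K) T k2"
    let ?X = "set_sum (b ` W1) C"
    have sub: "subspace W1" "subspace W2" "W2 \<subseteq> lperp i0 K" "subspace ?X" "T ` W2 \<subseteq> W2"
      using W1 W2 subspace_sum by (auto simp: R S_inv_def)
    have subU: "subspace (set_sum ?X W2)"
      using subspace_sums sub by blast
    \<comment> \<open>\<open>T\<close> moves vectors of \<open>K\<close> only by elements of
      \<open>C\<close>, so every subspace between \<open>C\<close> and \<open>K\<close> is
      invariant.\<close>
    have TX: "T x \<in> ?X" if x: "x \<in> ?X" for x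
    proof -
      have "T x - x \<in> ?X"
        using TC[OF subsetD[OF sum_sub_K x]] C_sub_sum[OF sub(1)] by blast
      from subspace_add[OF sub(4) x this] show ?thesis
        by (simp only: add_diff_eq add_diff_cancel_left')
    qed
    have "T ` set_sum ?X W2 \<subseteq> set_sum ?X W2"
    proof
      fix z assume "z \<in> T ` set_sum ?X W2"
      then obtain x y where "z = T (x + y)" and xy: "x \<in> ?X" "y \<in> W2"
        by blast
      then have "z = T x + T y"
        by (simp add: linear_add[OF linear_T])
      moreover have "T x \<in> ?X" "T y \<in> W2"
        using TX xy sub(5) by blast+
      ultimately show "z \<in> set_sum ?X W2"
        by blast
    qed
    then have "T ` set_sum ?X W2 = set_sum ?X W2"
      using PO_image_eq[OF PO subU] by blast
    moreover have "dim (set_sum ?X W2) = k + 1"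
      using dim_KP[OF sub(4,2) sum_sub_K sub(3)] dim_sum[OF sub(1)] W1 W2 k by (simp add: R S_inv_def)
    moreover have "\<exists>v\<in>set_sum ?X W2. lform i0 v v < 0"
    proof -
      have "good (a ` ?X)"
        unfolding a_sum using W1 by (simp add: R)
      then obtain v where "v \<in> ?X" "lform i0 v v < 0"
        using good[OF sub(4) C_sub_sum[OF sub(1)] sum_sub_K] by blast
      then show ?thesis
        using subspace_0[OF sub(2)] by (metis (mono_tags, lifting) add.right_neutral mem_Collect_eq)
    qed
    ultimately have "set_sum ?X W2 \<in> GammaT i0 T k"
      using subU by (simp add: GammaT_def)
    moreover have "(a \<circ> \<pi>) ` set_sum ?X W2 = W1"
      unfolding image_comp[symmetric] \<pi>_sum(1)[OF sub(4) sum_sub_K sub(2,3)] by (rule a_sum)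
    moreover have "?P ` set_sum ?X W2 = W2"
      using \<pi>_sum(2)[OF sub(4) sum_sub_K sub(2,3)] .
    ultimately show "set_sum (b ` W1) (set_sum C W2) \<in> GammaT i0 T k
        \<and> (a \<circ> \<pi>) ` set_sum (b ` W1) (set_sum C W2) = W1
        \<and> ?P ` set_sum (b ` W1) (set_sum C W2) = W2"
      unfolding assoc by blast
  qed simp
qed

end

section \<open>The elliptic case\<close>

lemma dim_spatial_part:
  fixes L :: "(real^'n::finite) set"
  assumes "subspace L" "axis i0 1 \<in> L"
  shows "dim {x \<in> L. x $ i0 = 0} + 1 = dim L"
proof -
  let ?e = "axis i0 (1::real) :: real^'n"
  have "span {?e} \<subseteq> L"
    using assms by (intro span_minimal) auto
  then have "dim {y \<in> L. \<forall>x\<in>span {?e}. orthogonal x y} + dim (span {?e}) = dim L"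
    by (rule dim_subspace_orthogonal_to_vectors[OF subspace_span assms(1)])
  moreover have "{y \<in> L. \<forall>x\<in>span {?e}. orthogonal x y} = {x \<in> L. x $ i0 = 0}"
    by (auto simp: span_singleton orthogonal_def inner_axis')
  moreover have "dim (span {?e}) = 1"
    by simp
  ultimately show ?thesis
    by simp
qed

lemma subspace_spatial_part: "subspace L \<Longrightarrow> subspace {x \<in> L. x $ i0 = 0}"
  by (auto simp: subspace_def)

text \<open>Reflecting in \<open>v + e\<^sub>0\<close> instead of \<open>v - e\<^sub>0\<close> avoids the degenerate case \<open>v = e\<^sub>0\<close>.\<close>
lemma ex_lorentz_reflection:
  fixes v :: "real^'n::finite"
  assumes "lform i0 v v < 0"
  obtains \<rho> c where "linear \<rho>" "\<And>x y. lform i0 (\<rho> x) (\<rho> y) = lform i0 x y" "\<And>x. \<rho> (\<rho> x) = x"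
    "\<rho> (c *\<^sub>R v) = axis i0 1"
proof -
  define e where "e = (axis i0 1 :: real^'n)"
  have v0: "v $ i0 \<noteq> 0"
  proof -
    have "v \<noteq> 0"
      using assms by (auto simp: lform_bilinear)
    then show ?thesis
      using causal_time_nonzero[of i0 v] assms by simp
  qed
  \<comment> \<open>This normalises \<open>v\<close> to a future-pointing \<open>u\<close> with form
    value -1. Then \<open>n = u + e\<close> satisfies
    \<open>lform i0 n n = - 2 - 2 * u $ i0 < 0\<close>, so the reflection in \<open>n\<close>
    exists.\<close>
  define c where "c = sgn (v $ i0) / sqrt (- lform i0 v v)"
  define u where "u = c *\<^sub>R v"
  have "c\<^sup>2 = 1 / (- lform i0 v v)"
    using v0 assms by (simp add: c_def power_divide power2_eq_square sgn_mult_self_eq)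
  then have uu: "lform i0 u u = - 1"
    using assms by (simp add: u_def lform_bilinear power2_eq_square[symmetric] mult.assoc[symmetric])
  have "u $ i0 = \<bar>v $ i0\<bar> / sqrt (- lform i0 v v)"
    by (simp add: u_def c_def abs_sgn)
  then have u0: "u $ i0 > 0"
    using v0 assms by simp
  define n where "n = u + e"
  have ee: "lform i0 e e = - 1" and xe: "lform i0 x e = - x $ i0" for x
    by (simp_all add: e_def lform_axis)
  have nn: "lform i0 n n = - 2 - 2 * u $ i0"
    by (simp add: n_def lform_bilinear uu ee xe lform_commute[of i0 e u]) (simp add: e_def)
  then have nn0: "lform i0 n n \<noteq> 0"
    using u0 by simp
  define q where "q = (\<lambda>x. 2 * lform i0 x n / lform i0 n n)"
  have q: "q x * lform i0 n n = 2 * lform i0 x n" for x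
    using nn0 by (simp add: q_def)
  define r where "r = (\<lambda>x. x - q x *\<^sub>R n)"
  have "linear r"
    by (rule linearI) (simp_all add: r_def q_def lform_bilinear algebra_simps add_divide_distrib)
  moreover have iso: "lform i0 (r x) (r y) = lform i0 x y" for x y
  proof -
    have "lform i0 (r x) (r y) = lform i0 x y - q y * lform i0 x n - q x * lform i0 y n + q x * (q y * lform i0 n n)"
      by (simp add: r_def lform_bilinear lform_commute[of i0 n y] algebra_simps)
    moreover have "q x * (q y * lform i0 n n) = 2 * (q x * lform i0 y n)"
      by (simp only: q mult.left_commute)
    moreover have "q x * (q y * lform i0 n n) = q y * (q x * lform i0 n n)"
      by (rule mult.left_commute)
    moreover have "q y * (q x * lform i0 n n) = 2 * (q y * lform i0 x n)"
      by (simp only: q mult.left_commute)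
    ultimately show ?thesis
      by linarith
  qed
  moreover have invol: "r (r x) = x" for x
  proof -
    have "lform i0 (r x) n = - lform i0 x n"
      using q[of x] by (simp add: r_def lform_bilinear)
    then have "q (r x) = - q x"
      by (simp add: q_def)
    then show ?thesis
      by (simp add: r_def)
  qed
  moreover have "r u = - e"
  proof -
    have "lform i0 u n = - 1 - u $ i0"
      by (simp add: n_def lform_bilinear uu xe)
    then have "q u = 1"
      using u0 by (simp add: q_def nn field_simps)
    then show ?thesis
      by (simp add: r_def n_def)
  qed
  \<comment> \<open>The reflection sends \<open>u\<close> to \<open>- e\<close>, whence the sign of
    the scalar.\<close>
  ultimately have "r ((- c) *\<^sub>R v) = e"
    using linear_neg[OF \<open>linear r\<close>, of u] by (simp add: u_def)
  then show ?thesis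
    using that[of r "- c"] \<open>linear r\<close> iso invol unfolding e_def by blast
qed

lemma lform_time_space: "y $ i0 = 0 \<Longrightarrow> lform i0 (c *\<^sub>R axis i0 1 + y) (c *\<^sub>R axis i0 1 + y) = (norm y)\<^sup>2 - c\<^sup>2"
  by (simp add: lform_bilinear lform_axis lform_commute[of i0 "axis i0 1" y])
    (simp add: lform_inner dot_square_norm power2_eq_square)

text \<open>After a reflection the subspace contains the time axis. There the form is the squared
  norm of the spatial part minus the squared time coordinate, so a Euclidean isometry of the spatial
  parts extends.\<close>

lemma ex_lorentz_isometry:
  fixes K :: "(real^'n::finite) set" and m0 :: "'m::finite"
  assumes K: "subspace K" "v \<in> K" "lform i0 v v < 0" and dim: "dim K = CARD('m)"
  obtains a :: "real^'n \<Rightarrow> real^'m" and b where "linear a" "linear b" "\<And>y. a (b y) = y" "\<And>y. b y \<in> K"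
    "\<And>x. x \<in> K \<Longrightarrow> b (a x) = x" "\<And>x. x \<in> K \<Longrightarrow> lform m0 (a x) (a x) = lform i0 x x"
proof -
  obtain \<rho> c where \<rho>: "linear \<rho>" "\<And>x y. lform i0 (\<rho> x) (\<rho> y) = lform i0 x y" "\<And>x. \<rho> (\<rho> x) = x"
    "\<rho> (c *\<^sub>R v) = axis i0 1"
    using ex_lorentz_reflection[OF K(3)] by metis
  let ?e = "axis i0 1 :: real^'n" and ?f = "axis m0 1 :: real^'m"
  define L where "L = \<rho> ` K"
  have L: "subspace L" "?e \<in> L"
    using linear_subspace_image[OF \<rho>(1) K(1)] \<rho>(4)[symmetric] subspace_scale[OF K(1,2)] by (auto simp: L_def)
  have \<rho>K: "\<rho> x \<in> L \<longleftrightarrow> x \<in> K" for x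
    unfolding L_def using \<rho>(3) by (metis image_eqI imageE)
  have "dim L = dim K"
    unfolding L_def using \<rho>(3) by (intro dim_image_eq[OF \<rho>(1)]) (metis inj_onI)
  define L0 where "L0 = {x \<in> L. x $ i0 = 0}"
  define M0 where "M0 = {y::real^'m. y $ m0 = 0}"
  have "subspace L0" "subspace M0"
    using subspace_spatial_part[OF L(1)] subspace_spatial_part[OF subspace_UNIV, of m0]
    by (simp_all add: L0_def M0_def)
  moreover have "dim L0 = dim M0"
    using dim_spatial_part[OF L] dim_spatial_part[of UNIV m0] dim \<open>dim L = dim K\<close>
    by (simp add: L0_def M0_def)
  ultimately obtain f g where fg: "linear f" "linear g" "f ` L0 = M0" "g ` M0 = L0"
    "\<And>x. x \<in> L0 \<Longrightarrow> norm (f x) = norm x" "\<And>x. x \<in> M0 \<Longrightarrow> norm (g x) = norm x"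
    "\<And>x. x \<in> L0 \<Longrightarrow> g (f x) = x" "\<And>x. x \<in> M0 \<Longrightarrow> f (g x) = x"
    using isometries_subspaces[of L0 M0] by metis
  define a0 where "a0 = (\<lambda>z. z $ i0 *\<^sub>R ?f + f (z - z $ i0 *\<^sub>R ?e))"
  define b0 where "b0 = (\<lambda>y. y $ m0 *\<^sub>R ?e + g (y - y $ m0 *\<^sub>R ?f))"
  have lin: "linear a0" "linear b0"
    unfolding a0_def b0_def
    by (auto intro!: linearI simp: linear_add[OF fg(1)] linear_add[OF fg(2)] linear_diff[OF fg(1)]
        linear_diff[OF fg(2)] linear_cmul[OF fg(1)] linear_cmul[OF fg(2)] algebra_simps)
  have z: "z - z $ i0 *\<^sub>R ?e \<in> L0" if "z \<in> L" for z
    using that L by (simp add: L0_def subspace_diff subspace_scale)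
  have y: "y - y $ m0 *\<^sub>R ?f \<in> M0" for y
    by (simp add: M0_def)
  have fz: "f x $ m0 = 0" if "x \<in> L0" for x
    using fg(3) that by (auto simp: M0_def)
  have gy: "g x \<in> L0" "g x $ i0 = 0" if "x \<in> M0" for x
    using fg(4) that by (auto simp: L0_def)
  have ab0: "a0 (b0 y) = y" for y
    using gy[OF y] fg(8)[OF y] by (simp add: a0_def b0_def)
  have ba0: "b0 (a0 z) = z" if "z \<in> L" for z
    using fz[OF z[OF that]] fg(7)[OF z[OF that]] by (simp add: a0_def b0_def)
  have b0L: "b0 y \<in> L" for y
    using gy(1)[OF y[of y]] L by (simp add: b0_def L0_def subspace_add subspace_scale)
  have iso0: "lform m0 (a0 z) (a0 z) = lform i0 z z" if "z \<in> L" for z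
  proof -
    have "lform m0 (a0 z) (a0 z) = (norm (z - z $ i0 *\<^sub>R ?e))\<^sup>2 - (z $ i0)\<^sup>2"
      unfolding a0_def using fz[OF z[OF that]] fg(5)[OF z[OF that]] by (simp add: lform_time_space)
    also have "\<dots> = lform i0 z z"
      using lform_time_space[of "z - z $ i0 *\<^sub>R ?e" i0 "z $ i0"] by simp
    finally show ?thesis .
  qed
  show ?thesis
  proof
    show "linear (a0 \<circ> \<rho>)" "linear (\<rho> \<circ> b0)"
      using lin \<rho>(1) linear_compose by blast+
    show "(a0 \<circ> \<rho>) ((\<rho> \<circ> b0) y) = y" for y
      by (simp add: \<rho>(3) ab0)
    show "(\<rho> \<circ> b0) y \<in> K" for y
      using \<rho>K[of "\<rho> (b0 y)"] b0L \<rho>(3) by simp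
    show "(\<rho> \<circ> b0) ((a0 \<circ> \<rho>) x) = x" "lform m0 ((a0 \<circ> \<rho>) x) ((a0 \<circ> \<rho>) x) = lform i0 x x" if "x \<in> K" for x
      using that \<rho>K[of x] ba0 \<rho>(2,3) iso0 by simp_all
  qed
qed

lemma (in lorentz_splitting) elliptic_homeomorphic:
  fixes m0 :: "'m::finite"
  assumes fixed: "\<And>x. x \<in> K \<Longrightarrow> T x = x" and dim: "CARD('m) = dim K"
  shows "subsp_top (GammaT i0 T k) homeomorphic_space
    sum_topology (\<lambda>(k1, k2). prod_topology (subsp_top (GrH m0 k1)) (subsp_top (S_inv (lperp i0 K) T k2)))
      {(k1, k2). k1 + k2 = k}"
proof -
  obtain v where v: "v \<in> K" "lform i0 v v < 0"
    using ex_timelike by blast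
  obtain a :: "real^'n \<Rightarrow> real^'m" and b where ab: "linear a" "linear b" "\<And>y. a (b y) = y" "\<And>y. b y \<in> K"
    "\<And>x. x \<in> K \<Longrightarrow> b (a x) = x" "\<And>x. x \<in> K \<Longrightarrow> lform m0 (a x) (a x) = lform i0 x x"
    using ex_lorentz_isometry[OF subspace_K v, where ?m0.0 = m0] dim by metis
  have "subsp_top (GammaT i0 T k) homeomorphic_space
    sum_topology (\<lambda>(k1, k2). prod_topology (subsp_top (GrH m0 k1)) (subsp_top (S_inv (lperp i0 K) T k2)))
      {(k1, k2). k1 + k2 + dim {0::real^'n} = k}"
  proof (rule GammaT_homeomorphic[OF ab(1,2), where good = "\<lambda>Y. \<exists>y\<in>Y. lform m0 y y < 0"])
    show "x - b (a x) \<in> {0}" "T x - x \<in> {0}" if "x \<in> K" for x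
      using ab(5) fixed that by simp_all
    show "(\<exists>v\<in>X. lform i0 v v < 0) \<longleftrightarrow> (\<exists>y\<in>a ` X. lform m0 y y < 0)" if "X \<subseteq> K" for X
      using that ab(6) by (auto simp: subset_iff)
    show "GrH m0 j = {W. subspace W \<and> dim W = j + 1 \<and> (\<exists>y\<in>W. lform m0 y y < 0)}" for j
      by (simp add: GrH_def)
  qed (use ab subspace_K in \<open>auto simp: subspace_0 linear_0 lform_bilinear\<close>)
  then show ?thesis
    by simp
qed

section \<open>The parabolic case\<close>

locale parabolic_splitting = lorentz_splitting i0 T K g
  for i0 :: "'n::finite" and T :: "real^'n \<Rightarrow> real^'n" and K g +
  fixes w :: "real^'n"
  assumes w: "w \<noteq> 0" "lform i0 w w \<le> 0" "T w = w" "w \<in> K"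
    and unipotent: "unipotent_on K T"
    and not_fixed: "\<exists>x\<in>K. T x \<noteq> x"
begin

lemma lform_T_diff_w: "lform i0 (T x - x) w = 0"
  using PO_lform[OF PO, of x w] w(3) by (simp add: lform_bilinear)

text \<open>With \<open>d = T z - z\<close>, invariance of \<open>lform i0 z d\<close> yields
  \<open>lform i0 d d = 0\<close>; a null vector orthogonal to \<open>w\<close> is a multiple of
  \<open>w\<close>.\<close>

lemma T_diff_multiple_step:
  assumes "lform i0 z w = 0" "T (T z - z) - (T z - z) = c *\<^sub>R w"
  shows "\<exists>c. T z - z = c *\<^sub>R w"
proof -
  define d where "d = T z - z"
  have dw: "lform i0 d w = 0"
    unfolding d_def by (rule lform_T_diff_w)
  have "T z = z + d" "T d = d + c *\<^sub>R w"
    using assms(2) unfolding d_def[symmetric] by (simp_all add: d_def diff_eq_eq add.commute)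
  then have "lform i0 z d = lform i0 (z + d) (d + c *\<^sub>R w)"
    using PO_lform[OF PO, of z d] by simp
  also have "\<dots> = lform i0 z d + lform i0 d d"
    using assms(1) dw by (simp add: lform_bilinear)
  finally have "lform i0 d d = 0"
    by simp
  then show ?thesis
    using lform_orthogonal_causal(2)[OF w(2,1) dw] unfolding d_def by blast
qed

text \<open>Unipotence gives the claim for a high power of \<open>T - 1\<close>;
  \<open>T_diff_multiple_step\<close> lowers the exponent, since \<open>T z - z\<close> is again
  orthogonal to \<open>w\<close>.\<close>

lemma T_diff_orthogonal:
  assumes "z \<in> K" "lform i0 z w = 0"
  shows "\<exists>c. T z - z = c *\<^sub>R w"
proof -
  obtain N where "((\<lambda>y. T y - y) ^^ N) z = 0"
    using unipotent assms(1) unfolding unipotent_on_def by blast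
  then have "((\<lambda>y. T y - y) ^^ Suc N) z = 0 *\<^sub>R w"
    using linear_0[OF linear_T] by simp
  then have "\<exists>c. ((\<lambda>y. T y - y) ^^ Suc N) z = c *\<^sub>R w" ..
  then show ?thesis
    using assms(2)
  proof (induction N arbitrary: z)
    case (Suc N)
    have "((\<lambda>y. T y - y) ^^ Suc N) (T z - z) = ((\<lambda>y. T y - y) ^^ Suc (Suc N)) z"
      by (simp only: funpow_Suc_right o_apply)
    then obtain c where "T (T z - z) - (T z - z) = c *\<^sub>R w"
      using Suc.IH[of "T z - z"] Suc.prems(1) lform_T_diff_w by metis
    then show ?case
      using T_diff_multiple_step Suc.prems(2) by blast
  qed simp
qed

text \<open>If \<open>w\<close> were timelike, \<open>K\<close> would be the sum of its line and its
  complement in \<open>K\<close>. On the latter \<open>T z - z\<close> is both a multiple of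
  \<open>w\<close> and orthogonal to it, so \<open>T\<close> would fix all of
  \<open>K\<close>.\<close>

lemma null: "lform i0 w w = 0"
proof (rule ccontr)
  assume nz: "lform i0 w w \<noteq> 0"
  have "T x = x" if x: "x \<in> K" for x
  proof -
    let ?z = "x - (lform i0 x w / lform i0 w w) *\<^sub>R w"
    have "?z \<in> K" "lform i0 ?z w = 0"
      using x w(4) subspace_K nz by (auto simp: lform_bilinear intro: subspace_diff subspace_scale)
    then obtain c where c: "T ?z - ?z = c *\<^sub>R w"
      using T_diff_orthogonal by blast
    moreover have "lform i0 (T ?z - ?z) w = 0"
      by (rule lform_T_diff_w)
    ultimately have "c = 0"
      using nz by (simp only: lform_bilinear) simp
    then have "T ?z = ?z"
      using c by simp
    then show ?thesis
      using w(3) by (simp add: linear_diff[OF linear_T] linear_cmul[OF linear_T])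
  qed
  then show False
    using not_fixed by blast
qed

text \<open>Up to the factor \<open>c\<close>, the vectors \<open>v\<close>, \<open>u\<close>,
  \<open>w\<close> form a Jordan chain of length three for \<open>T - 1\<close>.\<close>

lemma ex_parabolic_basis:
  obtains v u c where "v \<in> K" "lform i0 v w = 1" "u = T v - v" "T u - u = c *\<^sub>R w" "c \<noteq> 0"
proof -
  have "w \<notin> lperp i0 K"
    using K_lperp_0 w by blast
  then obtain y where y: "y \<in> K" "lform i0 y w \<noteq> 0"
    using lform_commute[of i0 w] by (auto simp: lperp_def)
  define v where "v = (1 / lform i0 y w) *\<^sub>R y"
  have v: "v \<in> K" "lform i0 v w = 1"
    using y subspace_K by (auto simp: v_def lform_bilinear subspace_scale)
  define u where "u = T v - v"
  have uK: "u \<in> K"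
    unfolding u_def using T_diff_invariant[OF subspace_K T_K v(1)] .
  have uw: "lform i0 u w = 0"
    unfolding u_def by (rule lform_T_diff_w)
  obtain c where c: "T u - u = c *\<^sub>R w"
    using T_diff_orthogonal[OF uK uw] by blast
  have Tv: "T v = v + u" and Tu: "T u = u + c *\<^sub>R w"
    using c by (simp_all add: u_def algebra_simps)
  \<comment> \<open>For \<open>c = 0\<close> the vector \<open>u\<close> would be null, hence
    \<open>d *\<^sub>R w\<close>, and comparing the form at \<open>v\<close> and \<open>T v\<close>
    gives \<open>d = 0\<close>. So \<open>T\<close> fixes \<open>v\<close>; pairing
    \<open>T z = z + e w\<close> with \<open>v\<close> shows that it fixes every \<open>z\<close> in
    \<open>K\<close> orthogonal to \<open>w\<close> too.\<close>
  have "c \<noteq> 0"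
  proof
    assume "c = 0"
    have "lform i0 (v + u) u = lform i0 v u"
      using PO_lform[OF PO, of v u] Tv Tu \<open>c = 0\<close> by simp
    then have "lform i0 u u = 0"
      by (simp add: lform_bilinear)
    then obtain d where d: "u = d *\<^sub>R w"
      using lform_orthogonal_causal(2)[OF w(2,1) uw] by blast
    have "lform i0 (v + u) (v + u) = lform i0 v v"
      using PO_lform[OF PO, of v v] Tv by simp
    then have "d = 0"
      unfolding d using v(2) null by (simp add: lform_bilinear lform_commute[of i0 w v])
    then have Tvv: "T v = v"
      using Tv d by simp
    have "T x = x" if x: "x \<in> K" for x
    proof -
      let ?z = "x - lform i0 x w *\<^sub>R v"
      have z: "?z \<in> K" "lform i0 ?z w = 0"
        using x v subspace_K by (auto simp: lform_bilinear intro: subspace_diff subspace_scale)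
      then obtain e where e: "T ?z - ?z = e *\<^sub>R w"
        using T_diff_orthogonal by blast
      then have "lform i0 (?z + e *\<^sub>R w) v = lform i0 ?z v"
        using PO_lform[OF PO, of ?z v] Tvv by (metis add_diff_cancel_left' add.commute diff_add_cancel)
      then have "e = 0"
        using v(2) by (simp add: lform_bilinear lform_commute[of i0 w v])
      then have "T ?z = ?z"
        using e by simp
      then show ?thesis
        using Tvv by (simp add: linear_diff[OF linear_T] linear_cmul[OF linear_T])
    qed
    then show False
      using not_fixed by blast
  qed
  then show ?thesis
    using that v c u_def by blast
qed

text \<open>On \<open>K\<close> the difference \<open>T x - x\<close> equals
  \<open>lform i0 x w *\<^sub>R u\<close> plus a multiple of \<open>w\<close>. For timelike
  \<open>x\<close> the coefficient of \<open>u\<close> is nonzero, so applying \<open>T - 1\<close>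
  twice isolates \<open>w\<close>, and then once isolates \<open>u\<close>.\<close>

lemma parabolic_structure:
  obtains v u where "v \<in> K" "lform i0 v w = 1" "u \<in> K" "lform i0 u w = 0" "dim (span {w, u}) = 2"
    "\<And>x. x \<in> K \<Longrightarrow> T x - x \<in> span {w, u}"
    "\<And>U x. subspace U \<Longrightarrow> T ` U \<subseteq> U \<Longrightarrow> x \<in> U \<Longrightarrow> x \<in> K \<Longrightarrow> lform i0 x x < 0 \<Longrightarrow> span {w, u} \<subseteq> U"
proof -
  obtain v u c where v: "v \<in> K" "lform i0 v w = 1" and u: "u = T v - v"
    and c: "T u - u = c *\<^sub>R w" "c \<noteq> 0"
    using ex_parabolic_basis by metis
  have uK: "u \<in> K"
    unfolding u using T_diff_invariant[OF subspace_K T_K v(1)] .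
  have uw: "lform i0 u w = 0"
    unfolding u by (rule lform_T_diff_w)
  have "u \<notin> span {w}"
  proof
    assume "u \<in> span {w}"
    then obtain d where "u = d *\<^sub>R w"
      by (auto simp: span_singleton)
    then have "T u - u = 0"
      using w(3) by (simp add: linear_cmul[OF linear_T])
    then show False
      using c w(1) by simp
  qed
  then have dim2: "dim (span {w, u}) = 2"
    using w(1) by (simp add: insert_commute[of w] dim_insert)
  have D: "\<exists>e. T x - x = lform i0 x w *\<^sub>R u + e *\<^sub>R w" if x: "x \<in> K" for x
  proof -
    let ?z = "x - lform i0 x w *\<^sub>R v"
    have z: "?z \<in> K" "lform i0 ?z w = 0"
      using x v subspace_K by (auto simp: lform_bilinear intro: subspace_diff subspace_scale)
    then obtain e where e: "T ?z - ?z = e *\<^sub>R w"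
      using T_diff_orthogonal by blast
    moreover have "T ?z - ?z = (T x - x) - lform i0 x w *\<^sub>R u"
      by (simp add: linear_diff[OF linear_T] linear_cmul[OF linear_T] u algebra_simps)
    ultimately have "T x - x = lform i0 x w *\<^sub>R u + e *\<^sub>R w"
      by (simp add: algebra_simps)
    then show ?thesis ..
  qed
  show ?thesis
  proof (rule that[OF v uK uw dim2])
    show "T x - x \<in> span {w, u}" if x: "x \<in> K" for x
    proof -
      obtain e where "T x - x = lform i0 x w *\<^sub>R u + e *\<^sub>R w"
        using D[OF x] by blast
      then show ?thesis
        by (simp add: span_add span_scale span_base)
    qed
    fix U x
    assume U: "subspace U" "T ` U \<subseteq> U" and x: "x \<in> U" "x \<in> K" "lform i0 x x < 0"
    let ?\<alpha> = "lform i0 x w"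
    have \<alpha>: "?\<alpha> \<noteq> 0"
      using lform_orthogonal_timelike[of i0 x w] x(3) w(1) null by (auto simp: lform_commute[of i0 w x])
    obtain e where e: "T x - x = ?\<alpha> *\<^sub>R u + e *\<^sub>R w"
      using D[OF x(2)] by blast
    let ?d = "T x - x"
    have d: "?d \<in> U"
      using T_diff_invariant[OF U x(1)] .
    have "T ?d - ?d = ?\<alpha> *\<^sub>R (T u - u)"
      unfolding e by (simp add: linear_add[OF linear_T] linear_cmul[OF linear_T] w(3) algebra_simps)
    then have "T ?d - ?d = (?\<alpha> * c) *\<^sub>R w"
      by (simp add: c(1))
    then have "(?\<alpha> * c) *\<^sub>R w \<in> U"
      using T_diff_invariant[OF U d] by simp
    then have "(1 / (?\<alpha> * c)) *\<^sub>R (?\<alpha> * c) *\<^sub>R w \<in> U"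
      by (rule subspace_scale[OF U(1)])
    then have wU: "w \<in> U"
      using \<alpha> c(2) by simp
    have "(1 / ?\<alpha>) *\<^sub>R (?d - e *\<^sub>R w) \<in> U"
      by (rule subspace_scale[OF U(1) subspace_diff[OF U(1) d subspace_scale[OF U(1) wU]]])
    moreover have "(1 / ?\<alpha>) *\<^sub>R (?d - e *\<^sub>R w) = u"
      unfolding e using \<alpha> by simp
    ultimately have "u \<in> U"
      by metis
    then show "span {w, u} \<subseteq> U"
      using wU U(1) by (intro span_minimal) auto
  qed
qed

lemma dim_orthogonal_w:
  assumes "v \<in> K" "lform i0 v w = 1"
  shows "dim {x \<in> K. lform i0 x w = 0} + 1 = dim K"
proof -
  let ?H = "{x \<in> K. lform i0 x w = 0}"
  have H: "subspace ?H"
    using subspace_K by (auto simp: subspace_def lform_bilinear)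
  have "set_sum (span {v}) ?H = K"
  proof (intro equalityI subsetI)
    fix x assume "x \<in> set_sum (span {v}) ?H"
    then show "x \<in> K"
      using assms(1) subspace_K by (auto simp: span_singleton intro!: subspace_add subspace_scale)
  next
    fix x assume x: "x \<in> K"
    have "lform i0 x w *\<^sub>R v \<in> span {v}" "x - lform i0 x w *\<^sub>R v \<in> ?H"
      using x assms subspace_K by (auto simp: lform_bilinear span_base span_scale intro: subspace_diff subspace_scale)
    then show "x \<in> set_sum (span {v}) ?H"
      by (intro CollectI exI[of _ "lform i0 x w *\<^sub>R v"] exI[of _ "x - lform i0 x w *\<^sub>R v"]) simp
  qed
  moreover have "span {v} \<inter> ?H = {0}"
    using assms(2) subspace_0[OF subspace_K] by (auto simp: span_singleton lform_bilinear)
  moreover have "dim (span {v}) = 1"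
    using assms(2) by (auto simp: lform_bilinear)
  ultimately show ?thesis
    using dim_sums_Int[OF subspace_span[of "{v}"] H] by simp
qed

text \<open>The plane spanned by \<open>w\<close> and \<open>u\<close> is orthogonal to
  \<open>w\<close>, but a timelike vector is not, so it adds a third dimension.\<close>

lemma parabolic_dims: "3 \<le> dim K" "GammaT i0 T 0 = {}" "GammaT i0 T 1 = {}"
proof -
  obtain v u where v: "v \<in> K" "lform i0 v w = 1" and u: "u \<in> K" "lform i0 u w = 0"
    and dim2: "dim (span {w, u}) = 2"
    and C: "\<And>U x. subspace U \<Longrightarrow> T ` U \<subseteq> U \<Longrightarrow> x \<in> U \<Longrightarrow> x \<in> K \<Longrightarrow> lform i0 x x < 0 \<Longrightarrow> span {w, u} \<subseteq> U"
    using parabolic_structure by metis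
  have H: "subspace {x. lform i0 x w = 0}"
    by (auto simp: subspace_def lform_bilinear)
  have CH: "span {w, u} \<subseteq> {x. lform i0 x w = 0}"
    using u null H by (intro span_minimal) auto
  have dim3: "3 \<le> dim X" if X: "span {w, u} \<subseteq> X" "x \<in> X" "lform i0 x w \<noteq> 0" for X x
  proof -
    have "x \<notin> span {w, u}"
      using CH X(3) by blast
    then have "dim (insert x (span {w, u})) = 3"
      using dim2 by (simp only: dim_insert span_span if_False)
    then show ?thesis
      using dim_subset[of "insert x (span {w, u})" X] X by simp
  qed
  show "3 \<le> dim K"
  proof (rule dim3[OF _ v(1)])
    show "span {w, u} \<subseteq> K"
      using u(1) w(4) by (intro span_minimal subspace_K) auto
  qed (use v(2) in simp)
  have "2 \<le> k" if U: "U \<in> GammaT i0 T k" for U k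
  proof -
    have UU: "subspace U" "T ` U \<subseteq> U" "dim U = k + 1"
      using U by (auto simp: GammaT_def)
    obtain x where x: "x \<in> U" "lform i0 x x < 0"
      using U by (auto simp: GammaT_def)
    obtain a s where as: "a \<in> K" "s \<in> lperp i0 K" "x = a + s"
      using decomposition by blast
    have a: "a \<in> U" "lform i0 a a < 0"
      using invariant_subspace_components(1)[OF UU(1,2) as(1,2)] timelike_component[OF as(1,2)] x as(3) by auto
    have "lform i0 a w \<noteq> 0"
      using lform_orthogonal_timelike[of i0 a w] a(2) w(1) null by (auto simp: lform_commute[of i0 w a])
    then show ?thesis
      using dim3[OF C[OF UU(1,2) a(1) as(1) a(2)] a(1)] UU(3) by simp
  qed
  from this[where k = 0] this[where k = 1] show "GammaT i0 T 0 = {}" "GammaT i0 T 1 = {}"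
    by fastforce+
qed

text \<open>The pairing with \<open>w\<close> becomes the homogenising coordinate \<open>p0\<close>
  on the quotient. On \<open>H\<close> the form is degenerate, so the complement \<open>E\<close> of
  \<open>C\<close> in \<open>H\<close> is taken in the Euclidean sense; it serves only as a linear
  section.\<close>

lemma parabolic_homeomorphic:
  fixes p0 :: "'p::finite"
  assumes dim: "CARD('p) = dim K - 2" and k: "2 \<le> k"
  shows "subsp_top (GammaT i0 T k) homeomorphic_space
    sum_topology (\<lambda>(k1, k2). prod_topology (subsp_top (GrE p0 k1)) (subsp_top (S_inv (lperp i0 K) T k2)))
      {(k1, k2). k1 + k2 = k - 2}"
proof -
  obtain v u where v: "v \<in> K" "lform i0 v w = 1" and u: "u \<in> K" "lform i0 u w = 0"
    and dim2: "dim (span {w, u}) = 2" and TC: "\<And>x. x \<in> K \<Longrightarrow> T x - x \<in> span {w, u}"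
    and C_min: "\<And>U x. subspace U \<Longrightarrow> T ` U \<subseteq> U \<Longrightarrow> x \<in> U \<Longrightarrow> x \<in> K \<Longrightarrow> lform i0 x x < 0 \<Longrightarrow> span {w, u} \<subseteq> U"
    using parabolic_structure by metis
  define C where "C = span {w, u}"
  define H where "H = {x \<in> K. lform i0 x w = 0}"
  define E where "E = {y \<in> H. \<forall>x\<in>C. orthogonal x y}"
  define M0 where "M0 = {y::real^'p. y $ p0 = 0}"
  let ?f = "axis p0 1 :: real^'p"
  have C: "subspace C" "C \<subseteq> K"
    unfolding C_def using span_minimal[of "{w, u}" K] u(1) w(4) subspace_K by auto
  have H: "subspace H"
    using subspace_K unfolding H_def by (auto simp: subspace_def lform_bilinear)
  have CH: "C \<subseteq> H"
    unfolding C_def using u null w(4) H by (intro span_minimal) (auto simp: H_def)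
  have E: "subspace E"
    using H unfolding E_def by (auto simp: subspace_def orthogonal_clauses)
  have EH: "E \<subseteq> H" and HK: "H \<subseteq> K"
    by (auto simp: E_def H_def)
  have M0: "subspace M0"
    unfolding M0_def using subspace_spatial_part[OF subspace_UNIV, of p0] by simp
  have "dim E + 2 = dim H"
    using dim_subspace_orthogonal_to_vectors[OF C(1) H CH] dim2 by (simp add: E_def C_def)
  moreover have "dim H + 1 = dim K"
    using dim_orthogonal_w[OF v] by (simp add: H_def)
  moreover have "dim M0 + 1 = CARD('p)"
    using dim_spatial_part[of UNIV p0] by (simp add: M0_def)
  ultimately have "dim E = dim M0"
    using dim by simp
  then obtain f g where fg: "linear f" "linear g" "f ` E = M0" "g ` M0 = E"
    "\<And>x. x \<in> E \<Longrightarrow> g (f x) = x" "\<And>x. x \<in> M0 \<Longrightarrow> f (g x) = x"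
    using isometries_subspaces[OF E M0] by metis
  let ?pr = "closest_point E"
  have pr: "linear ?pr" "\<And>x. ?pr x \<in> E" "\<And>x. x \<in> E \<Longrightarrow> ?pr x = x"
    using E linear_closest_point_subspace closest_point_subspace_in closest_point_subspace_self by blast+
  have prC: "x - ?pr x \<in> C" if x: "x \<in> H" for x
  proof -
    obtain y z where yz: "y \<in> span C" "\<And>y. y \<in> span C \<Longrightarrow> orthogonal z y" "x = y + z"
      using orthogonal_subspace_decomp_exists by blast
    have y: "y \<in> C"
      using yz(1) C(1) by (simp add: span_eq_iff[THEN iffD2])
    have "x - y \<in> H"
      using x y CH H by (blast intro: subspace_diff)
    then have z: "z \<in> E"
      using yz(2,3) by (auto simp: E_def orthogonal_commute span_base)
    have "?pr x = z"
      using z y yz(3) by (intro closest_point_subspace_eqI[OF E]) (auto simp: E_def orthogonal_def)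
    then show ?thesis
      using yz(3) y by simp
  qed
  define a where "a = (\<lambda>x. lform i0 x w *\<^sub>R ?f + f (?pr (x - lform i0 x w *\<^sub>R v)))"
  define b where "b = (\<lambda>y. y $ p0 *\<^sub>R v + g (y - y $ p0 *\<^sub>R ?f))"
  have a: "linear a"
    unfolding a_def
    by (rule linearI) (simp_all add: lform_bilinear linear_add[OF fg(1)] linear_diff[OF fg(1)] linear_cmul[OF fg(1)]
        linear_add[OF pr(1)] linear_diff[OF pr(1)] linear_cmul[OF pr(1)] algebra_simps)
  have b: "linear b"
    unfolding b_def
    by (rule linearI) (simp_all add: linear_add[OF fg(2)] linear_diff[OF fg(2)] linear_cmul[OF fg(2)] algebra_simps)
  have gE: "g (y - y $ p0 *\<^sub>R ?f) \<in> E" for y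
  proof -
    have "y - y $ p0 *\<^sub>R ?f \<in> M0"
      by (simp add: M0_def)
    then show ?thesis
      using fg(4) by blast
  qed
  have ap0: "a x $ p0 = lform i0 x w" for x
  proof -
    have "f (?pr (x - lform i0 x w *\<^sub>R v)) \<in> M0"
      using fg(3) pr(2) by blast
    then show ?thesis
      by (simp add: a_def M0_def)
  qed
  have bw: "lform i0 (b y) w = y $ p0" for y
    using gE[of y] EH v(2) by (auto simp: b_def H_def lform_bilinear)
  have ab: "a (b y) = y" for y
  proof -
    have "a (b y) = y $ p0 *\<^sub>R ?f + f (g (y - y $ p0 *\<^sub>R ?f))"
      unfolding a_def bw using pr(3)[OF gE] by (simp add: b_def)
    also have "f (g (y - y $ p0 *\<^sub>R ?f)) = y - y $ p0 *\<^sub>R ?f"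
      by (rule fg(6)) (simp add: M0_def)
    finally show ?thesis
      by simp
  qed
  have "subsp_top (GammaT i0 T k) homeomorphic_space
    sum_topology (\<lambda>(k1, k2). prod_topology (subsp_top (GrE p0 k1)) (subsp_top (S_inv (lperp i0 K) T k2)))
      {(k1, k2). k1 + k2 + dim C = k}"
  proof (rule GammaT_homeomorphic[OF a b C ab, where good = "\<lambda>Y. \<not> Y \<subseteq> {x. x $ p0 = 0}"])
    show "b y \<in> K" for y
      using gE[of y] EH HK v(1) subspace_K unfolding b_def by (blast intro: subspace_add subspace_scale)
    show "x - b (a x) \<in> C" if x: "x \<in> K" for x
    proof -
      let ?h = "x - lform i0 x w *\<^sub>R v"
      have "?h \<in> H"
        using x v subspace_K by (auto simp: H_def lform_bilinear intro: subspace_diff subspace_scale)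
      moreover have "b (a x) = lform i0 x w *\<^sub>R v + ?pr ?h"
        unfolding b_def ap0 using fg(5)[OF pr(2)] by (simp add: a_def)
      ultimately show ?thesis
        using prC[of ?h] by (simp add: diff_diff_eq)
    qed
    show "a x = 0" if x: "x \<in> C" for x
    proof -
      have "lform i0 x w = 0"
        using x CH by (auto simp: H_def)
      moreover have "?pr x = 0"
        using x subspace_0[OF E] by (intro closest_point_subspace_eqI[OF E]) (auto simp: E_def orthogonal_def)
      ultimately show ?thesis
        by (simp add: a_def linear_0[OF fg(1)])
    qed
    show "T x - x \<in> C" if "x \<in> K" for x
      using TC[OF that] by (simp add: C_def)
    show "C \<subseteq> U" if "subspace U" "T ` U \<subseteq> U" "x \<in> U" "x \<in> K" "lform i0 x x < 0" for U x
      using C_min that by (simp add: C_def)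
    show "(\<exists>v\<in>X. lform i0 v v < 0) \<longleftrightarrow> \<not> a ` X \<subseteq> {x. x $ p0 = 0}" if X: "subspace X" "C \<subseteq> X" "X \<subseteq> K" for X
    proof -
      have "lform i0 x w \<noteq> 0" if "lform i0 x x < 0" for x
        using lform_orthogonal_timelike[of i0 x w] that w(1) null by (auto simp: lform_commute[of i0 w x])
      moreover have "\<exists>v\<in>X. lform i0 v v < 0" if x: "x \<in> X" "lform i0 x w \<noteq> 0" for x
      proof
        \<comment> \<open>As \<open>w\<close> is null, the form at \<open>x + t w\<close> is affine
          in \<open>t\<close>; this \<open>t\<close> makes it -1.\<close>
        let ?t = "- (lform i0 x x + 1) / (2 * lform i0 x w)"
        have "w \<in> X"
          using X(2) by (auto simp: C_def span_base)
        then show "x + ?t *\<^sub>R w \<in> X"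
          using x(1) X(1) by (intro subspace_add subspace_scale)
        have "lform i0 (x + ?t *\<^sub>R w) (x + ?t *\<^sub>R w) = lform i0 x x + ?t * (2 * lform i0 x w)"
          by (simp only: lform_bilinear lform_commute[of i0 w x] null) (simp add: algebra_simps)
        also have "\<dots> = - 1"
          using x(2) by simp
        finally show "lform i0 (x + ?t *\<^sub>R w) (x + ?t *\<^sub>R w) < 0"
          by simp
      qed
      ultimately show ?thesis
        by (auto simp: ap0 image_subset_iff)
    qed
    show "GrE p0 j = {W. subspace W \<and> dim W = j + 1 \<and> \<not> W \<subseteq> {x. x $ p0 = 0}}" for j
      by (simp add: GrE_def)
  qed simp
  moreover have "{(k1, k2). k1 + k2 + dim C = k} = {(k1, k2). k1 + k2 = k - 2}"
    using k dim2 by (auto simp: C_def)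
  ultimately show ?thesis
    by simp
qed

end

section \<open>The hyperbolic case\<close>

text \<open>Here \<open>C = K\<close> and the quotient is 0, which no \<open>real^'m\<close> models.
  There is a single stratum, and \<open>U\<close> is recovered as \<open>K\<close> plus its
  component in the complement.\<close>

lemma (in lorentz_splitting) hyperbolic_homeomorphic:
  assumes l: "l \<noteq> l'" and w: "T w = l *\<^sub>R w" and w': "T w' = l' *\<^sub>R w'"
    and null: "lform i0 w w = 0" "lform i0 w' w' = 0" "lform i0 w w' \<noteq> 0" and K: "K = span {w, w'}"
  shows "GammaT i0 T 0 = {}"
    "1 \<le> k \<Longrightarrow> subsp_top (GammaT i0 T k) homeomorphic_space subsp_top (S_inv (lperp i0 K) T (k - 1))"
proof -
  obtain \<pi> where \<pi>: "linear \<pi>" "\<And>x. \<pi> x \<in> K" "\<And>x. x - \<pi> x \<in> lperp i0 K"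
    "\<And>k s. k \<in> K \<Longrightarrow> s \<in> lperp i0 K \<Longrightarrow> \<pi> (k + s) = k"
    using ex_projection by metis
  let ?P = "\<lambda>x. x - \<pi> x"
  have P: "linear ?P"
    using linear_compose_sub[OF linear_ident \<pi>(1)] .
  have w0: "w \<noteq> 0"
    using null(3) by (auto simp: lform_bilinear)
  have "w' \<notin> span {w}"
    using null by (auto simp: span_singleton lform_bilinear)
  then have dimK: "dim K = 2"
    unfolding K using w0 by (simp add: insert_commute[of w] dim_insert)
  have KU: "K \<subseteq> U" if U: "U \<in> GammaT i0 T j" for U j
  proof -
    have UU: "subspace U" "T ` U \<subseteq> U"
      using U by (auto simp: GammaT_def)
    obtain v where v: "v \<in> U" "lform i0 v v < 0"
      using U by (auto simp: GammaT_def)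
    obtain x s where xs: "x \<in> K" "s \<in> lperp i0 K" "v = x + s"
      using decomposition by blast
    have x: "x \<in> U" "lform i0 x x < 0"
      using invariant_subspace_components(1)[OF UU xs(1,2)] timelike_component[OF xs(1,2)] v xs(3) by auto
    obtain c d where cd: "x = c *\<^sub>R w + d *\<^sub>R w'"
      using xs(1) by (auto simp: K span_insert span_singleton) (metis add.commute diff_add_cancel)
    have "c \<noteq> 0" "d \<noteq> 0"
      using x(2) null by (auto simp: cd lform_bilinear)
    have Tx: "T x = (c * l) *\<^sub>R w + (d * l') *\<^sub>R w'"
      by (simp add: cd linear_add[OF linear_T] linear_cmul[OF linear_T] w w')
    have "T x \<in> U"
      using UU(2) x(1) by blast
    \<comment> \<open>A timelike vector of the plane involves both null eigenvectors; each
      difference eliminates one of them.\<close>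
    have "T x - l' *\<^sub>R x = (c * (l - l')) *\<^sub>R w" "T x - l *\<^sub>R x = (d * (l' - l)) *\<^sub>R w'"
      by (simp_all only: Tx) (simp_all add: cd algebra_simps)
    then have "(c * (l - l')) *\<^sub>R w \<in> U" "(d * (l' - l)) *\<^sub>R w' \<in> U"
      using \<open>T x \<in> U\<close> x(1) UU(1) by (metis subspace_diff subspace_scale)+
    then have "(1 / (c * (l - l'))) *\<^sub>R (c * (l - l')) *\<^sub>R w \<in> U" "(1 / (d * (l' - l))) *\<^sub>R (d * (l' - l)) *\<^sub>R w' \<in> U"
      using subspace_scale[OF UU(1)] by blast+
    then have "w \<in> U" "w' \<in> U"
      using \<open>c \<noteq> 0\<close> \<open>d \<noteq> 0\<close> l by simp_all
    then show "K \<subseteq> U"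
      unfolding K using UU(1) by (intro span_minimal) auto
  qed
  have "dim K \<le> j + 1" if "U \<in> GammaT i0 T j" for U j
    using dim_subset[OF KU[OF that]] that by (simp add: GammaT_def)
  then show "GammaT i0 T 0 = {}"
    using dimK by fastforce
  assume k: "1 \<le> k"
  have sum_inv: "set_sum K (?P ` U) = U" if U: "U \<in> GammaT i0 T k" for U
  proof -
    have sub: "subspace U"
      using U by (auto simp: GammaT_def)
    show ?thesis
    proof (intro equalityI subsetI)
      fix z assume "z \<in> set_sum K (?P ` U)"
      then obtain x y where "z = x + ?P y" "x \<in> K" "y \<in> U"
        by blast
      then show "z \<in> U"
        using KU[OF U] \<pi>(2)[of y] sub by (auto simp del: add_diff_eq intro!: subspace_add subspace_diff)
    next
      fix x assume "x \<in> U"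
      then show "x \<in> set_sum K (?P ` U)"
        using \<pi>(2)[of x] by (intro CollectI exI[of _ "\<pi> x"] exI[of _ "?P x"]) auto
    qed
  qed
  have dim_sum: "dim (set_sum K W) = 2 + dim W" if "subspace W" "W \<subseteq> lperp i0 K" for W
  proof -
    have "K \<inter> W = {0}"
      using that K_lperp_0 subspace_0 subspace_K by blast
    then show ?thesis
      using dim_sums_Int[OF subspace_K that(1)] dimK by simp
  qed
  have fwd: "?P ` U \<in> S_inv (lperp i0 K) T (k - 1)" if U: "U \<in> GammaT i0 T k" for U
  proof -
    have UU: "subspace U" "T ` U \<subseteq> U" "dim U = k + 1"
      using U by (auto simp: GammaT_def)
    have sub: "subspace (?P ` U)"
      using linear_subspace_image[OF P UU(1)] .
    have PK: "?P ` U \<subseteq> lperp i0 K"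
      using \<pi>(3) by blast
    have "dim U = 2 + dim (?P ` U)"
      using dim_sum[OF sub PK] unfolding sum_inv[OF U] .
    moreover have "T ` ?P ` U \<subseteq> ?P ` U"
    proof
      fix z assume "z \<in> T ` ?P ` U"
      then obtain x where x: "x \<in> U" "z = T (?P x)"
        by blast
      have "\<pi> x \<in> U"
        using KU[OF U] \<pi>(2) by blast
      then have "?P x \<in> U"
        using x(1) UU(1) by (blast intro: subspace_diff)
      then have "z \<in> U"
        using x(2) UU(2) by blast
      moreover have "z \<in> lperp i0 K"
        using x(2) T_lperp \<pi>(3)[of x] by blast
      then have "?P z = z"
        using \<pi>(4)[OF subspace_0[OF subspace_K], of z] by simp
      ultimately show "z \<in> ?P ` U"
        by (metis image_eqI)
    qed
    ultimately show ?thesis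
      using sub PK UU(3) by (simp add: S_inv_def)
  qed
  have P_sum: "?P ` set_sum K W = W" if "subspace W" "W \<subseteq> lperp i0 K" for W
  proof -
    have "?P ` set_sum K W = {?P (x + y) |x y. x \<in> K \<and> y \<in> W}"
      by blast
    also have "\<dots> = {y |x y. x \<in> K \<and> y \<in> W}"
      using \<pi>(4) that(2) by (metis (no_types, opaque_lifting) add_diff_cancel_left' subsetD)
    also have "\<dots> = W"
      using subspace_0[OF subspace_K] by blast
    finally show ?thesis .
  qed
  have bwd: "set_sum K W \<in> GammaT i0 T k" if W: "W \<in> S_inv (lperp i0 K) T (k - 1)" for W
  proof -
    have WW: "subspace W" "W \<subseteq> lperp i0 K" "dim W = k - 1" "T ` W \<subseteq> W"
      using W by (auto simp: S_inv_def)
    have sub: "subspace (set_sum K W)"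
      using subspace_sums[OF subspace_K WW(1)] .
    have "T ` set_sum K W \<subseteq> set_sum K W"
    proof
      fix z assume "z \<in> T ` set_sum K W"
      then obtain x y where "z = T (x + y)" "x \<in> K" "y \<in> W"
        by blast
      then have "z = T x + T y" "T x \<in> K" "T y \<in> W"
        using T_K WW(4) by (auto simp: linear_add[OF linear_T])
      then show "z \<in> set_sum K W"
        by blast
    qed
    then have "T ` set_sum K W = set_sum K W"
      using PO_image_eq[OF PO sub] by blast
    moreover have "\<exists>v\<in>set_sum K W. lform i0 v v < 0"
    proof -
      obtain v where "v \<in> K" "lform i0 v v < 0"
        using ex_timelike by blast
      then show ?thesis
        using subspace_0[OF WW(1)] by (intro bexI[of _ v] CollectI exI[of _ v] exI[of _ 0]) auto
    qed
    ultimately show ?thesis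
      using sub dim_sum[OF WW(1,2)] WW(3) k by (simp add: GammaT_def)
  qed
  have "homeomorphic_maps (subsp_top (GammaT i0 T k)) (subsp_top (S_inv (lperp i0 K) T (k - 1)))
      (\<lambda>U. ?P ` U) (\<lambda>W. set_sum K W)"
    unfolding homeomorphic_maps_def
  proof (intro conjI ballI)
    have "lsc_family (subsp_top (GammaT i0 T k)) (\<lambda>U. U)"
      by (rule lsc_family_subsp_top) (simp add: GammaT_def)
    from lsc_family_linear_image[OF this P]
    show "continuous_map (subsp_top (GammaT i0 T k)) (subsp_top (S_inv (lperp i0 K) T (k - 1))) (\<lambda>U. ?P ` U)"
      by (rule continuous_map_subsp_top) (use fwd in \<open>auto simp: S_inv_def\<close>)
    have "lsc_family (subsp_top (S_inv (lperp i0 K) T (k - 1))) (\<lambda>U. U)"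
      by (rule lsc_family_subsp_top) (simp add: S_inv_def)
    from lsc_family_sum[OF lsc_family_const this]
    show "continuous_map (subsp_top (S_inv (lperp i0 K) T (k - 1))) (subsp_top (GammaT i0 T k)) (\<lambda>W. set_sum K W)"
      by (rule continuous_map_subsp_top) (use bwd in \<open>auto simp: GammaT_def\<close>)
    show "set_sum K (?P ` U) = U" if "U \<in> topspace (subsp_top (GammaT i0 T k))" for U
      using sum_inv that by simp
    show "?P ` set_sum K W = W" if "W \<in> topspace (subsp_top (S_inv (lperp i0 K) T (k - 1)))" for W
      using P_sum[of W] that by (simp add: S_inv_def)
  qed
  then show "subsp_top (GammaT i0 T k) homeomorphic_space subsp_top (S_inv (lperp i0 K) T (k - 1))"
    unfolding homeomorphic_space_def by blast
qed

section \<open>The three types of isometries together\<close>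

theorem mainTheorem10:
  fixes i0 :: "'n::finite" and T :: "real^'n \<Rightarrow> real^'n"
    and m0 :: "'m::finite" and p0 :: "'p::finite"
  assumes "PO i0 T"
  defines "r \<equiv> dim (Vt i0 T)"
  shows
   "(elliptic i0 T \<and> CARD('m) = r \<longrightarrow>
      (\<forall>k. subsp_top (GammaT i0 T k) homeomorphic_space
        sum_topology (\<lambda>(k1, k2). prod_topology (subsp_top (GrH m0 k1)) (subsp_top (S_inv (Vs i0 T) T k2)))
          {(k1, k2). k1 + k2 = k}))
  \<and> (parabolic i0 T \<longrightarrow>
      GammaT i0 T 0 = {} \<and> GammaT i0 T 1 = {} \<and> 3 \<le> r \<and>
      (CARD('p) = r - 2 \<longrightarrow>
        (\<forall>k\<ge>2. subsp_top (GammaT i0 T k) homeomorphic_space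
          sum_topology (\<lambda>(k1, k2). prod_topology (subsp_top (GrE p0 k1)) (subsp_top (S_inv (Vs i0 T) T k2)))
            {(k1, k2). k1 + k2 = k - 2})))
  \<and> (hyperbolic i0 T \<longrightarrow>
      GammaT i0 T 0 = {} \<and>
      (\<forall>k\<ge>1. subsp_top (GammaT i0 T k) homeomorphic_space subsp_top (S_inv (Vs i0 T) T (k - 1))))"
proof -
  obtain w l where w: "w \<noteq> 0" "lform i0 w w \<le> 0" "l > 0" "T w = l *\<^sub>R w"
    using PO_causal_eigenvector[OF assms(1)] by metis
  show ?thesis
  \<comment> \<open>The eigenvalue of the causal eigenvector decides the type: for
    \<open>l = 1\<close> the action on \<open>Vt\<close> is unipotent, hence elliptic or parabolic,
    and otherwise \<open>T\<close> is hyperbolic.\<close>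
  proof (cases "l = 1")
    case True
    then have "T w = w"
      using w(4) by simp
    then obtain g where g: "lorentz_splitting i0 T (Vt i0 T) g" "Vs i0 T = lperp i0 (Vt i0 T)"
      "unipotent_on (Vt i0 T) T" "w \<in> Vt i0 T"
      using fixed_causal_splitting[OF assms(1) w(1,2)] by metis
    interpret lorentz_splitting i0 T "Vt i0 T" g
      by (rule g(1))
    have "\<not> hyperbolic i0 T"
      using g(3) by (auto simp: hyperbolic_def parabolic_def)
    moreover have "GammaT i0 T 0 = {} \<and> GammaT i0 T 1 = {} \<and> 3 \<le> r \<and>
      (CARD('p) = r - 2 \<longrightarrow>
        (\<forall>k\<ge>2. subsp_top (GammaT i0 T k) homeomorphic_space
          sum_topology (\<lambda>(k1, k2). prod_topology (subsp_top (GrE p0 k1)) (subsp_top (S_inv (Vs i0 T) T k2)))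
            {(k1, k2). k1 + k2 = k - 2}))" if "parabolic i0 T"
    proof -
      interpret parabolic_splitting i0 T "Vt i0 T" g w
        by unfold_locales (use that w g \<open>T w = w\<close> in \<open>auto simp: parabolic_def elliptic_def\<close>)
      show ?thesis
        using parabolic_dims parabolic_homeomorphic[where ?p0.0 = p0] unfolding r_def g(2) by blast
    qed
    moreover have "subsp_top (GammaT i0 T k) homeomorphic_space
        sum_topology (\<lambda>(k1, k2). prod_topology (subsp_top (GrH m0 k1)) (subsp_top (S_inv (Vs i0 T) T k2)))
          {(k1, k2). k1 + k2 = k}" if "elliptic i0 T" "CARD('m) = r" for k
      using elliptic_homeomorphic[where ?m0.0 = m0 and k = k] that unfolding elliptic_def r_def g(2) by blast
    ultimately show ?thesis
      by blast
  next
    case False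
    obtain g w' where g: "lorentz_splitting i0 T (Vt i0 T) g" "Vs i0 T = lperp i0 (Vt i0 T)"
      and w': "T w' = (1 / l) *\<^sub>R w'" "lform i0 w w = 0" "lform i0 w' w' = 0" "lform i0 w w' \<noteq> 0"
        "Vt i0 T = span {w, w'}"
      using moved_null_splitting[OF assms(1) w(1,2,4,3) False] by metis
    interpret lorentz_splitting i0 T "Vt i0 T" g
      by (rule g(1))
    have wt: "w \<in> Vt i0 T"
      unfolding w'(5) by (simp add: span_base)
    have "((\<lambda>y. T y - y) ^^ N) w = ((l - 1) ^ N) *\<^sub>R w" for N
      by (induction N) (simp_all add: w(4) linear_cmul[OF linear_T] algebra_simps)
    then have "\<not> unipotent_on (Vt i0 T) T"
      using wt w(1) False by (auto simp: unipotent_on_def intro!: bexI[of _ w])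
    moreover have "\<not> elliptic i0 T"
    proof -
      have "T w \<noteq> w"
        using w(1,4) False by (metis scaleR_cancel_right scaleR_one)
      then show ?thesis
        using wt by (auto simp: elliptic_def)
    qed
    moreover have "l \<noteq> 1 / l"
    proof
      assume "l = 1 / l"
      then have "l\<^sup>2 = 1"
        using w(3) by (simp add: power2_eq_square field_simps)
      then show False
        using w(3) False by (simp add: power2_eq_1_iff)
    qed
    ultimately show ?thesis
      using hyperbolic_homeomorphic[OF _ w(4) w'] unfolding parabolic_def g(2) by blast
  qed
qed

end
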